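(* Let $\alpha = \alpha(N) \in (0,1)$. If $\alpha^2 N \to \infty$ as $N \to \infty$, then \[ f_N(\alpha) = (1+o(1))\alpha^2 N \quad (N\to\infty). \]
   Context: For a positive integer $N$, $[N] := \{1,2,\dots,N\}$. For a finite set $A$ of integers and an integer $d$, $r_{A-A}(d) := \#\{(a,a') \in A\times A : d = a - a'\}$. For $\alpha \in (0,1)$, $f_N(\alpha) := \min\{ \max_{1 \le d < N} r_{A-A}(d) : A \subseteq [N],\ |A| \ge \alpha N\}$. *)

theory Defs
  imports Complex_Main "HOL-Library.Landau_Symbols"
begin

definition diff_rep :: "int set \<Rightarrow> int \<Rightarrow> nat" where
  "diff_rep A d = card {(a, a'). a \<in> A \<and> a' \<in> A \<and> d = a - a'}"

text \<open>For \<open>N \<ge> 2\<close> and \<open>\<alpha> \<le> 1\<close> both extrema range over finite nonempty sets. For \<open>N \<le> 1\<close> there is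
  no admissible \<open>d\<close>, and the value is unspecified.\<close>

definition min_max_diff_rep :: "nat \<Rightarrow> real \<Rightarrow> nat" where
  "min_max_diff_rep N \<alpha> =
     Min {Max {diff_rep A d | d. 1 \<le> d \<and> d < int N} | A.
            A \<subseteq> {1..int N} \<and> real (card A) \<ge> \<alpha> * real N}"

end

theory Submission
  imports Defs
    "HOL-Algebra.Algebraic_Closure"
    "HOL-Complex_Analysis.Complex_Analysis"
    "HOL-Probability.Probability"
    "HOL-Number_Theory.Number_Theory"
    "HOL-Real_Asymp.Real_Asymp"
begin

text \<open>
  Lower bound: average the square of \<open>card (A \<inter> {x+1..x+H})\<close> over all translates of a window of length
  \<open>H = \<delta> N\<close>. By Cauchy--Schwarz this is large, while expanding the square bounds it by the number of
  representations of differences.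

  Upper bound: put \<open>g = \<alpha>\<^sup>2 N\<close>. If \<open>g\<close> exceeds a large multiple of \<open>ln N\<close>, a random set of density slightly above
  \<open>\<alpha>\<close> works by a Chernoff bound. For smaller \<open>g\<close> take the Bose--Chowla Sidon set of size \<open>q\<close> modulo \<open>q\<^sup>2 - 1\<close> and
  reduce it modulo \<open>v = (q\<^sup>2 - 1) / g'\<close>, where \<open>g'\<close> divides \<open>q - 1\<close>: every nonzero difference has at most \<open>g'\<close>
  representations, and \<open>q\<^sup>2 / v\<close> is about \<open>g'\<close>. One needs \<open>g'\<close> close to \<open>g\<close> and \<open>q\<close> close to \<open>(g N)\<^sup>1\<^sup>/\<^sup>2\<close>. The divisibility is
  forced by taking \<open>q = p\<^sup>f\<close>, where \<open>f\<close> is a multiple of the exponent of the unit group modulo \<open>g'\<close>; choosing \<open>g'\<close> to be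
  \<open>lcm(1..m)\<close> times the product of the primes up to \<open>m\<close>, times a small factor, keeps \<open>f\<close> near \<open>g\<^sup>1\<^sup>/\<^sup>2\<close>. The size of \<open>q\<close> is then tuned by the
  choice of \<open>p\<close>, for which it suffices that there is a prime \<open>p\<close> with \<open>\<bar>ln p - L\<bar> \<le> L\<^sup>-\<^sup>7\<^sup>/\<^sup>5\<close> for all large \<open>L\<close>.
  The latter follows from polynomial bounds for \<open>\<zeta>\<close> and \<open>1/\<zeta>\<close> to the right of the line \<open>Re s = 1\<close>, by weighting
  \<open>\<Lambda>(n) (ln n)\<^sup>2 n\<^sup>-\<^sup>\<sigma>\<close> with a Gaussian centred at \<open>ln n = L\<close>.
\<close>

section \<open>Dirichlet series and the zeta function\<close>

text \<open>The random construction stops where it does because a union bound over about N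
  differences needs failure probabilities exp(-c g) below 1/N. Below that range an algebraic set
  must fit both g and N up to a factor 1 + o(1), since any constant loss shows in the asymptotics. A
  prime q of prescribed size with g' dividing q - 1 would call for primes in progressions to a
  growing modulus; a prime power p^f gets the divisibility from Euler's theorem, and only the size
  of p is left to choose. The price is that an error in ln p is multiplied by f in ln q. With l = ln
  N and g of order l, f is about l^(1/2), and L = ln p is again about l^(1/2), so the error must be
  o(1/f), that is about L^(-1-c): closer than the prime number theorem without an error term gives.
  The exponents 57/100 and 7/5 leave room around these. The weight (ln n)^2 serves the same purpose:
  near n = e^L it lifts the main term of a window of width \<tau> from \<tau> to L^2 \<tau>, above
  the error \<tau>^(-1/4) even for \<tau> = L^(-3/2).\<close>

definition dirichlet_series :: "(nat \<Rightarrow> complex) \<Rightarrow> complex \<Rightarrow> complex" where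
  "dirichlet_series a s = (\<Sum>n. a n * of_nat n powr (-s))"

definition abs_conv_dirichlet :: "(nat \<Rightarrow> complex) \<Rightarrow> bool" where
  "abs_conv_dirichlet a \<longleftrightarrow> (\<forall>\<sigma>>1. summable (\<lambda>n. norm (a n) * real n powr (-\<sigma>)))"

text \<open>\<open>0 powr z\<close> is 0, so this and the series above may include n = 0 at no
  cost.\<close>

lemma norm_nat_powr: "norm (of_nat n powr (-s :: complex)) = real n powr (- Re s)"
  by (subst norm_powr_real_powr) auto

lemma abs_conv_dirichlet_summable_norm:
  assumes "abs_conv_dirichlet a" "Re s > 1"
  shows "summable (\<lambda>n. norm (a n * of_nat n powr (-s)))"
  using assms by (simp add: abs_conv_dirichlet_def norm_mult norm_nat_powr)

lemma abs_conv_dirichlet_summable: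
  assumes "abs_conv_dirichlet a" "Re s > 1"
  shows "summable (\<lambda>n. a n * of_nat n powr (-s))"
  using abs_conv_dirichlet_summable_norm[OF assms] by (rule summable_norm_cancel)

lemma abs_conv_dirichlet_const: "abs_conv_dirichlet (\<lambda>n. 1)"
  by (simp add: abs_conv_dirichlet_def summable_real_powr_iff)

lemma abs_conv_dirichlet_bound:
  assumes "abs_conv_dirichlet b" "\<And>n. norm (a n) \<le> norm (b n)"
  shows "abs_conv_dirichlet a"
  unfolding abs_conv_dirichlet_def
proof (intro allI impI)
  fix \<sigma> :: real assume "\<sigma> > 1"
  then have "summable (\<lambda>n. norm (b n) * real n powr (-\<sigma>))"
    using assms(1) by (auto simp: abs_conv_dirichlet_def)
  then show "summable (\<lambda>n. norm (a n) * real n powr (-\<sigma>))"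
    by (rule summable_comparison_test') (auto intro!: mult_right_mono assms(2) simp: abs_mult)
qed

text \<open>Lowering \<sigma> to a point still right of 1 frees a factor n^(-e), which absorbs the
  logarithm. This is why absolute convergence is asked on the whole open half-line and not at one
  point.\<close>

lemma abs_conv_dirichlet_ln:
  assumes "abs_conv_dirichlet a"
  shows "abs_conv_dirichlet (\<lambda>n. a n * of_real (ln (real n)))"
  unfolding abs_conv_dirichlet_def
proof (intro allI impI)
  fix \<sigma> :: real assume s: "\<sigma> > 1"
  define e where "e = (\<sigma> - 1) / 2"
  have e: "e > 0" "\<sigma> - e > 1" using s by (auto simp: e_def field_simps)
  have "summable (\<lambda>n. norm (a n) * real n powr (-(\<sigma> - e)) * (1 / e))"
    using assms e(2) unfolding abs_conv_dirichlet_def by (intro summable_mult2) blast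
  then show "summable (\<lambda>n. norm (a n * of_real (ln (real n))) * real n powr (-\<sigma>))"
  proof (rule summable_comparison_test')
    fix n :: nat assume "n \<ge> 0"
    show "norm (norm (a n * of_real (ln (real n))) * real n powr (-\<sigma>))
      \<le> norm (a n) * real n powr (-(\<sigma> - e)) * (1 / e)"
    proof (cases "n = 0")
      case False
      then have "ln (real n) \<le> real n powr e / e" "ln (real n) \<ge> 0"
        using ln_powr_bound[of "real n" e] e by auto
      then have "ln (real n) * real n powr (-\<sigma>) \<le> real n powr e / e * real n powr (-\<sigma>)"
        by (intro mult_right_mono) auto
      also have "\<dots> = real n powr (-(\<sigma> - e)) * (1 / e)"
        by (simp add: powr_add[symmetric])
      finally have "norm (a n) * (ln (real n) * real n powr (-\<sigma>)) \<le> norm (a n) * (real n powr (-(\<sigma> - e)) * (1 / e))"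
        by (intro mult_left_mono) auto
      then show ?thesis using \<open>ln (real n) \<ge> 0\<close> by (simp add: norm_mult mult_ac)
    qed auto
  qed
qed

lemma has_field_derivative_nat_powr:
  "((\<lambda>s. of_nat n powr (-s)) has_field_derivative - (of_real (ln (real n)) * of_nat n powr (-s))) (at (s::complex))"
proof (cases "n = 0")
  case False
  have "((\<lambda>s. exp (- s * of_real (ln (real n)))) has_field_derivative
     - (of_real (ln (real n)) * exp (- s * of_real (ln (real n))))) (at s)"
    by (auto intro!: derivative_eq_intros)
  moreover have "of_nat n powr (-s) = exp (- s * of_real (ln (real n)))" for s :: complex
    using False Ln_of_real[of "real n"] by (simp add: powr_def)
  ultimately show ?thesis by simp
qed auto

lemma has_field_derivative_dirichlet_series:
  assumes a: "abs_conv_dirichlet a" and s: "Re s > 1"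
  shows "(dirichlet_series a has_field_derivative
    - dirichlet_series (\<lambda>n. a n * of_real (ln (real n))) s) (at s)"
proof -
  define S where "S = {s :: complex. Re s > 1}"
  have S: "open S" unfolding S_def by (simp add: open_halfspace_Re_gt)
  obtain g g' where g: "\<forall>x\<in>S. ((\<lambda>n. a n * of_nat n powr (-x)) sums g x) \<and>
     ((\<lambda>n. a n * (- (of_real (ln (real n)) * of_nat n powr (-x)))) sums g' x) \<and> (g has_field_derivative g' x) (at x)"
  proof (atomize_elim, rule series_and_derivative_comparison_complex[OF S])
    fix n x show "((\<lambda>x. a n * of_nat n powr (-x)) has_field_derivative a n * - (of_real (ln (real n)) * of_nat n powr (-x))) (at x)"
      by (intro DERIV_cmult has_field_derivative_nat_powr)
  next
    fix x assume x: "x \<in> S"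
    \<comment> \<open>Half the distance to the line Re s = 1, so that on the whole disc one
      convergent series at \<open>Re x - d > 1\<close> dominates.\<close>
    define d where "d = (Re x - 1) / 2"
    have d: "d > 0" "Re x - d > 1" using x by (auto simp: d_def S_def field_simps)
    show "\<exists>d h. 0 < d \<and> summable h \<and> range h \<subseteq> \<real>\<^sub>\<ge>\<^sub>0 \<and>
      (\<forall>\<^sub>F n in sequentially. \<forall>y\<in>ball x d \<inter> S. cmod (a n * of_nat n powr (-y)) \<le> cmod (h n))"
    proof (intro exI[of _ d] exI[of _ "\<lambda>n. of_real (norm (a n) * real n powr (-(Re x - d)))"] conjI)
      have "summable (\<lambda>n. norm (a n) * real n powr (-(Re x - d)))"
        using a d unfolding abs_conv_dirichlet_def by blast
      then show "summable (\<lambda>n. complex_of_real (norm (a n) * real n powr (-(Re x - d))))"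
        by (simp only: summable_of_real_iff)
      show "\<forall>\<^sub>F n in sequentially. \<forall>y\<in>ball x d \<inter> S. cmod (a n * of_nat n powr (-y)) \<le>
         cmod (complex_of_real (norm (a n) * real n powr (-(Re x - d))))"
      proof (rule eventually_mono[OF eventually_gt_at_top[of "0::nat"]], intro ballI)
        fix n :: nat and y assume n: "n > 0" and y: "y \<in> ball x d \<inter> S"
        have "Re x - Re y \<le> d" using y abs_Re_le_cmod[of "x - y"] by (auto simp: dist_norm)
        then have "real n powr (- Re y) \<le> real n powr (-(Re x - d))"
          using n by (intro powr_mono) auto
        then show "cmod (a n * of_nat n powr (-y)) \<le> cmod (complex_of_real (norm (a n) * real n powr (-(Re x - d))))"
          by (simp add: norm_mult norm_nat_powr mult_left_mono)
      qed
    qed (use d in auto)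
  qed
  have eq: "g x = dirichlet_series a x" if "x \<in> S" for x
    using g that unfolding dirichlet_series_def by (auto simp: sums_iff)
  have "((\<lambda>n. - (a n * of_real (ln (real n)) * of_nat n powr (-s))) sums g' s)"
    using g s by (auto simp: S_def mult.assoc)
  then have "(\<lambda>n. a n * of_real (ln (real n)) * of_nat n powr (-s)) sums (- g' s)"
    using sums_minus by fastforce
  then have "g' s = - dirichlet_series (\<lambda>n. a n * of_real (ln (real n))) s"
    unfolding dirichlet_series_def by (auto simp: sums_iff)
  moreover have "(g has_field_derivative g' s) (at s)" using g s by (auto simp: S_def)
  ultimately show ?thesis
    using has_field_derivative_transform_within_open[OF _ S _ eq] s by (auto simp: S_def)
qed

lemma mangoldt_le_ln: "(mangoldt n :: real) \<le> ln (real n)"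
proof (cases "n = 0")
  case False
  have "(mangoldt n :: real) \<le> (\<Sum>d | d dvd n. mangoldt d)"
    using False by (intro member_le_sum) (auto simp: mangoldt_nonneg)
  then show ?thesis using mangoldt_sum[of n, where 'a = real] False by simp
qed auto

lemma abs_conv_dirichlet_mangoldt: "abs_conv_dirichlet mangoldt"
proof (rule abs_conv_dirichlet_bound[OF abs_conv_dirichlet_ln[OF abs_conv_dirichlet_const]])
  show "norm (mangoldt n :: complex) \<le> norm (1 * complex_of_real (ln (real n)))" for n
    using mangoldt_le_ln[of n] mangoldt_nonneg[of n] by simp
qed

text \<open>This is -zeta' = (-zeta'/zeta) zeta in coefficients: the sum of \<Lambda>(d) over d
  dividing n is ln n. Absolute convergence permits regrouping the product by n = d m.\<close>

lemma dirichlet_series_mangoldt_mult_zeta: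
  assumes s: "Re s > 1"
  shows "dirichlet_series mangoldt s * dirichlet_series (\<lambda>_. 1) s = dirichlet_series (\<lambda>n. of_real (ln (real n))) s"
proof -
  define u v where "u = (\<lambda>n. mangoldt n * of_nat n powr (-s))" and "v = (\<lambda>n::nat. of_nat n powr (-s))"
  have su: "summable (\<lambda>n. norm (u n))" and sv: "summable (\<lambda>n. norm (v n))"
    using abs_conv_dirichlet_summable_norm[OF abs_conv_dirichlet_mangoldt s]
      abs_conv_dirichlet_summable_norm[OF abs_conv_dirichlet_const s] by (auto simp: u_def v_def)
  have au: "(\<lambda>n. norm (u n)) summable_on {0<..}" and av: "(\<lambda>n. norm (v n)) summable_on {0<..}"
    using su sv by (auto intro!: summable_on_subset_banach[OF summable_nonneg_imp_summable_on] )
  have hu: "(u has_sum dirichlet_series mangoldt s) {0<..}"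
  proof -
    have "(u has_sum suminf u) UNIV"
      by (rule norm_summable_imp_has_sum[OF su]) (use su in \<open>auto intro: summable_sums summable_norm_cancel\<close>)
    then show ?thesis
      by (subst has_sum_cong_neutral[of UNIV "{0<..}" u u]) (auto simp: dirichlet_series_def u_def)
  qed
  have hv: "(v has_sum dirichlet_series (\<lambda>_. 1) s) {0<..}"
  proof -
    have "(v has_sum suminf v) UNIV"
      by (rule norm_summable_imp_has_sum[OF sv]) (use sv in \<open>auto intro: summable_sums summable_norm_cancel\<close>)
    then show ?thesis
      by (subst has_sum_cong_neutral[of UNIV "{0<..}" v v]) (auto simp: dirichlet_series_def v_def)
  qed
  have "(\<lambda>x. norm ((\<lambda>(d,m). u d * v m) x)) summable_on {0<..} \<times> {0<..}"
    using au av by (subst Infinite_Sum.abs_summable_on_Sigma_iff)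
     (auto simp: norm_mult infsum_cmult_right' abs_mult infsum_nonneg intro!: summable_on_cmult_left summable_on_cmult_right)
  then have sumon: "(\<lambda>(d,m). u d * v m) summable_on {0<..} \<times> {0<..}"
    by (rule abs_summable_summable)
  have prod: "((\<lambda>(d,m). u d * v m) has_sum (dirichlet_series mangoldt s * dirichlet_series (\<lambda>_. 1) s)) ({0<..} \<times> {0<..})"
    by (rule has_sum_SigmaI[OF _ _ sumon, where g = "\<lambda>d. u d * dirichlet_series (\<lambda>_. 1) s"])
      (auto intro!: has_sum_cmult_right has_sum_cmult_left hu hv)
  have "((\<lambda>(n,d). mangoldt d * of_nat n powr (-s)) has_sum
     (dirichlet_series mangoldt s * dirichlet_series (\<lambda>_. 1) s)) (Sigma {0<..} (\<lambda>n. {d. d dvd n}))"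
  proof -
    \<comment> \<open>The pair (d, m) is traded for (d m, d); positive indices make this a
      bijection.\<close>
    have bij: "bij_betw (\<lambda>(d,m). (d * m, d)) ({0<..} \<times> {0<..}) (Sigma {0<..} (\<lambda>n::nat. {d. d dvd n}))"
      by (rule bij_betwI[of _ _ _ "\<lambda>(n,d). (d, n div d)"]) (auto simp: dvd_div_eq_0_iff dvd_pos_nat intro!: Nat.gr0I dest: dvd_imp_le)
    have "((\<lambda>x. (\<lambda>(n,d). mangoldt d * of_nat n powr (-s)) ((\<lambda>(d,m). (d * m, d)) x)) has_sum
       (dirichlet_series mangoldt s * dirichlet_series (\<lambda>_. 1) s)) ({0<..} \<times> {0<..})"
      by (rule has_sum_cong[THEN iffD1, OF _ prod]) (auto simp: u_def v_def powr_times_real)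
    then show ?thesis by (subst (asm) has_sum_reindex_bij_betw[OF bij])
  qed
  then have "((\<lambda>n. of_real (ln (real n)) * of_nat n powr (-s)) has_sum (dirichlet_series mangoldt s * dirichlet_series (\<lambda>_. 1) s)) {0<..}"
  proof (rule has_sum_SigmaD)
    fix n :: nat assume n: "n \<in> {0<..}"
    have "((\<lambda>d. mangoldt d * of_nat n powr (-s)) has_sum (\<Sum>d | d dvd n. mangoldt d * of_nat n powr (-s))) {d. d dvd n}"
      using n by (intro has_sum_finite) auto
    also have "(\<Sum>d | d dvd n. mangoldt d * of_nat n powr (-s)) = of_real (ln (real n)) * of_nat n powr (-s)"
      using n by (simp add: sum_distrib_right[symmetric] mangoldt_sum)
    finally show "((\<lambda>y. case (n, y) of (n, d) \<Rightarrow> mangoldt d * of_nat n powr (-s)) has_sum of_real (ln (real n)) * of_nat n powr (-s)) {d. d dvd n}"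
      by simp
  qed
  then have "((\<lambda>n. of_real (ln (real n)) * of_nat n powr (-s)) has_sum (dirichlet_series mangoldt s * dirichlet_series (\<lambda>_. 1) s)) UNIV"
    by (subst has_sum_cong_neutral[of "{0<..}" UNIV _ "\<lambda>n. of_real (ln (real n)) * of_nat n powr (-s)"]) auto
  from has_sum_imp_sums[OF this] show ?thesis
    by (auto simp: dirichlet_series_def sums_iff)
qed

abbreviation zeta :: "complex \<Rightarrow> complex" where "zeta \<equiv> dirichlet_series (\<lambda>_. 1)"

lemma has_field_derivative_zeta:
  assumes "Re s > 1"
  shows "(zeta has_field_derivative - (dirichlet_series mangoldt s * zeta s)) (at s)"
  using has_field_derivative_dirichlet_series[OF abs_conv_dirichlet_const assms]
    dirichlet_series_mangoldt_mult_zeta[OF assms] by simp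

text \<open>What matters is the consequence zeta(s) -> 1 as Re s -> \<infinity>: it normalizes the
  monotone quantity in \<open>zeta_341\<close>.\<close>

lemma norm_zeta_minus_1_le:
  assumes "Re s \<ge> 2"
  shows "norm (zeta s - 1) \<le> 2 powr (2 - Re s) * (\<Sum>n. real n powr (-2))"
proof -
  have sm: "summable (\<lambda>n. of_nat n powr (-s))"
    using abs_conv_dirichlet_summable[OF abs_conv_dirichlet_const, of s] assms by simp
  have s2: "summable (\<lambda>n. 2 powr (2 - Re s) * real n powr (-2))"
    by (intro summable_mult) (simp add: summable_real_powr_iff)
  have "zeta s - 1 = (\<Sum>n. of_nat n powr (-s)) - (\<Sum>n. if n = (1::nat) then 1 else 0)"
    using sums_single[of 1 "\<lambda>_. 1::complex"] by (simp add: dirichlet_series_def sums_iff)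
  also have "\<dots> = (\<Sum>n. of_nat n powr (-s) - (if n = 1 then 1 else 0))"
    by (intro suminf_diff sm) auto
  finally have eq: "zeta s - 1 = (\<Sum>n. of_nat n powr (-s) - (if n = 1 then 1 else 0))" .
  have "norm (\<Sum>n. of_nat n powr (-s) - (if n = 1 then 1 else 0 :: complex)) \<le> (\<Sum>n. 2 powr (2 - Re s) * real n powr (-2))"
  proof (rule norm_suminf_le[OF _ s2])
    fix n :: nat
    consider "n = 0" | "n = 1" | "n \<ge> 2" by linarith
    then show "norm (of_nat n powr (-s) - (if n = 1 then 1 else 0 :: complex)) \<le> 2 powr (2 - Re s) * real n powr (-2)"
    proof cases
      case 3
      have "real n powr (- Re s) = real n powr (2 - Re s) * real n powr (-2)"
        using 3 by (simp add: powr_add[symmetric])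
      also have "\<dots> \<le> 2 powr (2 - Re s) * real n powr (-2)"
        using 3 assms by (intro mult_right_mono powr_mono2') auto
      finally show ?thesis using 3 by (simp add: norm_nat_powr)
    qed auto
  qed
  also have "\<dots> = 2 powr (2 - Re s) * (\<Sum>n. real n powr (-2))"
    by (rule suminf_mult) (simp add: summable_real_powr_iff)
  finally show ?thesis by (simp add: eq)
qed

section \<open>The 3-4-1 inequality for zeta\<close>

lemma Re_nat_powr: "Re (of_nat n powr (-s)) = real n powr (- Re s) * cos (Im s * ln (real n))"
proof (cases "n = 0")
  case False
  then have "of_nat n powr (-s) = exp (- s * of_real (ln (real n)))"
    using Ln_of_real[of "real n"] by (simp add: powr_def)
  then show ?thesis using False by (simp add: Re_exp powr_def mult.commute)
qed auto

text \<open>In each term 3 + 4 cos u + cos 2u = 2 (1 + cos u)^2, and \<Lambda> is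
  nonnegative.\<close>

lemma Re_mangoldt_341_nonneg:
  assumes "x > 1"
  shows "Re (3 * dirichlet_series mangoldt (of_real x) + 4 * dirichlet_series mangoldt (Complex x t)
     + dirichlet_series mangoldt (Complex x (2 * t))) \<ge> 0"
proof -
  have S: "(\<lambda>n. mangoldt n * (real n powr (-x) * cos (y * ln (real n)))) sums Re (dirichlet_series mangoldt (Complex x y))" for y
  proof -
    have "(\<lambda>n. mangoldt n * of_nat n powr (- Complex x y)) sums dirichlet_series mangoldt (Complex x y)"
      unfolding dirichlet_series_def using abs_conv_dirichlet_summable[OF abs_conv_dirichlet_mangoldt, of "Complex x y"] assms
      by (intro summable_sums) auto
    then have "(\<lambda>n. Re (mangoldt n * of_nat n powr (- Complex x y))) sums Re (dirichlet_series mangoldt (Complex x y))"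
      by (rule sums_Re)
    then show ?thesis by (simp add: Re_nat_powr)
  qed
  have "(\<lambda>n. 3 * (mangoldt n * (real n powr (-x) * cos (0 * ln (real n)))) + 4 * (mangoldt n * (real n powr (-x) * cos (t * ln (real n))))
     + mangoldt n * (real n powr (-x) * cos (2 * t * ln (real n)))) sums
     (3 * Re (dirichlet_series mangoldt (Complex x 0)) + 4 * Re (dirichlet_series mangoldt (Complex x t))
     + Re (dirichlet_series mangoldt (Complex x (2 * t))))"
    by (intro sums_add sums_mult S)
  moreover have "0 \<le> 3 * (mangoldt n * (real n powr (-x) * cos (0 * ln (real n)))) + 4 * (mangoldt n * (real n powr (-x) * cos (t * ln (real n))))
     + mangoldt n * (real n powr (-x) * cos (2 * t * ln (real n)))" for n
  proof -
    have c: "cos (2 * t * ln (real n)) = 2 * (cos (t * ln (real n)))\<^sup>2 - 1"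
      by (metis cos_double_cos mult.assoc)
    have "3 * (mangoldt n * (real n powr (-x) * cos (0 * ln (real n)))) + 4 * (mangoldt n * (real n powr (-x) * cos (t * ln (real n))))
     + mangoldt n * (real n powr (-x) * cos (2 * t * ln (real n))) = mangoldt n * real n powr (-x) * (2 * (1 + cos (t * ln (real n)))\<^sup>2)"
      unfolding c by (simp add: power2_eq_square algebra_simps)
    then show ?thesis by (simp add: mangoldt_nonneg)
  qed
  ultimately have "0 \<le> 3 * Re (dirichlet_series mangoldt (Complex x 0)) + 4 * Re (dirichlet_series mangoldt (Complex x t))
     + Re (dirichlet_series mangoldt (Complex x (2 * t)))"
    by (rule sums_le[OF _ sums_zero, rotated])
  moreover have "Complex x 0 = of_real x" by (simp add: complex_eq_iff)
  ultimately show ?thesis by simp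
qed

text \<open>Differentiation replaces the usual logarithm of zeta. The derivative of |\<Phi>|^2 along
  the real axis is -2 |\<Phi>|^2 Re K, which is at most 0 by \<open>Re_mangoldt_341_nonneg\<close>;
  hence |\<Phi>| decreases to its limit 1 at infinity and is at least 1 everywhere. In particular
  zeta has no zero with Re s > 1.\<close>

lemma zeta_341:
  assumes "x > 1"
  shows "1 \<le> norm (zeta (of_real x)) ^ 3 * norm (zeta (Complex x t)) ^ 4 * norm (zeta (Complex x (2 * t)))"
proof -
  define \<Phi> where "\<Phi> = (\<lambda>z. zeta z ^ 3 * zeta (z + Complex 0 t) ^ 4 * zeta (z + Complex 0 (2 * t)))"
  define K where "K = (\<lambda>x. 3 * dirichlet_series mangoldt (of_real x) + 4 * dirichlet_series mangoldt (Complex x t)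
     + dirichlet_series mangoldt (Complex x (2 * t)))"
  have cx: "of_real y + Complex 0 u = Complex y u" for y u by (simp add: complex_eq_iff)
  have d: "((\<lambda>z. zeta (z + c)) has_field_derivative - (dirichlet_series mangoldt (z + c) * zeta (z + c))) (at z)"
    if "Re (z + c) > 1" for z c
    using has_field_derivative_zeta[OF that] DERIV_shift by blast
  have "(\<Phi> has_field_derivative - (\<Phi> (of_real y) * K y)) (at (of_real y))" if "y > 1" for y
  proof -
    note D = DERIV_mult[OF DERIV_mult[OF DERIV_power[OF has_field_derivative_zeta[of "of_real y"], of 3]
       DERIV_power[OF d[of "of_real y" "Complex 0 t"], of 4]] d[of "of_real y" "Complex 0 (2 * t)"]]
    show ?thesis unfolding \<Phi>_def
      by (rule DERIV_cong[OF D]) (use that in \<open>simp_all add: cx K_def eval_nat_numeral algebra_simps\<close>)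
  qed
  then have dv: "((\<lambda>y. \<Phi> (of_real y)) has_vector_derivative - (\<Phi> (of_real y) * K y)) (at y)" if "y > 1" for y
    using that by (intro has_vector_derivative_real_field) auto
  have dn: "((\<lambda>y. (Re (\<Phi> (of_real y)))\<^sup>2 + (Im (\<Phi> (of_real y)))\<^sup>2) has_real_derivative
     - 2 * (norm (\<Phi> (of_real y)))\<^sup>2 * Re (K y)) (at y)" if "y > 1" for y
  proof -
    note D = DERIV_add[OF DERIV_power[OF has_field_derivative_Re[OF dv[OF that]], of 2]
       DERIV_power[OF has_field_derivative_Im[OF dv[OF that]], of 2]]
    show ?thesis
      by (rule DERIV_cong[OF D], unfold cmod_power2) (simp add: algebra_simps power2_eq_square)
  qed
  have mono: "(norm (\<Phi> (of_real y)))\<^sup>2 \<le> (norm (\<Phi> (of_real x)))\<^sup>2" if "y \<ge> x" for y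
  proof -
    have "(\<lambda>y. (Re (\<Phi> (of_real y)))\<^sup>2 + (Im (\<Phi> (of_real y)))\<^sup>2) x \<ge> (\<lambda>y. (Re (\<Phi> (of_real y)))\<^sup>2 + (Im (\<Phi> (of_real y)))\<^sup>2) y"
    proof (rule DERIV_nonpos_imp_nonincreasing[OF that])
      fix u assume u: "x \<le> u" "u \<le> y"
      have "Re (K u) \<ge> 0" using Re_mangoldt_341_nonneg[of u t] u assms by (simp add: K_def)
      then have "- 2 * (norm (\<Phi> (of_real u)))\<^sup>2 * Re (K u) \<le> 0" by simp
      then show "\<exists>D. ((\<lambda>y. (Re (\<Phi> (of_real y)))\<^sup>2 + (Im (\<Phi> (of_real y)))\<^sup>2) has_real_derivative D) (at u) \<and> D \<le> 0"
        using dn[of u] u assms by (meson less_le_trans)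
    qed
    then show ?thesis by (simp add: cmod_power2)
  qed
  have lim1: "((\<lambda>y. zeta (of_real y + c)) \<longlongrightarrow> 1) at_top" if "Re c = 0" for c
  proof -
    have "((\<lambda>y. zeta (of_real y + c) - 1) \<longlongrightarrow> 0) at_top"
    proof (rule Lim_null_comparison)
      show "\<forall>\<^sub>F y in at_top. norm (zeta (of_real y + c) - 1) \<le> 2 powr (2 - y) * (\<Sum>n. real n powr (-2))"
        using eventually_ge_at_top[of 2]
      proof eventually_elim
        case (elim y)
        then show ?case using norm_zeta_minus_1_le[of "of_real y + c"] that by simp
      qed
      have "((\<lambda>y::real. 2 powr (2 - y)) \<longlongrightarrow> 0) at_top" by real_asymp
      then show "((\<lambda>y::real. 2 powr (2 - y) * (\<Sum>n. real n powr (-2))) \<longlongrightarrow> 0) at_top"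
        by (rule tendsto_mult_left_zero)
    qed
    then show ?thesis by (simp add: LIM_zero_iff)
  qed
  have "((\<lambda>y. \<Phi> (of_real y)) \<longlongrightarrow> 1 ^ 3 * 1 ^ 4 * 1) at_top"
    unfolding \<Phi>_def by (intro tendsto_intros lim1) (use lim1[of 0] in auto)
  then have "((\<lambda>y. (norm (\<Phi> (of_real y)))\<^sup>2) \<longlongrightarrow> (norm (1::complex))\<^sup>2) at_top"
    by (intro tendsto_intros) simp
  then have "(norm (1::complex))\<^sup>2 \<le> (norm (\<Phi> (of_real x)))\<^sup>2"
    by (rule tendsto_upperbound) (use mono in \<open>auto intro!: eventually_mono[OF eventually_ge_at_top[of x]]\<close>)
  then have "1 \<le> norm (\<Phi> (of_real x))"
    using power2_le_imp_le[of 1 "norm (\<Phi> (of_real x))"] by simp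
  then show ?thesis by (simp add: \<Phi>_def cx norm_mult norm_power)
qed

section \<open>Continuation of (s - 1) zeta(s) past Re s = 1 and its growth\<close>

text \<open>With \<open>a = n + 1\<close> this is \<open>s - 1\<close> times \<open>a\<^sup>-\<^sup>s\<close> minus the integral of \<open>x\<^sup>-\<^sup>s\<close> over \<open>{a..a+1}\<close>, so that \<open>zeta_reg\<close>
  continues \<open>(s - 1) \<zeta>(s)\<close> holomorphically to \<open>Re s > 0\<close>.\<close>

definition zterm :: "nat \<Rightarrow> complex \<Rightarrow> complex" where
  "zterm n s = (s - 1) * of_nat (Suc n) powr (-s) + of_nat (Suc (Suc n)) powr (1 - s) - of_nat (Suc n) powr (1 - s)"

definition zeta_reg :: "complex \<Rightarrow> complex" where
  "zeta_reg s = 1 + (\<Sum>n. zterm n s)"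

lemma convex_horizontal_segment: "convex {y. Im y = c \<and> a \<le> Re y \<and> Re y \<le> b}"
proof -
  have "{y. Im y = c \<and> a \<le> Re y \<and> Re y \<le> b} = (+) (Complex 0 c) ` of_real ` {a..b}"
    by (auto simp: image_iff complex_eq_iff)
  then show ?thesis
    using convex_translation[OF convex_linear_image[OF linear_of_real, of "{a..b}"], of "Complex 0 c"] by simp
qed

text \<open>The first bound is the triangle inequality, the second the mean value theorem: the first
  decays more slowly in \<open>a\<close>, the second pays a factor |s|. Both are kept because they
  are interpolated below. The real segment is treated as a subset of the complex plane so that
  complex derivatives apply.\<close>

lemma norm_powr_diff_le:
  fixes a :: real
  assumes a: "a \<ge> 1" and s: "Re s > 0" and y: "y \<in> {y. Im y = 0 \<and> a \<le> Re y \<and> Re y \<le> a + 1}"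
  shows "norm (of_real a powr (-s) - y powr (-s)) \<le> 2 * a powr (- Re s)"
    "norm (of_real a powr (-s) - y powr (-s)) \<le> norm s * a powr (- Re s - 1)"
proof -
  define S where "S = {y. Im y = 0 \<and> a \<le> Re y \<and> Re y \<le> a + 1}"
  have conv: "convex S" unfolding S_def by (rule convex_horizontal_segment)
  have nz: "norm (y powr w) = Re y powr Re w" if "y \<in> S" for y w
    using that a by (subst norm_powr_real_powr) (auto simp: S_def complex_is_Real_iff)
  have aS: "of_real a \<in> S" by (auto simp: S_def)
  have ys: "y \<in> S" using y by (simp add: S_def)
  have m: "Re z powr (- c) \<le> a powr (- c)" if "z \<in> S" "c > 0" for z c
    using that a by (intro powr_mono2') (auto simp: S_def)
  have "norm (of_real a powr (-s) - y powr (-s)) \<le> norm (of_real a powr (-s)) + norm (y powr (-s))"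
    by (rule norm_triangle_ineq4)
  also have "\<dots> \<le> a powr (- Re s) + a powr (- Re s)"
    using m[OF ys, of "Re s"] s by (simp add: nz[OF ys] nz[OF aS])
  finally show "norm (of_real a powr (-s) - y powr (-s)) \<le> 2 * a powr (- Re s)" by simp
  have le: "norm ((\<lambda>z. z powr (-s)) (of_real a) - (\<lambda>z. z powr (-s)) y) \<le> (norm s * a powr (- Re s - 1)) * norm (of_real a - y)"
  proof (rule field_differentiable_bound[OF conv _ _ aS ys])
    fix z assume z: "z \<in> S"
    then have "z \<notin> \<real>\<^sub>\<le>\<^sub>0" using a by (auto simp: S_def complex_nonpos_Reals_iff)
    then show "((\<lambda>z. z powr (-s)) has_field_derivative (- s) * z powr (- s - 1)) (at z within S)"
      by (rule has_field_derivative_at_within[OF has_field_derivative_powr])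
    show "norm ((- s) * z powr (- s - 1)) \<le> norm s * a powr (- Re s - 1)"
      using m[OF z, of "Re s + 1"] s by (auto simp: norm_mult nz[OF z] intro!: mult_left_mono)
  qed
  have "norm (of_real a - y) \<le> 1"
  proof -
    have "of_real a - y = of_real (a - Re y)" using ys by (auto simp: S_def complex_eq_iff)
    then show ?thesis using ys by (simp only: norm_of_real) (auto simp: S_def)
  qed
  then have "(norm s * a powr (- Re s - 1)) * norm (of_real a - y) \<le> (norm s * a powr (- Re s - 1)) * 1"
    by (intro mult_left_mono) auto
  with le show "norm (of_real a powr (-s) - y powr (-s)) \<le> norm s * a powr (- Re s - 1)"
    by simp
qed

text \<open>\<open>zterm n s\<close> is the increment over [a, a + 1] of a function h with h'(y) =
  (s - 1) (a^(-s) - y^(-s)), so each bound of \<open>norm_powr_diff_le\<close> carries over.\<close>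

lemma norm_zterm_le:
  assumes s: "Re s > 0"
  shows "norm (zterm n s) \<le> norm (s - 1) * (2 * real (Suc n) powr (- Re s))" (is ?A)
    "norm (zterm n s) \<le> norm (s - 1) * (norm s * real (Suc n) powr (- Re s - 1))" (is ?B)
proof -
  define a where "a = real (Suc n)"
  define S where "S = {y. Im y = 0 \<and> a \<le> Re y \<and> Re y \<le> a + 1}"
  have a: "a \<ge> 1" by (simp add: a_def)
  have conv: "convex S" unfolding S_def by (rule convex_horizontal_segment)
  define h where "h = (\<lambda>y. (s - 1) * of_real a powr (-s) * y + y powr (1 - s))"
  have z: "zterm n s = h (of_real (a + 1)) - h (of_real a)"
  proof -
    have "of_real a = (of_nat (Suc n) :: complex)" "of_real (a + 1) = (of_nat (Suc (Suc n)) :: complex)"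
      by (auto simp: a_def)
    then show ?thesis unfolding zterm_def h_def by (simp add: algebra_simps)
  qed
  have der: "(h has_field_derivative (s - 1) * (of_real a powr (-s) - y powr (-s))) (at y within S)" if "y \<in> S" for y
  proof -
    have "y \<notin> \<real>\<^sub>\<le>\<^sub>0" using a that by (auto simp: S_def complex_nonpos_Reals_iff)
    then have "((\<lambda>z. z powr (1 - s)) has_field_derivative (1 - s) * y powr (1 - s - 1)) (at y)"
      by (rule has_field_derivative_powr)
    then have "((\<lambda>z. z powr (1 - s)) has_field_derivative (1 - s) * y powr (- s)) (at y within S)"
      using has_field_derivative_at_within by fastforce
    from DERIV_add[OF DERIV_cmult[OF DERIV_ident, of "(s - 1) * of_real a powr (-s)" y S] this]
    show ?thesis unfolding h_def
      by (rule DERIV_cong) (simp add: algebra_simps)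
  qed
  have mem: "of_real a \<in> S" "of_real (a + 1) \<in> S" by (auto simp: S_def)
  have gen: "norm (zterm n s) \<le> norm (s - 1) * B" if "\<And>y. y \<in> S \<Longrightarrow> norm (of_real a powr (-s) - y powr (-s)) \<le> B" for B
  proof -
    have "norm (h (of_real (a + 1)) - h (of_real a)) \<le> (norm (s - 1) * B) * norm (of_real (a + 1) - of_real a :: complex)"
      by (rule field_differentiable_bound[OF conv der _ mem(2,1)])
        (auto simp: norm_mult intro!: mult_left_mono that)
    then show ?thesis by (simp add: z)
  qed
  show ?A unfolding a_def[symmetric] by (rule gen) (rule norm_powr_diff_le(1)[OF a s], simp add: S_def)
  show ?B unfolding a_def[symmetric] by (rule gen) (rule norm_powr_diff_le(2)[OF a s], simp add: S_def)
qed

text \<open>The geometric mean of the two bounds is still summable slightly to the left of \<open>Re s = 1\<close>, at the cost of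
  only \<open>\<bar>s\<bar>\<^sup>\<theta>\<close>.\<close>

lemma norm_zterm_interpolate:
  assumes s: "Re s > 0" and \<theta>: "0 \<le> \<theta>" "\<theta> \<le> 1"
  shows "norm (zterm n s) \<le> 2 * norm (s - 1) * norm s powr \<theta> * real (Suc n) powr (- Re s - \<theta>)"
proof (cases "zterm n s = 0")
  case False
  define B a where "B = norm (zterm n s)" and "a = real (Suc n)"
  have B: "B > 0" using False by (simp add: B_def)
  have s1: "norm (s - 1) > 0"
    using norm_zterm_le(1)[OF s, of n] B by (cases "s = 1") (auto simp: B_def)
  have s0: "norm s > 0" using s by auto
  have a: "a > 0" by (simp add: a_def)
  have "B = B powr (1 - \<theta>) * B powr \<theta>" using B by (simp add: powr_add[symmetric])
  also have "\<dots> \<le> (norm (s - 1) * (2 * a powr (- Re s))) powr (1 - \<theta>) * (norm (s - 1) * (norm s * a powr (- Re s - 1))) powr \<theta>"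
    using norm_zterm_le[OF s, of n] \<theta> B by (intro mult_mono powr_mono2) (auto simp: B_def a_def)
  also have "\<dots> = (norm (s - 1) powr (1 - \<theta>) * norm (s - 1) powr \<theta>) * 2 powr (1 - \<theta>) * norm s powr \<theta>
      * ((a powr (- Re s)) powr (1 - \<theta>) * (a powr (- Re s - 1)) powr \<theta>)"
    by (simp add: powr_mult mult_ac)
  also have "norm (s - 1) powr (1 - \<theta>) * norm (s - 1) powr \<theta> = norm (s - 1)"
    using s1 by (simp add: powr_add[symmetric])
  also have "(a powr (- Re s)) powr (1 - \<theta>) * (a powr (- Re s - 1)) powr \<theta> = a powr (- Re s - \<theta>)"
    using a by (simp add: powr_powr powr_add[symmetric] algebra_simps)
  also have "norm (s - 1) * 2 powr (1 - \<theta>) * norm s powr \<theta> * a powr (- Re s - \<theta>)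
     \<le> norm (s - 1) * 2 powr 1 * norm s powr \<theta> * a powr (- Re s - \<theta>)"
    using \<theta> by (intro mult_right_mono mult_left_mono powr_mono) auto
  finally show ?thesis by (simp add: B_def a_def mult_ac)
qed simp

lemma summable_Suc_powr: "c > 1 \<Longrightarrow> summable (\<lambda>n. real (Suc n) powr (-c))"
  using summable_Suc_iff[of "\<lambda>n. real n powr (-c)"] summable_real_powr_iff[of "-c"] by simp

lemma summable_zterm: "Re s > 0 \<Longrightarrow> summable (\<lambda>n. zterm n s)"
proof -
  assume s: "Re s > 0"
  have "summable (\<lambda>n. norm (s - 1) * (norm s * real (Suc n) powr (-(Re s + 1))))"
    using s by (intro summable_mult summable_Suc_powr) auto
  then show ?thesis
    by (rule summable_comparison_test') (use norm_zterm_le(2)[OF s] in simp)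
qed

lemma zeta_reg_eq:
  assumes s: "Re s > 1"
  shows "zeta_reg s = (s - 1) * zeta s"
proof -
  have "(\<lambda>k. \<Sum>n<k. zterm n s) \<longlonglongrightarrow> (\<Sum>n. zterm n s)"
    using summable_zterm[of s] s by (simp add: summable_LIMSEQ)
  \<comment> \<open>The powers with exponent 1 - s telescope; the first of them is 1 and cancels the
    1 in \<open>zeta_reg\<close>.\<close>
  moreover have "(\<Sum>n<k. zterm n s) = (s - 1) * (\<Sum>n<k. of_nat (Suc n) powr (-s)) + of_nat (Suc k) powr (1 - s) - 1" for k
    by (induction k) (auto simp: zterm_def algebra_simps)
  moreover have "(\<lambda>k. (s - 1) * (\<Sum>n<k. of_nat (Suc n) powr (-s)) + of_nat (Suc k) powr (1 - s) - 1) \<longlonglongrightarrow> (s - 1) * zeta s + 0 - 1"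
  proof (intro tendsto_intros)
    have "(\<lambda>n. of_nat n powr (-s)) sums zeta s"
      using abs_conv_dirichlet_summable[OF abs_conv_dirichlet_const s] by (simp add: dirichlet_series_def summable_sums)
    then have "(\<lambda>n. of_nat (Suc n) powr (-s)) sums zeta s"
      using sums_Suc_iff[of "\<lambda>n. of_nat n powr (-s)" "zeta s"] by simp
    then show "(\<lambda>k. \<Sum>n<k. of_nat (Suc n) powr (-s)) \<longlonglongrightarrow> zeta s" by (simp add: sums_def)
    have "(\<lambda>k. real (Suc k) powr (1 - Re s)) \<longlonglongrightarrow> 0" using s by real_asymp
    then show "(\<lambda>k. of_nat (Suc k) powr (1 - s)) \<longlonglongrightarrow> 0"
      by (rule Lim_null_comparison[rotated]) (auto simp: norm_powr_real_powr intro!: always_eventually)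
  qed
  ultimately have "(\<Sum>n. zterm n s) = (s - 1) * zeta s + 0 - 1"
    using LIMSEQ_unique by (metis (no_types, lifting) ext)
  then show ?thesis by (simp add: zeta_reg_def)
qed

lemma zeta_reg_holomorphic: "zeta_reg holomorphic_on {s. Re s > 0}"
proof -
  define S where "S = {s :: complex. Re s > 0}"
  have S: "open S" unfolding S_def by (simp add: open_halfspace_Re_gt)
  have "\<exists>g g'. \<forall>x\<in>S. ((\<lambda>n. zterm n x) sums g x) \<and> ((\<lambda>n. deriv (zterm n) x) sums g' x) \<and> (g has_field_derivative g' x) (at x)"
  proof (rule series_and_derivative_comparison_complex[OF S])
    fix n x
    have "zterm n holomorphic_on UNIV" unfolding zterm_def
      by (intro holomorphic_intros)
    then show "(zterm n has_field_derivative deriv (zterm n) x) (at x)"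
      by (auto intro!: holomorphic_derivI[of _ UNIV])
  next
    fix x assume x: "x \<in> S"
    define d where "d = Re x / 2"
    have d: "d > 0" using x by (auto simp: d_def S_def)
    define M where "M = (norm x + d + 1)\<^sup>2"
    show "\<exists>d h. 0 < d \<and> summable h \<and> range h \<subseteq> \<real>\<^sub>\<ge>\<^sub>0 \<and>
      (\<forall>\<^sub>F n in sequentially. \<forall>y\<in>ball x d \<inter> S. cmod (zterm n y) \<le> cmod (h n))"
    proof (intro exI[of _ d] exI[of _ "\<lambda>n. of_real (M * real (Suc n) powr (-(d + 1)))"] conjI)
      have "summable (\<lambda>n. M * real (Suc n) powr (-(d + 1)))"
        using d by (intro summable_mult summable_Suc_powr) auto
      then show "summable (\<lambda>n. complex_of_real (M * real (Suc n) powr (-(d + 1))))"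
        by (simp only: summable_of_real_iff)
      show "\<forall>\<^sub>F n in sequentially. \<forall>y\<in>ball x d \<inter> S. cmod (zterm n y) \<le> cmod (complex_of_real (M * real (Suc n) powr (-(d + 1))))"
      proof (intro always_eventually allI ballI)
        fix n y assume y: "y \<in> ball x d \<inter> S"
        have r: "Re y \<ge> d" using y abs_Re_le_cmod[of "x - y"] by (auto simp: dist_norm d_def)
        have ny: "norm y \<le> norm x + d" using y norm_triangle_sub[of y x] by (auto simp: dist_norm norm_minus_commute)
        have "cmod (zterm n y) \<le> norm (y - 1) * (norm y * real (Suc n) powr (- Re y - 1))"
          using y by (intro norm_zterm_le) (auto simp: S_def)
        also have "\<dots> \<le> (norm x + d + 1) * ((norm x + d + 1) * real (Suc n) powr (- (d + 1)))"
          using r d ny norm_triangle_ineq4[of y 1] by (intro mult_mono powr_mono) auto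
        finally show "cmod (zterm n y) \<le> cmod (complex_of_real (M * real (Suc n) powr (-(d + 1))))"
          unfolding norm_of_real by (simp add: M_def power2_eq_square abs_mult mult.assoc)
      qed
    qed (use d in \<open>auto simp: M_def\<close>)
  qed
  then obtain g g' where g: "\<forall>x\<in>S. ((\<lambda>n. zterm n x) sums g x) \<and> (g has_field_derivative g' x) (at x)"
    by blast
  have "g holomorphic_on S" using g S by (auto simp: holomorphic_on_open)
  then have "(\<lambda>x. 1 + g x) holomorphic_on S" by (intro holomorphic_intros)
  then show ?thesis unfolding S_def[symmetric]
    by (rule holomorphic_transform) (use g in \<open>auto simp: zeta_reg_def sums_iff\<close>)
qed

text \<open>For Re s \<ge> 1 - \<theta>/2 the interpolated exponent Re s + \<theta> is at least 1 +
  \<theta>/2, so the series converges uniformly. Of the growth exponent 1 + \<theta>, the 1 comes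
  from the factor s - 1 built into \<open>zeta_reg\<close>; zeta itself grows only with exponent
  \<theta>.\<close>

lemma norm_zeta_reg_le:
  assumes \<theta>: "0 < \<theta>" "\<theta> \<le> 1"
  shows "\<exists>C>0. \<forall>s. 1 - \<theta> / 2 \<le> Re s \<and> Re s \<le> 3 \<longrightarrow> norm (zeta_reg s) \<le> C * (\<bar>Im s\<bar> + 4) powr (1 + \<theta>)"
proof -
  define A where "A = (\<Sum>n. real (Suc n) powr (-(1 + \<theta> / 2)))"
  have sA: "summable (\<lambda>n. real (Suc n) powr (-(1 + \<theta> / 2)))" using \<theta> by (intro summable_Suc_powr) auto
  have A: "A \<ge> 0" unfolding A_def by (intro suminf_nonneg sA) auto
  show ?thesis
  proof (intro exI[of _ "1 + 2 * A"] conjI allI impI)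
    fix s assume s: "1 - \<theta> / 2 \<le> Re s \<and> Re s \<le> 3"
    then have s0: "Re s > 0" using \<theta> by auto
    define T where "T = \<bar>Im s\<bar> + 4"
    have T: "T \<ge> 1" by (simp add: T_def)
    have ns: "norm s \<le> T" using cmod_le[of s] s s0 by (auto simp: T_def)
    have ns1: "norm (s - 1) \<le> T" using cmod_le[of "s - 1"] s \<theta> by (auto simp: T_def)
    have sm: "summable (\<lambda>n. 2 * T powr (1 + \<theta>) * real (Suc n) powr (-(1 + \<theta> / 2)))"
      by (intro summable_mult sA)
    have "norm (\<Sum>n. zterm n s) \<le> (\<Sum>n. 2 * T powr (1 + \<theta>) * real (Suc n) powr (-(1 + \<theta> / 2)))"
    proof (rule norm_suminf_le[OF _ sm])
      fix n
      have "norm (zterm n s) \<le> 2 * norm (s - 1) * norm s powr \<theta> * real (Suc n) powr (- Re s - \<theta>)"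
        using \<theta> s0 by (intro norm_zterm_interpolate) auto
      also have "\<dots> \<le> 2 * T * T powr \<theta> * real (Suc n) powr (-(1 + \<theta> / 2))"
        using ns ns1 \<theta> s T by (intro mult_mono powr_mono powr_mono2) auto
      also have "\<dots> = 2 * T powr (1 + \<theta>) * real (Suc n) powr (-(1 + \<theta> / 2))"
        using T by (simp add: powr_add)
      finally show "norm (zterm n s) \<le> 2 * T powr (1 + \<theta>) * real (Suc n) powr (-(1 + \<theta> / 2))" .
    qed
    also have "\<dots> = 2 * T powr (1 + \<theta>) * A" unfolding A_def by (rule suminf_mult[OF sA])
    finally have "norm (zeta_reg s) \<le> 1 + 2 * T powr (1 + \<theta>) * A"
      unfolding zeta_reg_def using norm_triangle_ineq[of 1 "\<Sum>n. zterm n s"] by simp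
    moreover have "1 \<le> T powr (1 + \<theta>)" using T \<theta> by (simp add: ge_one_powr_ge_zero)
    ultimately show "norm (zeta_reg s) \<le> (1 + 2 * A) * (\<bar>Im s\<bar> + 4) powr (1 + \<theta>)"
      by (simp add: T_def[symmetric] algebra_simps)
  qed (use A in auto)
qed

text \<open>Cauchy's inequality on discs of radius \<theta>/2, which stay in the strip of
  \<open>norm_zeta_reg_le\<close>. Three derivatives are what the second derivative of zeta'/zeta
  involves.\<close>

lemma norm_deriv_zeta_reg_le:
  assumes \<theta>: "0 < \<theta>" "\<theta> \<le> 1"
  shows "\<exists>C>0. \<forall>j\<le>3. \<forall>s. 1 \<le> Re s \<and> Re s \<le> 2 \<longrightarrow> norm ((deriv ^^ j) zeta_reg s) \<le> C * (\<bar>Im s\<bar> + 4) powr (1 + \<theta>)"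
proof -
  obtain C where C: "C > 0" "\<And>s. 1 - \<theta> / 2 \<le> Re s \<Longrightarrow> Re s \<le> 3 \<Longrightarrow> norm (zeta_reg s) \<le> C * (\<bar>Im s\<bar> + 4) powr (1 + \<theta>)"
    using norm_zeta_reg_le[OF \<theta>] by blast
  define r where "r = \<theta> / 2"
  have r: "0 < r" "r \<le> 1" using \<theta> by (auto simp: r_def)
  show ?thesis
  proof (intro exI[of _ "6 * (C * 4) / r ^ 3"] conjI allI impI)
    fix j :: nat and s assume j: "j \<le> 3" and s: "1 \<le> Re s \<and> Re s \<le> 2"
    define T where "T = \<bar>Im s\<bar> + 4"
    have T: "T \<ge> 1" by (simp add: T_def)
    have sub: "1 - \<theta> / 2 \<le> Re x \<and> Re x \<le> 3 \<and> \<bar>Im x\<bar> \<le> \<bar>Im s\<bar> + 1" if "dist s x \<le> r" for x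
      using that s abs_Re_le_cmod[of "s - x"] abs_Im_le_cmod[of "s - x"] r \<theta> by (auto simp: dist_norm r_def)
    have sub0: "Re x > 0" if "dist s x \<le> r" for x using sub[OF that] \<theta> by auto
    have "norm ((deriv ^^ j) zeta_reg s) \<le> fact j * (C * (4 * T powr (1 + \<theta>))) / r ^ j"
    proof (rule Cauchy_inequality)
      show "zeta_reg holomorphic_on ball s r"
        by (rule holomorphic_on_subset[OF zeta_reg_holomorphic]) (use sub0 in auto)
      show "continuous_on (cball s r) zeta_reg"
        by (rule holomorphic_on_imp_continuous_on, rule holomorphic_on_subset[OF zeta_reg_holomorphic]) (use sub0 in auto)
      fix x assume x: "norm (s - x) = r"
      then have d: "dist s x \<le> r" by (simp add: dist_norm)
      have "norm (zeta_reg x) \<le> C * (\<bar>Im x\<bar> + 4) powr (1 + \<theta>)" using C(2) sub[OF d] by auto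
      also have "\<dots> \<le> C * (2 * T) powr (1 + \<theta>)"
        using C(1) sub[OF d] \<theta> by (intro mult_left_mono powr_mono2) (auto simp: T_def)
      also have "\<dots> = C * (2 powr (1 + \<theta>) * T powr (1 + \<theta>))" using T by (simp add: powr_mult)
      also have "\<dots> \<le> C * (4 * T powr (1 + \<theta>))"
      proof -
        have "2 powr (1 + \<theta>) \<le> 2 powr 2" using \<theta> by (intro powr_mono) auto
        then show ?thesis using C(1) by (intro mult_left_mono mult_right_mono) auto
      qed
      finally show "norm (zeta_reg x) \<le> C * (4 * T powr (1 + \<theta>))" .
    qed (use r in auto)
    also have "\<dots> \<le> 6 * (C * (4 * T powr (1 + \<theta>))) / r ^ 3"
    proof (intro frac_le mult_right_mono)
      show "(fact j :: real) \<le> 6" using fact_mono[OF j, where 'a = real] by (simp add: eval_nat_numeral)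
      show "r ^ 3 \<le> r ^ j" using r j by (intro power_decreasing) auto
    qed (use C r in auto)
    finally show "norm ((deriv ^^ j) zeta_reg s) \<le> 6 * (C * 4) / r ^ 3 * (\<bar>Im s\<bar> + 4) powr (1 + \<theta>)"
      by (simp add: T_def mult_ac)
  qed (use C r in auto)
qed

section \<open>Non-vanishing of zeta and a lower bound up to Re s = 1\<close>

lemma zeta_nonzero: "Re s > 1 \<Longrightarrow> zeta s \<noteq> 0"
  using zeta_341[of "Re s" "Im s"] by auto

lemma has_field_derivative_zeta_reg:
  "Re s > 0 \<Longrightarrow> (zeta_reg has_field_derivative deriv zeta_reg s) (at s)"
  by (rule holomorphic_derivI[OF zeta_reg_holomorphic]) (auto simp: open_halfspace_Re_gt)

lemma norm_zeta_reg_diff_le: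
  assumes "1 \<le> x" "x \<le> y" "y \<le> 2"
    and B: "\<And>u. 1 \<le> u \<Longrightarrow> u \<le> 2 \<Longrightarrow> norm (deriv zeta_reg (Complex u t)) \<le> B"
  shows "norm (zeta_reg (Complex y t) - zeta_reg (Complex x t)) \<le> B * (y - x)"
proof -
  have "norm (zeta_reg (Complex y t) - zeta_reg (Complex x t)) \<le> B * norm (Complex y t - Complex x t)"
  proof (rule field_differentiable_bound[OF convex_horizontal_segment[of t 1 2]])
    fix z assume z: "z \<in> {z. Im z = t \<and> 1 \<le> Re z \<and> Re z \<le> 2}"
    then show "(zeta_reg has_field_derivative deriv zeta_reg z) (at z within {z. Im z = t \<and> 1 \<le> Re z \<and> Re z \<le> 2})"
      using has_field_derivative_at_within[OF has_field_derivative_zeta_reg[of z]] by auto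
    have "z = Complex (Re z) t" using z by (auto simp: complex_eq_iff)
    then show "norm (deriv zeta_reg z) \<le> B" using B[of "Re z"] z by auto
  qed (use assms in auto)
  also have "Complex y t - Complex x t = of_real (y - x)" by (simp add: complex_eq_iff)
  finally show ?thesis using assms by (simp add: norm_of_real del: of_real_diff)
qed

lemma norm_zeta_real_le: "\<exists>C>0. \<forall>x. 1 < x \<and> x \<le> 2 \<longrightarrow> norm (zeta (of_real x)) \<le> C / (x - 1)"
proof -
  obtain C where C: "C > 0" "\<And>s. 1 - 1 / 2 \<le> Re s \<Longrightarrow> Re s \<le> 3 \<Longrightarrow> norm (zeta_reg s) \<le> C * (\<bar>Im s\<bar> + 4) powr (1 + 1)"
    using norm_zeta_reg_le[of 1] by auto
  show ?thesis
  proof (intro exI[of _ "C * 4 powr 2"] conjI allI impI)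
    fix x :: real assume x: "1 < x \<and> x \<le> 2"
    then have "norm (zeta_reg (of_real x)) \<le> C * 4 powr 2" using C(2)[of "of_real x"] by simp
    moreover have "norm (zeta_reg (of_real x)) = (x - 1) * norm (zeta (of_real x))"
    proof -
      have "norm (zeta_reg (of_real x)) = norm (of_real (x - 1) * zeta (of_real x))"
        using zeta_reg_eq[of "of_real x"] x by simp
      then show ?thesis using x by (simp only: norm_mult norm_of_real) simp
    qed
    ultimately show "norm (zeta (of_real x)) \<le> C * 4 powr 2 / (x - 1)"
      using x by (simp add: field_simps)
  qed (use C in auto)
qed

lemma zeta_reg_1: "zeta_reg 1 = 1"
  by (simp add: zeta_reg_def zterm_def del: of_nat_Suc)

text \<open>At a zero on the line the fourth power in \<open>zeta_341\<close> vanishes to order at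
  least 4 while the cube has a pole of order 3, so the product is O(x - 1) as x -> 1, against the
  lower bound 1.\<close>

lemma zeta_reg_nonzero_line_1:
  assumes t: "t \<noteq> 0"
  shows "zeta_reg (Complex 1 t) \<noteq> 0"
proof
  assume z: "zeta_reg (Complex 1 t) = 0"
  obtain C1 where C1: "C1 > 0" "\<And>x. 1 < x \<Longrightarrow> x \<le> 2 \<Longrightarrow> norm (zeta (of_real x)) \<le> C1 / (x - 1)"
    using norm_zeta_real_le by blast
  obtain C where C: "C > 0" "\<And>j s. j \<le> 3 \<Longrightarrow> 1 \<le> Re s \<Longrightarrow> Re s \<le> 2 \<Longrightarrow> norm ((deriv ^^ j) zeta_reg s) \<le> C * (\<bar>Im s\<bar> + 4) powr (1 + 1)"
    using norm_deriv_zeta_reg_le[of 1] by auto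
  define B where "B = C * (2 * \<bar>t\<bar> + 4) powr 2"
  have B: "B > 0" using C by (auto simp: B_def)
  have b1: "norm (deriv zeta_reg (Complex u t)) \<le> B" if "1 \<le> u" "u \<le> 2" for u
  proof -
    have "norm ((deriv ^^ 1) zeta_reg (Complex u t)) \<le> C * (\<bar>t\<bar> + 4) powr (1 + 1)" using C(2)[of 1 "Complex u t"] that by simp
    also have "\<dots> \<le> B" unfolding B_def using C(1) by (intro mult_left_mono powr_mono2) auto
    finally show ?thesis by simp
  qed
  define K where "K = C1 ^ 3 * (B / \<bar>t\<bar>) ^ 4 * (B / \<bar>2 * t\<bar>)"
  have "1 \<le> K * (x - 1)" if x: "1 < x" "x \<le> 2" for x
  proof -
    have a1: "norm (zeta (of_real x)) ^ 3 \<le> (C1 / (x - 1)) ^ 3" using C1(2)[OF x] by (intro power_mono) auto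
    have gen: "norm (zeta (Complex x u)) \<le> M / \<bar>u\<bar>" if "norm (zeta_reg (Complex x u)) \<le> M" "u \<noteq> 0" for u M
    proof -
      have "\<bar>u\<bar> * norm (zeta (Complex x u)) \<le> norm (Complex x u - 1) * norm (zeta (Complex x u))"
        using abs_Im_le_cmod[of "Complex x u - 1"] by (intro mult_right_mono) auto
      also have "\<dots> = norm (zeta_reg (Complex x u))" using zeta_reg_eq[of "Complex x u"] x by (simp add: norm_mult)
      finally show ?thesis using that by (simp add: field_simps)
    qed
    have "norm (zeta_reg (Complex x t)) \<le> B * (x - 1)"
      using norm_zeta_reg_diff_le[of 1 x t B] x b1 z by simp
    from gen[OF this t] have a2: "norm (zeta (Complex x t)) ^ 4 \<le> (B * (x - 1) / \<bar>t\<bar>) ^ 4" by (intro power_mono) auto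
    have "norm ((deriv ^^ 0) zeta_reg (Complex x (2 * t))) \<le> B" unfolding B_def
      using C(2)[of 0 "Complex x (2 * t)"] x by (simp add: abs_mult)
    then have a3: "norm (zeta (Complex x (2 * t))) \<le> B / \<bar>2 * t\<bar>" using t by (intro gen) auto
    have "1 \<le> norm (zeta (of_real x)) ^ 3 * norm (zeta (Complex x t)) ^ 4 * norm (zeta (Complex x (2 * t)))"
      by (rule zeta_341[OF x(1)])
    also have "\<dots> \<le> (C1 / (x - 1)) ^ 3 * (B * (x - 1) / \<bar>t\<bar>) ^ 4 * (B / \<bar>2 * t\<bar>)"
      using C1 B x by (intro mult_mono a1 a2 a3) auto
    also have "\<dots> = K * (x - 1)" using x by (simp add: K_def power_divide power_mult_distrib eval_nat_numeral)
    finally show ?thesis .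
  qed
  note * = this
  have K: "K > 0" using t C1 B by (auto simp: K_def)
  define x where "x = 1 + min 1 (1 / (2 * K))"
  have "K * (x - 1) \<le> K * (1 / (2 * K))" unfolding x_def using K by (intro mult_left_mono) auto
  then have "K * (x - 1) \<le> 1 / 2" using K by simp
  moreover have "1 \<le> K * (x - 1)" using K by (intro *) (auto simp: x_def)
  ultimately show False by simp
qed

lemma zeta_reg_nonzero:
  assumes "Re s \<ge> 1"
  shows "zeta_reg s \<noteq> 0"
proof (cases "Re s > 1")
  case True
  then show ?thesis using zeta_reg_eq[OF True] zeta_nonzero[OF True] by auto
next
  case False
  then have "s = Complex 1 (Im s)" using assms by (simp add: complex_eq_iff)
  moreover have "s = 1" if "Im s = 0" using that False assms by (simp add: complex_eq_iff)
  ultimately show ?thesis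
    using zeta_reg_nonzero_line_1[of "Im s"] zeta_reg_1 by (cases "Im s = 0") auto
qed

text \<open>\<open>zeta_341\<close> solved for its middle factor: the cube costs (x - 1)^3, the
  value at height 2t costs T^\<theta>, and a factor |t|^4 converts zeta to
  \<open>zeta_reg\<close>.\<close>

lemma norm_zeta_reg_pow4_ge:
  assumes \<theta>: "0 < \<theta>" "\<theta> \<le> 1"
  shows "\<exists>\<kappa>>0. \<forall>x t. 1 \<le> x \<and> x \<le> 2 \<and> \<bar>t\<bar> \<ge> 1 \<longrightarrow>
    \<kappa> * (\<bar>t\<bar> + 4) powr (4 - \<theta>) * (x - 1) ^ 3 \<le> norm (zeta_reg (Complex x t)) ^ 4"
proof -
  obtain C1 where C1: "C1 > 0" "\<And>x. 1 < x \<Longrightarrow> x \<le> 2 \<Longrightarrow> norm (zeta (of_real x)) \<le> C1 / (x - 1)"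
    using norm_zeta_real_le by blast
  obtain C where C: "C > 0" "\<And>j s. j \<le> 3 \<Longrightarrow> 1 \<le> Re s \<Longrightarrow> Re s \<le> 2 \<Longrightarrow> norm ((deriv ^^ j) zeta_reg s) \<le> C * (\<bar>Im s\<bar> + 4) powr (1 + \<theta>)"
    using norm_deriv_zeta_reg_le[OF \<theta>] by blast
  \<comment> \<open>625 = 5^4 comes from T \<le> 5 |t|, valid for |t| \<ge> 1; \<open>10 * C\<close>
    is the constant in the bound for zeta at height 2t.\<close>
  define \<kappa> where "\<kappa> = 1 / (625 * (10 * C * C1 ^ 3))"
  show ?thesis
  proof (intro exI[of _ \<kappa>] conjI allI impI)
    fix x t :: real assume xt: "1 \<le> x \<and> x \<le> 2 \<and> \<bar>t\<bar> \<ge> 1"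
    define T where "T = \<bar>t\<bar> + 4"
    have T: "T \<ge> 5" "T \<le> 5 * \<bar>t\<bar>" using xt by (auto simp: T_def)
    show "\<kappa> * (\<bar>t\<bar> + 4) powr (4 - \<theta>) * (x - 1) ^ 3 \<le> norm (zeta_reg (Complex x t)) ^ 4"
    proof (cases "x = 1")
      case False
      then have x: "1 < x" "x \<le> 2" using xt by auto
      have a1: "norm (zeta (of_real x)) ^ 3 \<le> (C1 / (x - 1)) ^ 3" using C1(2)[OF x] by (intro power_mono) auto
      have gen: "\<bar>u\<bar> * norm (zeta (Complex x u)) \<le> norm (zeta_reg (Complex x u))" for u
      proof -
        have "\<bar>u\<bar> * norm (zeta (Complex x u)) \<le> norm (Complex x u - 1) * norm (zeta (Complex x u))"
          using abs_Im_le_cmod[of "Complex x u - 1"] by (intro mult_right_mono) auto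
        also have "\<dots> = norm (zeta_reg (Complex x u))" using zeta_reg_eq[of "Complex x u"] x by (simp add: norm_mult)
        finally show ?thesis .
      qed
      have a3: "norm (zeta (Complex x (2 * t))) \<le> 10 * C * T powr \<theta>"
      proof -
        have "norm ((deriv ^^ 0) zeta_reg (Complex x (2 * t))) \<le> C * (\<bar>2 * t\<bar> + 4) powr (1 + \<theta>)"
          using C(2)[of 0 "Complex x (2 * t)"] x by simp
        also have "\<dots> \<le> C * (2 * T) powr (1 + \<theta>)" using C(1) \<theta> by (intro mult_left_mono powr_mono2) (auto simp: T_def)
        also have "\<dots> = C * (2 powr (1 + \<theta>) * T powr (1 + \<theta>))" using T by (simp add: powr_mult)
        also have "\<dots> \<le> C * (4 * T powr (1 + \<theta>))"
        proof -
          have "2 powr (1 + \<theta>) \<le> 2 powr 2" using \<theta> by (intro powr_mono) auto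
          then show ?thesis using C(1) by (intro mult_left_mono mult_right_mono) auto
        qed
        also have "\<dots> = C * 4 * T powr \<theta> * T" using T by (simp add: powr_add)
        also have "\<dots> \<le> C * 4 * T powr \<theta> * (5 * \<bar>t\<bar>)" using C(1) T by (intro mult_left_mono) auto
        finally have "\<bar>2 * t\<bar> * norm (zeta (Complex x (2 * t))) \<le> \<bar>2 * t\<bar> * (10 * C * T powr \<theta>)"
          using gen[of "2 * t"] by (simp add: abs_mult mult_ac)
        then show ?thesis using xt by (subst (asm) mult_le_cancel_left_pos) auto
      qed
      have a2: "\<bar>t\<bar> ^ 4 * norm (zeta (Complex x t)) ^ 4 \<le> norm (zeta_reg (Complex x t)) ^ 4"
        using power_mono[OF gen[of t], of 4] by (simp add: power_mult_distrib)
      have "1 \<le> norm (zeta (of_real x)) ^ 3 * norm (zeta (Complex x t)) ^ 4 * norm (zeta (Complex x (2 * t)))"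
        by (rule zeta_341[OF x(1)])
      also have "\<dots> \<le> (C1 / (x - 1)) ^ 3 * norm (zeta (Complex x t)) ^ 4 * (10 * C * T powr \<theta>)"
        using C1 C x by (intro mult_mono a1 a3) auto
      finally have m: "1 \<le> (C1 / (x - 1)) ^ 3 * norm (zeta (Complex x t)) ^ 4 * (10 * C * T powr \<theta>)" .
      have "(x - 1) ^ 3 * 1 \<le> (x - 1) ^ 3 * ((C1 / (x - 1)) ^ 3 * norm (zeta (Complex x t)) ^ 4 * (10 * C * T powr \<theta>))"
        using m x by (intro mult_left_mono) auto
      then have m2: "(x - 1) ^ 3 \<le> C1 ^ 3 * norm (zeta (Complex x t)) ^ 4 * (10 * C * T powr \<theta>)"
        using x by (simp add: power_divide mult.assoc)
      have "\<kappa> * T powr (4 - \<theta>) * (x - 1) ^ 3 \<le> \<kappa> * T powr (4 - \<theta>) * (C1 ^ 3 * norm (zeta (Complex x t)) ^ 4 * (10 * C * T powr \<theta>))"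
        using m2 C C1 by (intro mult_left_mono) (auto simp: \<kappa>_def)
      also have "\<dots> = (\<kappa> * (10 * C * C1 ^ 3)) * (T powr (4 - \<theta>) * T powr \<theta>) * norm (zeta (Complex x t)) ^ 4" by (simp add: mult_ac)
      also have "\<kappa> * (10 * C * C1 ^ 3) = 1 / 625" using C C1 by (simp add: \<kappa>_def)
      also have "T powr (4 - \<theta>) * T powr \<theta> = T ^ 4" using T by (simp add: powr_add[symmetric])
      also have "1 / 625 * T ^ 4 * norm (zeta (Complex x t)) ^ 4 \<le> 1 / 625 * (5 * \<bar>t\<bar>) ^ 4 * norm (zeta (Complex x t)) ^ 4"
        using T by (intro mult_left_mono mult_right_mono power_mono) auto
      also have "\<dots> = \<bar>t\<bar> ^ 4 * norm (zeta (Complex x t)) ^ 4" by (simp add: power_mult_distrib)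
      also note a2
      finally show ?thesis by (simp add: T_def)
    qed auto
  qed (use C C1 in \<open>auto simp: \<kappa>_def\<close>)
qed

text \<open>The bound of \<open>norm_zeta_reg_pow4_ge\<close> degenerates as x -> 1. It is used down
  to the distance \<eta> = c0 T^(-6 \<theta>), where it still gives b T^(1 - 5 \<theta>); nearer to
  the line, \<open>zeta_reg\<close> changes by at most C T^(1 + \<theta>) \<eta>, which has the same
  order in T and is at most half as large by the choice of c0.\<close>

lemma norm_zeta_reg_ge:
  assumes \<theta>: "0 < \<theta>" "\<theta> \<le> 1"
  shows "\<exists>c>0. \<forall>s. 1 \<le> Re s \<and> Re s \<le> 2 \<and> \<bar>Im s\<bar> \<ge> 1 \<longrightarrow> c * (\<bar>Im s\<bar> + 4) powr (1 - 5 * \<theta>) \<le> norm (zeta_reg s)"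
proof -
  obtain \<kappa> where \<kappa>: "\<kappa> > 0" "\<And>x t. 1 \<le> x \<Longrightarrow> x \<le> 2 \<Longrightarrow> \<bar>t\<bar> \<ge> 1 \<Longrightarrow>
    \<kappa> * (\<bar>t\<bar> + 4) powr (4 - \<theta>) * (x - 1) ^ 3 \<le> norm (zeta_reg (Complex x t)) ^ 4"
    using norm_zeta_reg_pow4_ge[OF \<theta>] by blast
  obtain C where C: "C > 0" "\<And>j s. j \<le> 3 \<Longrightarrow> 1 \<le> Re s \<Longrightarrow> Re s \<le> 2 \<Longrightarrow> norm ((deriv ^^ j) zeta_reg s) \<le> C * (\<bar>Im s\<bar> + 4) powr (1 + \<theta>)"
    using norm_deriv_zeta_reg_le[OF \<theta>] by blast
  \<comment> \<open>The second bound gives 16 (C c0)^4 \<le> \<kappa> c0^3 = b^4, that is C c0 \<le>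
    b/2.\<close>
  define c0 where "c0 = min 1 (\<kappa> / (16 * C ^ 4))"
  have c0: "c0 > 0" "c0 \<le> 1" using \<kappa> C by (auto simp: c0_def)
  define b where "b = (\<kappa> * c0 ^ 3) powr (1 / 4)"
  have b: "b > 0" using \<kappa> c0 by (simp add: b_def)
  have b4: "b ^ 4 = \<kappa> * c0 ^ 3" using \<kappa> c0 by (simp add: b_def powr_powr flip: powr_numeral)
  have Cb: "C * c0 \<le> b / 2"
  proof (rule power_le_imp_le_base[of _ 3])
    have "c0 * (16 * C ^ 4) \<le> \<kappa>" using C by (auto simp: c0_def min_def field_simps)
    then have "c0 * (16 * C ^ 4) * c0 ^ 3 \<le> \<kappa> * c0 ^ 3" using c0 by (intro mult_right_mono) auto
    then have "(C * c0) ^ 4 * 16 \<le> b ^ 4" unfolding b4 by (simp add: power_mult_distrib mult_ac eval_nat_numeral)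
    then show "(C * c0) ^ Suc 3 \<le> (b / 2) ^ Suc 3" by (simp add: power_divide eval_nat_numeral)
  qed (use b in auto)
  show ?thesis
  proof (intro exI[of _ "b / 2"] conjI allI impI)
    fix s assume s: "1 \<le> Re s \<and> Re s \<le> 2 \<and> \<bar>Im s\<bar> \<ge> 1"
    define x t where "x = Re s" and "t = Im s"
    have s': "s = Complex x t" by (simp add: x_def t_def)
    define T where "T = \<bar>t\<bar> + 4"
    have T: "T \<ge> 1" by (simp add: T_def)
    define \<eta> where "\<eta> = c0 * T powr (- 6 * \<theta>)"
    have "T powr (- 6 * \<theta>) \<le> T powr 0" using T \<theta> by (intro powr_mono) auto
    then have \<eta>: "0 < \<eta>" "\<eta> \<le> 1" using c0 T by (auto simp: \<eta>_def intro!: mult_le_one)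
    have far: "b * T powr (1 - 5 * \<theta>) \<le> norm (zeta_reg (Complex y t))" if y: "1 + \<eta> \<le> y" "y \<le> 2" for y
    proof (rule power_le_imp_le_base[of _ 3])
      have "(b * T powr (1 - 5 * \<theta>)) ^ 4 = \<kappa> * c0 ^ 3 * T powr (4 - 20 * \<theta>)"
        using T by (simp add: power_mult_distrib b4 powr_powr flip: powr_numeral)
      also have "\<dots> \<le> \<kappa> * c0 ^ 3 * T powr (4 - 19 * \<theta>)"
        using T \<kappa> c0 \<theta> by (intro mult_left_mono powr_mono) auto
      also have "\<dots> = \<kappa> * T powr (4 - \<theta>) * \<eta> ^ 3"
      proof -
        have "\<eta> ^ 3 = c0 ^ 3 * T powr (- 18 * \<theta>)"
          using T by (simp add: \<eta>_def power_mult_distrib powr_powr flip: powr_numeral)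
        moreover have "T powr (4 - \<theta>) * T powr (- 18 * \<theta>) = T powr (4 - 19 * \<theta>)"
          by (simp add: powr_add[symmetric])
        ultimately show ?thesis by (simp add: mult_ac)
      qed
      also have "\<dots> \<le> \<kappa> * T powr (4 - \<theta>) * (y - 1) ^ 3"
        using y \<eta> \<kappa> by (intro mult_left_mono power_mono) auto
      also have "\<dots> \<le> norm (zeta_reg (Complex y t)) ^ 4"
        unfolding T_def using y \<eta> s by (intro \<kappa>) (auto simp: t_def)
      finally show "(b * T powr (1 - 5 * \<theta>)) ^ Suc 3 \<le> norm (zeta_reg (Complex y t)) ^ Suc 3" by simp
    qed auto
    have "b / 2 * T powr (1 - 5 * \<theta>) \<le> norm (zeta_reg s)"
    proof (cases "x \<ge> 1 + \<eta>")
      case True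
      have "b / 2 * T powr (1 - 5 * \<theta>) \<le> b * T powr (1 - 5 * \<theta>)" using b by (intro mult_right_mono) auto
      also have "\<dots> \<le> norm (zeta_reg s)" unfolding s' using True s by (intro far) (auto simp: x_def)
      finally show ?thesis .
    next
      case False
      have "norm (zeta_reg (Complex (1 + \<eta>) t) - zeta_reg (Complex x t)) \<le> C * T powr (1 + \<theta>) * (1 + \<eta> - x)"
      proof (rule norm_zeta_reg_diff_le)
        fix u :: real assume "1 \<le> u" "u \<le> 2"
        then show "norm (deriv zeta_reg (Complex u t)) \<le> C * T powr (1 + \<theta>)"
          using C(2)[of 1 "Complex u t"] by (simp add: T_def)
      qed (use False s \<eta> in \<open>auto simp: x_def\<close>)
      also have "\<dots> \<le> C * T powr (1 + \<theta>) * \<eta>"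
        using C(1) s by (intro mult_left_mono) (auto simp: x_def)
      also have "\<dots> = C * c0 * T powr (1 - 5 * \<theta>)"
      proof -
        have "T powr (1 + \<theta>) * T powr (- 6 * \<theta>) = T powr (1 - 5 * \<theta>)" by (simp add: powr_add[symmetric])
        then show ?thesis by (simp add: \<eta>_def mult_ac)
      qed
      also have "\<dots> \<le> b / 2 * T powr (1 - 5 * \<theta>)" using Cb by (intro mult_right_mono) auto
      finally have "norm (zeta_reg (Complex (1 + \<eta>) t)) - norm (zeta_reg s) \<le> b / 2 * T powr (1 - 5 * \<theta>)"
        using norm_triangle_ineq2[of "zeta_reg (Complex (1 + \<eta>) t)" "zeta_reg s"] by (simp add: s')
      moreover have "b * T powr (1 - 5 * \<theta>) \<le> norm (zeta_reg (Complex (1 + \<eta>) t))" using \<eta> by (intro far) auto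
      ultimately show ?thesis by (simp add: algebra_simps)
    qed
    then show "b / 2 * (\<bar>Im s\<bar> + 4) powr (1 - 5 * \<theta>) \<le> norm (zeta_reg s)" by (simp add: T_def t_def)
  qed (use b in auto)
qed

section \<open>Primes in short intervals\<close>

definition ln_twist :: "(nat \<Rightarrow> complex) \<Rightarrow> nat \<Rightarrow> complex" where
  "ln_twist a n = a n * of_real (ln (real n))"

lemma abs_conv_dirichlet_ln_twist: "abs_conv_dirichlet a \<Longrightarrow> abs_conv_dirichlet (ln_twist a)"
  using abs_conv_dirichlet_ln unfolding ln_twist_def[abs_def] .

lemma has_field_derivative_dirichlet_series':
  "abs_conv_dirichlet a \<Longrightarrow> Re s > 1 \<Longrightarrow>
   (dirichlet_series a has_field_derivative - dirichlet_series (ln_twist a) s) (at s)"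
  using has_field_derivative_dirichlet_series unfolding ln_twist_def[abs_def] .

text \<open>The \<open>k\<close>-th derivative of \<open>- \<zeta>'/\<zeta> - \<zeta>\<close>, in which the poles at \<open>1\<close> cancel.\<close>

definition mdiff :: "nat \<Rightarrow> complex \<Rightarrow> complex" where
  "mdiff k s = (-1) ^ k * (dirichlet_series ((ln_twist ^^ k) mangoldt) s - dirichlet_series ((ln_twist ^^ k) (\<lambda>_. 1)) s)"

lemma abs_conv_dirichlet_ln_twist_pow: "abs_conv_dirichlet a \<Longrightarrow> abs_conv_dirichlet ((ln_twist ^^ k) a)"
  by (induction k) (auto intro: abs_conv_dirichlet_ln_twist)

lemma has_field_derivative_mdiff:
  assumes "Re s > 1"
  shows "(mdiff k has_field_derivative mdiff (Suc k) s) (at s)"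
proof -
  have "((\<lambda>s. (-1) ^ k * (dirichlet_series ((ln_twist ^^ k) mangoldt) s - dirichlet_series ((ln_twist ^^ k) (\<lambda>_. 1)) s))
     has_field_derivative (-1) ^ k * (- dirichlet_series (ln_twist ((ln_twist ^^ k) mangoldt)) s
       - - dirichlet_series (ln_twist ((ln_twist ^^ k) (\<lambda>_. 1))) s)) (at s)"
    by (intro DERIV_cmult DERIV_diff has_field_derivative_dirichlet_series' assms abs_conv_dirichlet_ln_twist_pow
      abs_conv_dirichlet_mangoldt abs_conv_dirichlet_const)
  then show ?thesis unfolding mdiff_def[abs_def] by (rule DERIV_cong) (simp add: algebra_simps)
qed

lemma has_field_derivative_deriv_zeta_reg:
  assumes "Re s > 0"
  shows "((deriv ^^ k) zeta_reg has_field_derivative (deriv ^^ Suc k) zeta_reg s) (at s)"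
proof -
  have "(deriv ^^ k) zeta_reg holomorphic_on {s. Re s > 0}"
    by (intro holomorphic_higher_deriv zeta_reg_holomorphic open_halfspace_Re_gt)
  then have "((deriv ^^ k) zeta_reg has_field_derivative deriv ((deriv ^^ k) zeta_reg) s) (at s)"
    by (rule holomorphic_derivI) (use assms in \<open>auto simp: open_halfspace_Re_gt\<close>)
  then show ?thesis by simp
qed

text \<open>zeta_reg'/zeta_reg = zeta'/zeta + 1/(s - 1) and zeta = zeta_reg/(s - 1). What is left of
  the poles is (zeta_reg - 1)/(s - 1), a removable singularity because \<open>zeta_reg\<close> is 1
  at 1.\<close>

lemma mdiff_0_eq:
  assumes s: "Re s > 1"
  shows "mdiff 0 s = - (deriv zeta_reg s * inverse (zeta_reg s) + (zeta_reg s - 1) * inverse (s - 1))"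
proof -
  have s1: "s \<noteq> 1" using s by auto
  have z: "zeta s \<noteq> 0" using zeta_nonzero[OF s] .
  have "((\<lambda>s. (s - 1) * zeta s) has_field_derivative zeta s + (s - 1) * (- (dirichlet_series mangoldt s * zeta s))) (at s)"
    by (rule DERIV_cong[OF DERIV_mult[OF DERIV_diff[OF DERIV_ident DERIV_const] has_field_derivative_zeta[OF s]]]) (simp add: algebra_simps)
  then have "(zeta_reg has_field_derivative zeta s + (s - 1) * (- (dirichlet_series mangoldt s * zeta s))) (at s)"
    by (rule has_field_derivative_transform_within_open[where S = "{s. Re s > 1}"])
      (use s in \<open>auto simp: open_halfspace_Re_gt zeta_reg_eq\<close>)
  then have d: "deriv zeta_reg s = zeta s + (s - 1) * (- (dirichlet_series mangoldt s * zeta s))"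
    by (rule DERIV_imp_deriv)
  have "(zeta s + (s - 1) * (- (dirichlet_series mangoldt s * zeta s))) * inverse ((s - 1) * zeta s)
     = inverse (s - 1) - dirichlet_series mangoldt s"
    using s1 z by (simp add: divide_simps) (simp add: algebra_simps)
  moreover have "((s - 1) * zeta s - 1) * inverse (s - 1) = zeta s - inverse (s - 1)"
    using s1 by (simp add: divide_simps)
  ultimately show ?thesis unfolding d zeta_reg_eq[OF s] by (simp add: mdiff_def)
qed

text \<open>Two differentiations of \<open>mdiff_0_eq\<close>. The form is a polynomial in the
  derivatives of \<open>zeta_reg\<close>, its inverse W and V = 1/(s - 1), so that away from s = 1
  each factor can be estimated on its own.\<close>

lemma mdiff_2_eq:
  assumes s: "Re s > 1"
  defines "Z \<equiv> (\<lambda>k. (deriv ^^ k) zeta_reg s)" and "W \<equiv> inverse (zeta_reg s)" and "V \<equiv> inverse (s - 1)"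
  shows "mdiff 2 s = - (Z 3 * W - 3 * Z 1 * Z 2 * W ^ 2 + 2 * Z 1 ^ 3 * W ^ 3 + Z 2 * V - 2 * Z 1 * V ^ 2 + 2 * (Z 0 - 1) * V ^ 3)"
proof -
  define Y where "Y = (\<lambda>k s. (deriv ^^ k) zeta_reg s)"
  define w where "w = (\<lambda>s. inverse (zeta_reg s))"
  define v where "v = (\<lambda>s::complex. inverse (s - 1))"
  have S: "open {s. Re s > 1}" by (simp add: open_halfspace_Re_gt)
  have dY: "(Y k has_field_derivative Y (Suc k) s) (at s)" if "Re s > 1" for k s
    unfolding Y_def using has_field_derivative_deriv_zeta_reg[of s k] that by simp
  have Y0: "Y 0 = zeta_reg" by (simp add: Y_def fun_eq_iff)
  have dw: "(w has_field_derivative - (Y 1 s * w s ^ 2)) (at s)" if "Re s > 1" for s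
  proof -
    have "zeta_reg s \<noteq> 0" using that by (intro zeta_reg_nonzero) auto
    then have "((\<lambda>s. inverse (Y 0 s)) has_field_derivative - (inverse (Y 0 s) * Y (Suc 0) s * inverse (Y 0 s))) (at s)"
      by (intro DERIV_inverse' dY that) (simp add: Y0)
    then show ?thesis unfolding w_def Y0 by (rule DERIV_cong) (simp add: power2_eq_square)
  qed
  have dv: "(v has_field_derivative - (v s ^ 2)) (at s)" if "Re s > 1" for s
  proof -
    have "s - 1 \<noteq> 0" using that by auto
    then have "((\<lambda>s. inverse (s - 1)) has_field_derivative - (inverse (s - 1) * (1 - 0) * inverse (s - 1))) (at s)"
      by (intro DERIV_inverse' DERIV_diff DERIV_ident DERIV_const)
    then show ?thesis unfolding v_def by (rule DERIV_cong) (simp add: power2_eq_square)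
  qed
  have e0: "mdiff 0 s = - (Y 1 s * w s + (Y 0 s - 1) * v s)" if "Re s > 1" for s
    using mdiff_0_eq[OF that] by (simp add: Y_def w_def v_def)
  have e1: "mdiff 1 s = - (Y 2 s * w s - Y 1 s ^ 2 * w s ^ 2 + Y 1 s * v s - (Y 0 s - 1) * v s ^ 2)" if "Re s > 1" for s
  proof -
    note D = DERIV_minus[OF DERIV_add[OF DERIV_mult[OF dY[OF that, of 1] dw[OF that]]
       DERIV_mult[OF DERIV_diff[OF dY[OF that, of 0] DERIV_const] dv[OF that]]]]
    have "(mdiff 0 has_field_derivative - (Y 2 s * w s - Y 1 s ^ 2 * w s ^ 2 + Y 1 s * v s - (Y 0 s - 1) * v s ^ 2)) (at s)"
      by (rule has_field_derivative_transform_within_open[OF DERIV_cong[OF D] S])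
       (use that e0 in \<open>auto simp: eval_nat_numeral algebra_simps\<close>)
    moreover have "(mdiff 0 has_field_derivative mdiff 1 s) (at s)" using has_field_derivative_mdiff[OF that, of 0] by simp
    ultimately show ?thesis using DERIV_unique by blast
  qed
  have e2: "mdiff 2 s = - (Y 3 s * w s - 3 * Y 1 s * Y 2 s * w s ^ 2 + 2 * Y 1 s ^ 3 * w s ^ 3 + Y 2 s * v s - 2 * Y 1 s * v s ^ 2 + 2 * (Y 0 s - 1) * v s ^ 3)"
    if "Re s > 1" for s
  proof -
    note D = DERIV_minus[OF DERIV_diff[OF DERIV_add[OF DERIV_diff[OF DERIV_mult[OF dY[OF that, of 2] dw[OF that]]
       DERIV_mult[OF DERIV_power[OF dY[OF that, of 1], of 2] DERIV_power[OF dw[OF that], of 2]]]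
       DERIV_mult[OF dY[OF that, of 1] dv[OF that]]]
       DERIV_mult[OF DERIV_diff[OF dY[OF that, of 0] DERIV_const] DERIV_power[OF dv[OF that], of 2]]]]
    have "(mdiff 1 has_field_derivative - (Y 3 s * w s - 3 * Y 1 s * Y 2 s * w s ^ 2 + 2 * Y 1 s ^ 3 * w s ^ 3 + Y 2 s * v s - 2 * Y 1 s * v s ^ 2 + 2 * (Y 0 s - 1) * v s ^ 3)) (at s)"
      by (rule has_field_derivative_transform_within_open[OF DERIV_cong[OF D] S])
       (use that e1 in \<open>auto simp: eval_nat_numeral algebra_simps\<close>)
    moreover have "(mdiff 1 has_field_derivative mdiff 2 s) (at s)" using has_field_derivative_mdiff[OF that, of 1] by (simp add: numeral_2_eq_2)
    ultimately show ?thesis using DERIV_unique by blast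
  qed
  show ?thesis using e2[OF s] by (simp add: Y_def w_def v_def Z_def W_def V_def)
qed

text \<open>Near s = 1 the terms of \<open>mdiff_2_eq\<close> blow up separately. So the function is
  continued across the line as a holomorphic G, with the difference quotient E filling the removable
  singularity, and is bounded on a compact rectangle with one side on Re s = 1, where
  \<open>zeta_reg\<close> has no zero.\<close>

lemma mdiff_2_bounded_near_1:
  "\<exists>M. \<forall>s. 1 < Re s \<and> Re s \<le> 2 \<and> \<bar>Im s\<bar> \<le> 1 \<longrightarrow> norm (mdiff 2 s) \<le> M"
proof -
  define E where "E = (\<lambda>s. if s = 1 then deriv zeta_reg 1 else (zeta_reg s - zeta_reg 1) / (s - 1))"
  define \<Omega> where "\<Omega> = {s. Re s > 0} \<inter> zeta_reg -` (- {0})"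
  define G where "G = (\<lambda>s. deriv zeta_reg s * inverse (zeta_reg s) + E s)"
  have op: "open {s. Re s > 0}" by (simp add: open_halfspace_Re_gt)
  have \<Omega>: "open \<Omega>" unfolding \<Omega>_def
    by (rule continuous_open_preimage[OF holomorphic_on_imp_continuous_on[OF zeta_reg_holomorphic] op]) auto
  have E: "E holomorphic_on {s. Re s > 0}" unfolding E_def by (rule pole_lemma_open[OF zeta_reg_holomorphic op])
  have G: "G holomorphic_on \<Omega>" unfolding G_def
    by (intro holomorphic_intros holomorphic_on_subset[OF E] holomorphic_on_subset[OF zeta_reg_holomorphic]
       holomorphic_on_subset[OF holomorphic_deriv[OF zeta_reg_holomorphic op]]) (auto simp: \<Omega>_def)
  have S: "open {s. Re s > 1}" by (simp add: open_halfspace_Re_gt)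
  have g0: "- mdiff 0 s = G s" if "Re s > 1" for s
  proof -
    have "s \<noteq> 1" using that by auto
    then show ?thesis using mdiff_0_eq[OF that] by (simp add: G_def E_def zeta_reg_1 divide_inverse)
  qed
  have g1: "deriv G s = - mdiff 1 s" if "Re s > 1" for s
  proof (rule DERIV_imp_deriv)
    have "((\<lambda>s. - mdiff 0 s) has_field_derivative - mdiff 1 s) (at s)"
      using DERIV_minus[OF has_field_derivative_mdiff[OF that, of 0]] by simp
    then show "(G has_field_derivative - mdiff 1 s) (at s)"
      by (rule has_field_derivative_transform_within_open[OF _ S]) (use that g0 in auto)
  qed
  have g2: "deriv (deriv G) s = - mdiff 2 s" if "Re s > 1" for s
  proof (rule DERIV_imp_deriv)
    have "((\<lambda>s. - mdiff 1 s) has_field_derivative - mdiff 2 s) (at s)"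
      using DERIV_minus[OF has_field_derivative_mdiff[OF that, of 1]] by (simp add: numeral_2_eq_2)
    then show "(deriv G has_field_derivative - mdiff 2 s) (at s)"
      by (rule has_field_derivative_transform_within_open[OF _ S]) (use that g1 in auto)
  qed
  define R where "R = cbox (Complex 1 (-1)) (Complex 2 1)"
  have R: "s \<in> R \<longleftrightarrow> 1 \<le> Re s \<and> Re s \<le> 2 \<and> \<bar>Im s\<bar> \<le> 1" for s by (auto simp: R_def in_cbox_complex_iff)
  have "R \<subseteq> \<Omega>" using R zeta_reg_nonzero by (auto simp: \<Omega>_def)
  moreover have "deriv (deriv G) holomorphic_on \<Omega>" by (intro holomorphic_deriv G \<Omega>)
  ultimately have "continuous_on R (deriv (deriv G))"
    using holomorphic_on_imp_continuous_on holomorphic_on_subset by blast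
  then have "bounded (deriv (deriv G) ` R)"
    by (intro compact_imp_bounded compact_continuous_image) (auto simp: R_def)
  then obtain M where M: "\<And>s. s \<in> R \<Longrightarrow> norm (deriv (deriv G) s) \<le> M" unfolding bounded_iff by blast
  show ?thesis
  proof (intro exI[of _ M] allI impI)
    fix s assume s: "1 < Re s \<and> Re s \<le> 2 \<and> \<bar>Im s\<bar> \<le> 1"
    then show "norm (mdiff 2 s) \<le> M" using M[of s] R[of s] g2[of s] by simp
  qed
qed

lemma norm_mdiff_2_le:
  "\<exists>K>0. \<forall>s. 1 < Re s \<and> Re s \<le> 2 \<longrightarrow> norm (mdiff 2 s) \<le> K * (\<bar>Im s\<bar> + 4) powr (1 / 4)"
proof -
  obtain M where M: "\<And>s. 1 < Re s \<Longrightarrow> Re s \<le> 2 \<Longrightarrow> \<bar>Im s\<bar> \<le> 1 \<Longrightarrow> norm (mdiff 2 s) \<le> M"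
    using mdiff_2_bounded_near_1 by blast
  \<comment> \<open>Each product of a derivative with W is O(T^(6 \<theta>)), and the worst term has
    three of them: 18 \<theta> = 1/4.\<close>
  define \<theta> :: real where "\<theta> = 1 / 72"
  have \<theta>: "0 < \<theta>" "\<theta> \<le> 1" by (auto simp: \<theta>_def)
  obtain C where C: "C > 0" "\<And>j s. j \<le> 3 \<Longrightarrow> 1 \<le> Re s \<Longrightarrow> Re s \<le> 2 \<Longrightarrow> norm ((deriv ^^ j) zeta_reg s) \<le> C * (\<bar>Im s\<bar> + 4) powr (1 + \<theta>)"
    using norm_deriv_zeta_reg_le[OF \<theta>] by blast
  obtain c where c: "c > 0" "\<And>s. 1 \<le> Re s \<Longrightarrow> Re s \<le> 2 \<Longrightarrow> \<bar>Im s\<bar> \<ge> 1 \<Longrightarrow> c * (\<bar>Im s\<bar> + 4) powr (1 - 5 * \<theta>) \<le> norm (zeta_reg s)"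
    using norm_zeta_reg_ge[OF \<theta>] by blast
  define q where "q = C / c"
  have q: "q > 0" using C c by (simp add: q_def)
  have q23: "0 \<le> q ^ 2" "0 \<le> q ^ 3" using q by auto
  define K where "K = \<bar>M\<bar> + (q + 3 * q ^ 2 + 2 * q ^ 3 + 25 * C + 2)"
  have K: "K > 0" using q C(1) q23 unfolding K_def by linarith
  show ?thesis
  proof (intro exI[of _ K] conjI allI impI K)
    fix s assume s: "1 < Re s \<and> Re s \<le> 2"
    define T where "T = \<bar>Im s\<bar> + 4"
    have T: "T \<ge> 4" by (simp add: T_def)
    have T1: "1 \<le> T powr (1 / 4)" using T by (simp add: ge_one_powr_ge_zero)
    show "norm (mdiff 2 s) \<le> K * (\<bar>Im s\<bar> + 4) powr (1 / 4)"
    proof (cases "\<bar>Im s\<bar> \<le> 1")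
      case True
      then have "norm (mdiff 2 s) \<le> M" using M s by auto
      also have "\<dots> \<le> K" using q C(1) q23 abs_ge_self[of M] unfolding K_def by linarith
      also have "\<dots> = K * 1" by simp
      also have "\<dots> \<le> K * T powr (1 / 4)" using K T1 by (intro mult_left_mono) auto
      finally show ?thesis by (simp add: T_def)
    next
      case False
      define Z where "Z = (\<lambda>k. (deriv ^^ k) zeta_reg s)"
      define W where "W = inverse (zeta_reg s)"
      define V where "V = inverse (s - 1)"
      define R where "R = T powr (6 * \<theta>)"
      have R: "R \<ge> 1" unfolding R_def using T \<theta> by (simp add: ge_one_powr_ge_zero)
      have R3: "R ^ 3 = T powr (1 / 4)" using T by (simp add: R_def \<theta>_def powr_powr flip: powr_numeral)
      have R23: "R \<le> R ^ 3" "R ^ 2 \<le> R ^ 3" using R power_increasing[of 1 3 R] power_increasing[of 2 3 R] by auto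
      have Z: "norm (Z j) \<le> C * T powr (1 + \<theta>)" if "j \<le> 3" for j using C(2)[OF that, of s] s by (simp add: Z_def T_def)
      have W: "norm W \<le> inverse (c * T powr (1 - 5 * \<theta>))"
        unfolding W_def norm_inverse using c(2)[of s] s False c(1) T by (intro le_imp_inverse_le) (auto simp: T_def)
      have ZW: "norm (Z j) * norm W \<le> q * R" if "j \<le> 3" for j
      proof -
        have "norm (Z j) * norm W \<le> (C * T powr (1 + \<theta>)) * inverse (c * T powr (1 - 5 * \<theta>))"
          using C(1) by (intro mult_mono Z W that) auto
        also have "\<dots> = q * (T powr (1 + \<theta>) * T powr (- (1 - 5 * \<theta>)))" 
          unfolding powr_minus[of T "1 - 5 * \<theta>"] by (simp add: q_def field_simps)
        also have "T powr (1 + \<theta>) * T powr (- (1 - 5 * \<theta>)) = R" by (simp add: R_def powr_add[symmetric])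
        finally show ?thesis .
      qed
      have V: "norm V \<le> 5 / T" "norm V \<le> 1"
      proof -
        have "\<bar>Im s\<bar> \<le> norm (s - 1)" using abs_Im_le_cmod[of "s - 1"] by simp
        then have "norm V \<le> inverse \<bar>Im s\<bar>" unfolding V_def norm_inverse using False by (intro le_imp_inverse_le) auto
        moreover have "inverse \<bar>Im s\<bar> \<le> 5 / T" "inverse \<bar>Im s\<bar> \<le> 1" using False by (auto simp: T_def field_simps)
        ultimately show "norm V \<le> 5 / T" "norm V \<le> 1" by linarith+
      qed
      have ZV: "norm (Z j) * norm V \<le> 5 * C * R" if "j \<le> 3" for j
      proof -
        have "norm (Z j) * norm V \<le> (C * T powr (1 + \<theta>)) * (5 / T)" using C(1) by (intro mult_mono Z V that) auto
        also have "\<dots> = 5 * C * T powr \<theta>" using T by (simp add: powr_add)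
        also have "\<dots> \<le> 5 * C * R" unfolding R_def using C(1) T \<theta> by (intro mult_left_mono powr_mono) auto
        finally show ?thesis .
      qed
      have ZVk: "norm (Z j) * norm V ^ Suc k \<le> 5 * C * R" if "j \<le> 3" for j k
      proof -
        have "norm (Z j) * norm V ^ Suc k = (norm (Z j) * norm V) * norm V ^ k" by simp
        also have "\<dots> \<le> (5 * C * R) * 1" using V(2) C(1) R by (intro mult_mono ZV that power_le_one) auto
        finally show ?thesis by simp
      qed
      have b1: "norm (Z 3 * W) \<le> q * R ^ 3"
        using order_trans[OF ZW[of 3] mult_left_mono[OF R23(1), of q]] q by (simp add: norm_mult)
      have b2: "norm (3 * Z 1 * Z 2 * W ^ 2) \<le> 3 * q ^ 2 * R ^ 3"
      proof -
        have "norm (3 * Z 1 * Z 2 * W ^ 2) = 3 * ((norm (Z 1) * norm W) * (norm (Z 2) * norm W))"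
          by (simp add: norm_mult norm_power power2_eq_square)
        also have "\<dots> \<le> 3 * ((q * R) * (q * R))" using q R by (intro mult_left_mono mult_mono ZW) auto
        also have "\<dots> = 3 * q ^ 2 * R ^ 2" by (simp add: power2_eq_square)
        also have "\<dots> \<le> 3 * q ^ 2 * R ^ 3" using R23 by (intro mult_left_mono) auto
        finally show ?thesis .
      qed
      have b3: "norm (2 * Z 1 ^ 3 * W ^ 3) \<le> 2 * q ^ 3 * R ^ 3"
      proof -
        have "norm (2 * Z 1 ^ 3 * W ^ 3) = 2 * (norm (Z 1) * norm W) ^ 3" by (simp add: norm_mult norm_power power_mult_distrib)
        also have "\<dots> \<le> 2 * (q * R) ^ 3" by (intro mult_left_mono power_mono ZW) auto
        finally show ?thesis by (simp add: power_mult_distrib)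
      qed
      have b4: "norm (Z 2 * V) \<le> 5 * C * R" using ZV[of 2] by (simp add: norm_mult)
      have b5: "norm (2 * Z 1 * V ^ 2) \<le> 10 * C * R" using ZVk[of 1 1] by (simp add: norm_mult norm_power numeral_2_eq_2 mult_ac)
      have b6: "norm (2 * (Z 0 - 1) * V ^ 3) \<le> 10 * C * R + 2"
      proof -
        have "norm (2 * (Z 0 - 1) * V ^ 3) = 2 * (norm (Z 0 - 1) * norm V ^ 3)"
          by (simp only: norm_mult norm_power norm_numeral mult.assoc)
        also have "\<dots> \<le> 2 * ((norm (Z 0) + 1) * norm V ^ 3)"
          using norm_triangle_ineq4[of "Z 0" 1] by (intro mult_left_mono mult_right_mono) auto
        also have "\<dots> = 2 * (norm (Z 0) * norm V ^ Suc 2) + 2 * norm V ^ 3" by (simp add: algebra_simps eval_nat_numeral)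
        also have "\<dots> \<le> 2 * (5 * C * R) + 2 * 1" using V(2) by (intro add_mono mult_left_mono ZVk power_le_one) auto
        finally show ?thesis by simp
      qed
      have "norm (mdiff 2 s) = norm (Z 3 * W - 3 * Z 1 * Z 2 * W ^ 2 + 2 * Z 1 ^ 3 * W ^ 3 + Z 2 * V - 2 * Z 1 * V ^ 2 + 2 * (Z 0 - 1) * V ^ 3)"
        using mdiff_2_eq[of s] s unfolding Z_def W_def V_def by (simp only: norm_minus_cancel)
      also have "\<dots> \<le> norm (Z 3 * W) + norm (3 * Z 1 * Z 2 * W ^ 2) + norm (2 * Z 1 ^ 3 * W ^ 3) + norm (Z 2 * V) + norm (2 * Z 1 * V ^ 2) + norm (2 * (Z 0 - 1) * V ^ 3)"
        by (intro norm_triangle_le norm_triangle_le_diff add_mono order.refl)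
      also have "\<dots> \<le> q * R ^ 3 + 3 * q ^ 2 * R ^ 3 + 2 * q ^ 3 * R ^ 3 + 5 * C * R + 10 * C * R + (10 * C * R + 2)"
        by (intro add_mono b1 b2 b3 b4 b5 b6)
      also have "\<dots> \<le> q * R ^ 3 + 3 * q ^ 2 * R ^ 3 + 2 * q ^ 3 * R ^ 3 + 5 * C * R ^ 3 + 10 * C * R ^ 3 + (10 * C * R ^ 3 + 2 * R ^ 3)"
        using C(1) R R23 by (intro add_mono mult_left_mono order.refl) auto
      also have "\<dots> = (q + 3 * q ^ 2 + 2 * q ^ 3 + 25 * C + 2) * R ^ 3" by (simp add: algebra_simps)
      also have "\<dots> \<le> K * R ^ 3" using R by (intro mult_right_mono) (auto simp: K_def)
      finally show ?thesis by (simp add: R3 T_def)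
    qed
  qed
qed

text \<open>The characteristic function of the standard normal law is again a Gaussian, so averaging
  n^(-\<sigma> - iu/\<tau>) e^(iuL/\<tau>) over normally distributed u yields the weight exp(-v^2/2)
  centred at ln n = L. All points stay on a line Re s = \<sigma> > 1, where the series converges
  absolutely and may be integrated termwise.\<close>

lemma gaussian_dirichlet_sum:
  fixes L \<tau> \<sigma> :: real
  assumes a: "abs_conv_dirichlet a" and \<sigma>: "\<sigma> > 1"
  defines "v \<equiv> (\<lambda>n. - ((ln (real n) - L) / \<tau>))"
  shows "(\<lambda>n. a n * of_real (real n powr (-\<sigma>) * exp (- (v n)\<^sup>2 / 2))) sums
    (LINT u|std_normal_distribution. iexp (u * L / \<tau>) * dirichlet_series a (Complex \<sigma> (u / \<tau>)))"
proof -
  interpret N: prob_space std_normal_distribution using real_dist_normal_dist real_distribution.axioms(1) by blast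
  define f where "f = (\<lambda>n u. a n * of_real (real n powr (-\<sigma>)) * iexp (v n * u))"
  have sm: "summable (\<lambda>n. norm (a n) * real n powr (-\<sigma>))" using a \<sigma> by (simp add: abs_conv_dirichlet_def)
  have nf: "norm (f n u) = norm (a n) * real n powr (-\<sigma>)" for n u by (simp add: f_def norm_mult)
  have f_eq: "f n u = iexp (u * L / \<tau>) * (a n * of_nat n powr (- Complex \<sigma> (u / \<tau>)))" for n u
  proof (cases "n = 0")
    case False
    have "of_nat n powr (- Complex \<sigma> (u / \<tau>)) = exp (- Complex \<sigma> (u / \<tau>) * of_real (ln (real n)))"
      using False Ln_of_real[of "real n"] by (simp add: powr_def)
    also have "- Complex \<sigma> (u / \<tau>) * of_real (ln (real n)) = of_real (- \<sigma> * ln (real n)) + \<i> * of_real (- (u / \<tau>) * ln (real n))"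
      by (simp add: complex_eq_iff)
    also have "exp \<dots> = of_real (real n powr (-\<sigma>)) * iexp (- (u / \<tau>) * ln (real n))"
      unfolding exp_add exp_of_real using False by (simp only: powr_def) simp
    finally have "iexp (u * L / \<tau>) * (a n * of_nat n powr (- Complex \<sigma> (u / \<tau>))) =
       a n * of_real (real n powr (-\<sigma>)) * (iexp (u * L / \<tau>) * iexp (- (u / \<tau>) * ln (real n)))" by simp
    also have "iexp (u * L / \<tau>) * iexp (- (u / \<tau>) * ln (real n)) = iexp (v n * u)"
      unfolding exp_add[symmetric] by (rule arg_cong[of _ _ exp]) (simp add: v_def complex_eq_iff diff_divide_distrib algebra_simps)
    finally show ?thesis unfolding f_def by (rule sym)
  qed (simp add: f_def)
  have int: "integrable std_normal_distribution (f n)" for n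
    by (rule N.integrable_const_bound[of _ "norm (a n) * real n powr (-\<sigma>)"]) (simp add: nf, simp add: f_def)
  have "(\<lambda>n. integral\<^sup>L std_normal_distribution (f n)) sums (LINT u|std_normal_distribution. (\<Sum>n. f n u))"
  proof (rule sums_integral[OF int])
    show "AE u in std_normal_distribution. summable (\<lambda>n. norm (f n u))" using sm by (simp add: nf)
    show "summable (\<lambda>n. LINT u|std_normal_distribution. norm (f n u))" using sm N.prob_space by (simp add: nf)
  qed
  moreover have "integral\<^sup>L std_normal_distribution (f n) = a n * of_real (real n powr (-\<sigma>) * exp (- (v n)\<^sup>2 / 2))" for n
  proof -
    have "integral\<^sup>L std_normal_distribution (f n) = a n * of_real (real n powr (-\<sigma>)) * char std_normal_distribution (v n)"
      unfolding f_def char_def by simp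
    then show ?thesis by (simp add: char_std_normal_distribution)
  qed
  moreover have "(\<Sum>n. f n u) = iexp (u * L / \<tau>) * dirichlet_series a (Complex \<sigma> (u / \<tau>))" for u
    unfolding f_eq dirichlet_series_def using \<sigma> by (intro suminf_mult abs_conv_dirichlet_summable a) auto
  ultimately show ?thesis by (simp only:)
qed

text \<open>The second derivative grows at most like |t|^(1/4) at height t = u/\<tau>, and
  \<tau>^(-1/4) is what remains after averaging over u. The bound is uniform in \<sigma>, so
  \<sigma> may later tend to 1 with growing L.\<close>

lemma gaussian_mangoldt_bound:
  "\<exists>K>0. \<forall>\<sigma> \<tau> L. 1 < \<sigma> \<and> \<sigma> \<le> 2 \<and> 0 < \<tau> \<and> \<tau> \<le> 1 \<longrightarrow>
    \<bar>\<Sum>n. (mangoldt n - 1) * (ln (real n))\<^sup>2 * real n powr (-\<sigma>) * exp (- ((ln (real n) - L) / \<tau>)\<^sup>2 / 2)\<bar> \<le> K * \<tau> powr (-1/4)"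
proof -
  obtain K where K: "K > 0" "\<And>s. 1 < Re s \<Longrightarrow> Re s \<le> 2 \<Longrightarrow> norm (mdiff 2 s) \<le> K * (\<bar>Im s\<bar> + 4) powr (1 / 4)"
    using norm_mdiff_2_le by blast
  define a where "a = (\<lambda>n. (ln_twist ^^ 2) mangoldt n - (ln_twist ^^ 2) (\<lambda>_. 1) n)"
  have a_eq: "a n = of_real ((mangoldt n - 1) * (ln (real n))\<^sup>2)" for n
    by (simp add: a_def ln_twist_def numeral_2_eq_2 algebra_simps)
  have cm: "abs_conv_dirichlet ((ln_twist ^^ 2) mangoldt)" and c1: "abs_conv_dirichlet ((ln_twist ^^ 2) (\<lambda>_. 1))"
    by (intro abs_conv_dirichlet_ln_twist_pow abs_conv_dirichlet_mangoldt abs_conv_dirichlet_const)+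
  have ca: "abs_conv_dirichlet a"
    unfolding abs_conv_dirichlet_def
  proof (intro allI impI)
    fix \<sigma> :: real assume "\<sigma> > 1"
    then have "summable (\<lambda>n. norm ((ln_twist ^^ 2) mangoldt n) * real n powr (-\<sigma>) + norm ((ln_twist ^^ 2) (\<lambda>_. 1) n) * real n powr (-\<sigma>))"
      using cm c1 by (intro summable_add) (auto simp: abs_conv_dirichlet_def)
    then show "summable (\<lambda>n. norm (a n) * real n powr (-\<sigma>))"
    proof (rule summable_comparison_test')
      fix n :: nat
      have "norm (a n) * real n powr (-\<sigma>) \<le> (norm ((ln_twist ^^ 2) mangoldt n) + norm ((ln_twist ^^ 2) (\<lambda>_. 1) n)) * real n powr (-\<sigma>)"
        unfolding a_def by (intro mult_right_mono norm_triangle_ineq4) auto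
      then show "norm (norm (a n) * real n powr (-\<sigma>)) \<le> norm ((ln_twist ^^ 2) mangoldt n) * real n powr (-\<sigma>) + norm ((ln_twist ^^ 2) (\<lambda>_. 1) n) * real n powr (-\<sigma>)"
        by (simp add: algebra_simps)
    qed
  qed
  have da: "dirichlet_series a s = mdiff 2 s" if "Re s > 1" for s
  proof -
    have "dirichlet_series a s = (\<Sum>n. (ln_twist ^^ 2) mangoldt n * of_nat n powr (-s) - (ln_twist ^^ 2) (\<lambda>_. 1) n * of_nat n powr (-s))"
      unfolding dirichlet_series_def a_def by (simp add: algebra_simps)
    also have "\<dots> = mdiff 2 s" unfolding mdiff_def dirichlet_series_def
      using suminf_diff[OF abs_conv_dirichlet_summable[OF cm that] abs_conv_dirichlet_summable[OF c1 that]] by simp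
    finally show ?thesis .
  qed
  show ?thesis
  proof (intro exI[of _ "6 * K"] conjI allI impI)
    fix \<sigma> \<tau> L :: real assume H: "1 < \<sigma> \<and> \<sigma> \<le> 2 \<and> 0 < \<tau> \<and> \<tau> \<le> 1"
    \<comment> \<open>A quadratic majorant, so that only the second moment of the normal law enters;
      its mean gives the factor 5 + 1 = 6.\<close>
    define g where "g = (\<lambda>u::real. K * \<tau> powr (-1/4) * (5 + u ^ 2))"
    have int2: "integrable std_normal_distribution (\<lambda>u::real. u ^ 2)" by (rule integrable_std_normal_distribution_moment)
    interpret N: prob_space std_normal_distribution using real_dist_normal_dist real_distribution.axioms(1) by blast
    have intg: "integrable std_normal_distribution g" unfolding g_def
      by (intro integrable_mult_right Bochner_Integration.integrable_add int2 N.integrable_const)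
    have "(LINT u|std_normal_distribution. u ^ (2 * 1)) = fact (2 * 1) / (2 ^ 1 * fact 1)"
      by (rule std_normal_distribution_even_moments)
    then have m2: "(LINT u|std_normal_distribution. u ^ 2) = 1" by (simp add: fact_2)
    have ig: "integral\<^sup>L std_normal_distribution g = 6 * K * \<tau> powr (-1/4)"
      unfolding g_def using int2 m2 N.prob_space by (simp add: Bochner_Integration.integral_add)
    have pw: "norm (iexp (u * L / \<tau>) * dirichlet_series a (Complex \<sigma> (u / \<tau>))) \<le> g u" for u
    proof -
      have "norm (iexp (u * L / \<tau>) * dirichlet_series a (Complex \<sigma> (u / \<tau>))) = norm (mdiff 2 (Complex \<sigma> (u / \<tau>)))"
        using H by (simp add: norm_mult da)
      also have "\<dots> \<le> K * (\<bar>u / \<tau>\<bar> + 4) powr (1 / 4)" using K(2)[of "Complex \<sigma> (u / \<tau>)"] H by simp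
      also have "\<dots> \<le> K * (inverse \<tau> * (\<bar>u\<bar> + 4)) powr (1 / 4)"
      proof -
        have "\<bar>u / \<tau>\<bar> + 4 \<le> inverse \<tau> * (\<bar>u\<bar> + 4)" using H by (simp add: field_simps)
        then show ?thesis using K(1) by (intro mult_left_mono powr_mono2) auto
      qed
      also have "\<dots> = K * (\<tau> powr (-1/4) * (\<bar>u\<bar> + 4) powr (1 / 4))"
        using H by (simp add: powr_mult powr_minus inverse_powr)
      also have "\<dots> \<le> K * (\<tau> powr (-1/4) * (\<bar>u\<bar> + 4) powr 1)"
        using K(1) by (intro mult_left_mono powr_mono) auto
      also have "\<dots> \<le> K * (\<tau> powr (-1/4) * (5 + u ^ 2))"
      proof -
        have "\<bar>u\<bar> \<le> 1 + u ^ 2" using zero_le_power2[of "\<bar>u\<bar> - 1"] abs_ge_zero[of u] by (simp add: power2_eq_square algebra_simps del: zero_le_power2)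
        then show ?thesis using K(1) by (intro mult_left_mono) auto
      qed
      finally show ?thesis by (simp add: g_def mult.assoc)
    qed
    define v where "v = (\<lambda>n. - ((ln (real n) - L) / \<tau>))"
    have S: "(\<lambda>n. a n * of_real (real n powr (-\<sigma>) * exp (- (v n)\<^sup>2 / 2))) sums
      (LINT u|std_normal_distribution. iexp (u * L / \<tau>) * dirichlet_series a (Complex \<sigma> (u / \<tau>)))"
      unfolding v_def using H by (intro gaussian_dirichlet_sum ca) auto
    have "norm (LINT u|std_normal_distribution. iexp (u * L / \<tau>) * dirichlet_series a (Complex \<sigma> (u / \<tau>)))
      \<le> (LINT u|std_normal_distribution. norm (iexp (u * L / \<tau>) * dirichlet_series a (Complex \<sigma> (u / \<tau>))))"
      by (rule integral_norm_bound)
    also have "\<dots> \<le> integral\<^sup>L std_normal_distribution g"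
      by (rule integral_mono'[OF intg pw]) (use K in \<open>auto simp: g_def\<close>)
    finally have nb: "norm (LINT u|std_normal_distribution. iexp (u * L / \<tau>) * dirichlet_series a (Complex \<sigma> (u / \<tau>))) \<le> 6 * K * \<tau> powr (-1/4)"
      by (simp add: ig)
    define r where "r = (\<lambda>n. (mangoldt n - 1) * (ln (real n))\<^sup>2 * real n powr (-\<sigma>) * exp (- ((ln (real n) - L) / \<tau>)\<^sup>2 / 2))"
    have "(\<lambda>n. complex_of_real (r n)) sums (LINT u|std_normal_distribution. iexp (u * L / \<tau>) * dirichlet_series a (Complex \<sigma> (u / \<tau>)))"
      using S unfolding a_eq r_def v_def by (simp add: mult.assoc)
    then have "complex_of_real (suminf r) = (LINT u|std_normal_distribution. iexp (u * L / \<tau>) * dirichlet_series a (Complex \<sigma> (u / \<tau>)))"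
      using suminf_of_real[of r, where 'a = complex] summable_of_real_iff[of r, where 'a = complex] by (simp add: sums_iff)
    then have "\<bar>suminf r\<bar> \<le> 6 * K * \<tau> powr (-1/4)" using nb unfolding norm_of_real[of "suminf r", where 'a = complex, symmetric] by simp
    then show "\<bar>\<Sum>n. (mangoldt n - 1) * (ln (real n))\<^sup>2 * real n powr (-\<sigma>) * exp (- ((ln (real n) - L) / \<tau>)\<^sup>2 / 2)\<bar> \<le> 6 * K * \<tau> powr (-1/4)"
      by (simp add: r_def)
  qed (use K in auto)
qed

section \<open>Comparison of the weighted sums, and a prime near exp(L)\<close>

lemma summable_ln_pow_powr:
  assumes "\<sigma> > 1"
  shows "summable (\<lambda>n. (ln (real n)) ^ k * real n powr (-\<sigma>))"
proof -
  have "abs_conv_dirichlet ((ln_twist ^^ k) (\<lambda>_. 1))" by (intro abs_conv_dirichlet_ln_twist_pow abs_conv_dirichlet_const)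
  then have "summable (\<lambda>n. norm ((ln_twist ^^ k) (\<lambda>_. 1) n) * real n powr (-\<sigma>))" using assms by (simp add: abs_conv_dirichlet_def)
  moreover have "norm ((ln_twist ^^ k) (\<lambda>_. 1) n) = \<bar>ln (real n)\<bar> ^ k" for n
    by (induction k) (auto simp: ln_twist_def norm_mult)
  moreover have "\<bar>ln (real n)\<bar> = ln (real n)" for n by (cases "n = 0") auto
  ultimately show ?thesis by simp
qed

text \<open>Half of the margin 1/L in the exponent absorbs (ln n)^3 at the price (6 L)^3, and zeta(1
  + 1/(2L)) = O(L) supplies the fourth factor.\<close>

lemma suminf_ln_cube_le:
  "\<exists>C>0. \<forall>L\<ge>1. (\<Sum>n. (ln (real n)) ^ 3 * real n powr (-(1 + 1 / L))) \<le> C * L ^ 4"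
proof -
  obtain C where C: "C > 0" "\<And>x. 1 < x \<Longrightarrow> x \<le> 2 \<Longrightarrow> norm (zeta (of_real x)) \<le> C / (x - 1)"
    using norm_zeta_real_le by blast
  show ?thesis
  proof (intro exI[of _ "432 * C"] conjI allI impI)
    fix L :: real assume L: "L \<ge> 1"
    define x where "x = 1 + 1 / (2 * L)"
    have x: "1 < x" "x \<le> 2" using L by (auto simp: x_def field_simps)
    have sx: "summable (\<lambda>n. real n powr (-x))" using x by (simp add: summable_real_powr_iff)
    have "(\<lambda>n. complex_of_real (real n powr (-x))) sums of_real (\<Sum>n. real n powr (-x))"
      by (intro sums_of_real summable_sums sx)
    moreover have "complex_of_real (real n powr (-x)) = 1 * of_nat n powr (- of_real x)" for n
      using powr_of_real[of "real n" "-x"] by simp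
    ultimately have "zeta (of_real x) = of_real (\<Sum>n. real n powr (-x))"
      unfolding dirichlet_series_def by (simp add: sums_iff)
    then have "(\<Sum>n. real n powr (-x)) \<le> norm (zeta (of_real x))" by (metis abs_ge_self norm_of_real)
    also have "\<dots> \<le> C * (2 * L)" using C(2)[OF x] L by (simp add: x_def)
    finally have zx: "(\<Sum>n. real n powr (-x)) \<le> C * (2 * L)" .
    have "(\<Sum>n. (ln (real n)) ^ 3 * real n powr (-(1 + 1 / L))) \<le> (\<Sum>n. 216 * L ^ 3 * real n powr (-x))"
    proof (rule suminf_le)
      fix n
      show "(ln (real n)) ^ 3 * real n powr (-(1 + 1 / L)) \<le> 216 * L ^ 3 * real n powr (-x)"
      proof (cases "n = 0")
        case False
        have "ln (real n) \<le> real n powr (1 / (6 * L)) / (1 / (6 * L))" using False L by (intro ln_powr_bound) auto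
        then have "(ln (real n)) ^ 3 \<le> (6 * L * real n powr (1 / (6 * L))) ^ 3"
          using False by (intro power_mono) (auto simp: mult_ac)
        also have "\<dots> = 216 * L ^ 3 * real n powr (1 / (2 * L))"
          using False by (simp add: power_mult_distrib powr_powr flip: powr_numeral)
        finally have "(ln (real n)) ^ 3 * real n powr (-(1 + 1 / L)) \<le> 216 * L ^ 3 * real n powr (1 / (2 * L)) * real n powr (-(1 + 1 / L))"
          by (intro mult_right_mono) auto
        also have "\<dots> = 216 * L ^ 3 * real n powr (1 / (2 * L) + -(1 + 1 / L))" by (simp only: powr_add mult.assoc)
        also have "1 / (2 * L) + -(1 + 1 / L) = - x" using L by (simp add: x_def field_simps)
        finally show ?thesis .
      qed auto
      show "summable (\<lambda>n. (ln (real n)) ^ 3 * real n powr (-(1 + 1 / L)))" using L by (intro summable_ln_pow_powr) auto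
      show "summable (\<lambda>n. 216 * L ^ 3 * real n powr (-x))" by (intro summable_mult sx)
    qed
    also have "\<dots> = 216 * L ^ 3 * (\<Sum>n. real n powr (-x))" by (rule suminf_mult[OF sx])
    also have "\<dots> \<le> 216 * L ^ 3 * (C * (2 * L))" using L zx by (intro mult_left_mono) auto
    finally show "(\<Sum>n. (ln (real n)) ^ 3 * real n powr (-(1 + 1 / L))) \<le> 432 * C * L ^ 4"
      by (simp add: eval_nat_numeral mult_ac)
  qed (use C in auto)
qed

text \<open>The base of a proper prime power is at most the square root of the number, and the
  exponent is at most 2 (L + 1) because ln 2 \<ge> 1/2.\<close>

lemma card_proper_prime_powers:
  fixes L :: real
  assumes "L \<ge> 1"
  defines "P \<equiv> {n::nat. primepow n \<and> \<not> prime n \<and> ln (real n) \<le> L + 1}"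
  shows "finite P" "real (card P) \<le> exp ((L + 1) / 2) * (2 * L + 3)"
proof -
  define A B where "A = nat \<lfloor>exp ((L + 1) / 2)\<rfloor>" and "B = nat \<lfloor>2 * (L + 1)\<rfloor>"
  have sub: "P \<subseteq> (\<lambda>(m,k). m ^ k) ` ({1..A} \<times> {..B})"
  proof
    fix n assume n: "n \<in> P"
    then obtain p k where pk: "prime p" "k > 0" "n = p ^ k" unfolding P_def primepow_def by auto
    have k: "k \<ge> 2" using n pk by (cases "k = 1") (auto simp: P_def)
    have p2: "p \<ge> 2" using pk prime_ge_2_nat by blast
    have l: "real k * ln (real p) \<le> L + 1" using n pk p2 by (simp add: P_def ln_realpow)
    have "2 * ln (real p) \<le> real k * ln (real p)" using k p2 by (intro mult_right_mono) auto
    then have "ln (real p) \<le> (L + 1) / 2" using l by simp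
    then have "real p \<le> exp ((L + 1) / 2)" using p2 by (metis exp_le_cancel_iff exp_ln gr0I not_numeral_le_zero of_nat_0_less_iff)
    then have pA: "p \<le> A" unfolding A_def by (simp add: le_nat_floor)
    have "1 / 2 \<le> ln (2::real)" using ln2_ge_two_thirds by simp
    also have "\<dots> \<le> ln (real p)" using p2 by simp
    finally have "real k * (1 / 2) \<le> real k * ln (real p)" by (intro mult_left_mono) auto
    then have "real k \<le> 2 * (L + 1)" using l by simp
    then have "k \<le> B" unfolding B_def by (rule le_nat_floor)
    then show "n \<in> (\<lambda>(m,k). m ^ k) ` ({1..A} \<times> {..B})" using pA p2 pk by (intro image_eqI[of _ _ "(p, k)"]) auto
  qed
  then show "finite P" by (rule finite_subset) auto
  have "card P \<le> card ((\<lambda>(m,k). m ^ k) ` ({1..A} \<times> {..B}))" using sub by (intro card_mono) auto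
  also have "\<dots> \<le> card ({1..A} \<times> {..B})" by (rule card_image_le) auto
  also have "\<dots> = A * (B + 1)" by (simp add: card_cartesian_product)
  finally have "real (card P) \<le> real A * (real B + 1)" by (metis of_nat_le_iff of_nat_mult of_nat_add of_nat_1)
  also have "\<dots> \<le> exp ((L + 1) / 2) * (2 * L + 3)"
    using assms by (intro mult_mono) (auto simp: A_def B_def)
  finally show "real (card P) \<le> exp ((L + 1) / 2) * (2 * L + 3)" .
qed

text \<open>The integers with ln n between L and L + \<tau> suffice, and \<open>big\<close>
  guarantees at least exp(L) \<tau> / 2 of them in spite of rounding. The choice \<sigma> = 1 + 1/L
  keeps n^(-\<sigma>) within a constant factor of exp(-L) there.\<close>

lemma suminf_ln_sq_gaussian_ge:
  fixes L \<tau> \<sigma> :: real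
  assumes L: "L \<ge> 1" and \<tau>: "0 < \<tau>" "\<tau> \<le> 1" and big: "2 \<le> exp L * \<tau>" and \<sigma>: "\<sigma> = 1 + 1 / L"
    and sm: "summable (\<lambda>n. (ln (real n))\<^sup>2 * real n powr (-\<sigma>) * exp (- ((ln (real n) - L) / \<tau>)\<^sup>2 / 2))"
  shows "exp (-4) / 2 * L\<^sup>2 * \<tau> \<le> (\<Sum>n. (ln (real n))\<^sup>2 * real n powr (-\<sigma>) * exp (- ((ln (real n) - L) / \<tau>)\<^sup>2 / 2))"
proof -
  define I where "I = {nat \<lceil>exp L\<rceil>..nat \<lfloor>exp (L + \<tau>)\<rfloor>}"
  have I: "L \<le> ln (real n)" "ln (real n) \<le> L + \<tau>" "n > 0" if "n \<in> I" for n
  proof -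
    have n: "exp L \<le> real n" "real n \<le> exp (L + \<tau>)"
      using that unfolding I_def by (auto simp: le_nat_iff nat_le_iff ceiling_le_iff) (simp_all add: le_floor_iff)
    show "n > 0" using n(1) exp_gt_zero[of L] by (cases "n = 0") auto
    then show "L \<le> ln (real n)" "ln (real n) \<le> L + \<tau>"
      using n by (auto simp: ln_ge_iff) (metis exp_gt_zero ln_exp ln_le_cancel_iff of_nat_0_less_iff)
  qed
  have "exp L * \<tau> - 1 \<le> real (card I)"
  proof -
    have "exp L * \<tau> \<le> exp (L + \<tau>) - exp L" using exp_ge_add_one_self[of \<tau>] mult_left_mono[of "1 + \<tau>" "exp \<tau>" "exp L"]
      by (simp add: exp_add algebra_simps)
    moreover have "exp L \<ge> 0" "exp (L + \<tau>) \<ge> 0" by auto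
    moreover have "real (nat \<lceil>exp L\<rceil>) \<le> exp L + 1" "exp (L + \<tau>) - 1 \<le> real (nat \<lfloor>exp (L + \<tau>)\<rfloor>)"
      using of_int_ceiling_le_add_one[of "exp L"] real_of_int_floor_gt_diff_one[of "exp (L + \<tau>)"]
      by (auto simp: ceiling_mono order_less_imp_le)
    moreover have "real (card I) \<ge> real (nat \<lfloor>exp (L + \<tau>)\<rfloor>) + 1 - real (nat \<lceil>exp L\<rceil>)"
      unfolding I_def card_atLeastAtMost by linarith
    ultimately show ?thesis by linarith
  qed
  then have card: "exp L * \<tau> / 2 \<le> real (card I)" using big by linarith
  define f where "f = (\<lambda>n. (ln (real n))\<^sup>2 * real n powr (-\<sigma>) * exp (- ((ln (real n) - L) / \<tau>)\<^sup>2 / 2))"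
  have fI: "L\<^sup>2 * exp (- (L + 3)) * exp (-1) \<le> f n" if "n \<in> I" for n
    unfolding f_def
  proof (intro mult_mono)
    note n = I[OF that]
    show "L\<^sup>2 \<le> (ln (real n))\<^sup>2" using n L by (intro power_mono) auto
    have "\<sigma> * ln (real n) \<le> (1 + 1 / L) * (L + 1)" unfolding \<sigma> using n L \<tau> by (intro mult_left_mono) auto
    also have "\<dots> = L + 2 + 1 / L" using L by (simp add: field_simps)
    also have "\<dots> \<le> L + 3" using L by simp
    finally show "exp (- (L + 3)) \<le> real n powr (-\<sigma>)" using n by (simp add: powr_def)
    have "((ln (real n) - L) / \<tau>)\<^sup>2 \<le> 1"
      using n \<tau> by (intro power_le_one) (auto simp: field_simps)
    then show "exp (-1) \<le> exp (- ((ln (real n) - L) / \<tau>)\<^sup>2 / 2)" by simp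
  qed auto
  have "exp (-4) / 2 * L\<^sup>2 * \<tau> = exp L * \<tau> / 2 * (L\<^sup>2 * exp (- (L + 3)) * exp (-1))"
  proof -
    have "exp L * (exp (- (L + 3)) * exp (-1)) = exp (-4::real)" by (simp flip: exp_add)
    moreover have "e / 2 * l * t = a * t / 2 * (l * b * c)" if "a * (b * c) = e" for a b c e l t :: real
      using that by (auto simp: field_simps)
    ultimately show ?thesis by blast
  qed
  also have "\<dots> \<le> real (card I) * (L\<^sup>2 * exp (- (L + 3)) * exp (-1))"
    using card by (intro mult_right_mono) auto
  also have "\<dots> = (\<Sum>n\<in>I. L\<^sup>2 * exp (- (L + 3)) * exp (-1))" by simp
  also have "\<dots> \<le> (\<Sum>n\<in>I. f n)" by (intro sum_mono fI)
  also have "\<dots> \<le> suminf f" by (rule sum_le_suminf) (use sm in \<open>auto simp: f_def I_def\<close>)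
  finally show ?thesis by (simp add: f_def)
qed

text \<open>Outside the window of radius W the Gaussian is at most exp(-(W/\<tau>)^2/2). Inside it,
  in the absence of primes, \<Lambda> is carried by proper prime powers: up to powers of L, there
  are at most exp(L/2) of them, each with weight at most exp(-L).\<close>

lemma suminf_mangoldt_gaussian_le:
  fixes L W \<tau> :: real
  assumes L: "L \<ge> 1" and W: "0 < W" "W \<le> 1" and \<tau>: "\<tau> > 0"
    and none: "\<And>p. prime p \<Longrightarrow> \<bar>ln (real p) - L\<bar> > W"
  defines "\<sigma> \<equiv> 1 + 1 / L"
  shows "(\<Sum>n. mangoldt n * (ln (real n))\<^sup>2 * real n powr (-\<sigma>) * exp (- ((ln (real n) - L) / \<tau>)\<^sup>2 / 2))
    \<le> exp (- (W / \<tau>)\<^sup>2 / 2) * (\<Sum>n. (ln (real n)) ^ 3 * real n powr (-\<sigma>)) + exp ((L + 1) / 2) * (2 * L + 3) * ((L + 1) ^ 3 * exp (1 - L))"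
proof -
  have \<sigma>: "\<sigma> > 1" using L by (simp add: \<sigma>_def)
  define P where "P = {n::nat. primepow n \<and> \<not> prime n \<and> ln (real n) \<le> L + 1}"
  have P: "finite P" "real (card P) \<le> exp ((L + 1) / 2) * (2 * L + 3)"
    unfolding P_def using card_proper_prime_powers[OF L] by auto
  define e where "e = exp (- (W / \<tau>)\<^sup>2 / 2)"
  define c where "c = (L + 1) ^ 3 * exp (1 - L)"
  have c0: "c \<ge> 0" using L by (simp add: c_def)
  have sm3: "summable (\<lambda>n. e * ((ln (real n)) ^ 3 * real n powr (-\<sigma>)))" using \<sigma> by (intro summable_mult summable_ln_pow_powr)
  have smP: "(\<lambda>n. if n \<in> P then c else 0) sums (\<Sum>n\<in>P. c)" by (rule sums_If_finite_set[OF P(1)])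
  have lnn: "ln (real n) \<ge> 0" for n by (cases "n = 0") auto
  define g where "g = (\<lambda>n. e * ((ln (real n)) ^ 3 * real n powr (-\<sigma>)) + (if n \<in> P then c else 0))"
  define f where "f = (\<lambda>n. mangoldt n * (ln (real n))\<^sup>2 * real n powr (-\<sigma>) * exp (- ((ln (real n) - L) / \<tau>)\<^sup>2 / 2))"
  have g0: "g n \<ge> 0" for n using c0 lnn by (auto simp: g_def e_def)
  have cube: "mangoldt n * (ln (real n))\<^sup>2 \<le> (ln (real n)) ^ 3" for n
    using mult_right_mono[OF mangoldt_le_ln[of n], of "(ln (real n))\<^sup>2"] by (simp add: power3_eq_cube power2_eq_square)
  have fg: "f n \<le> g n" for n
  proof (cases "primepow n")
    case False
    then have "f n = 0" by (simp add: f_def mangoldt_def)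
    then show ?thesis using g0 by simp
  next
    case True
    have n2: "n \<ge> 2" using True by (metis primepow_gt_Suc_0 Suc_leI numeral_2_eq_2)
    show ?thesis
    proof (cases "\<bar>ln (real n) - L\<bar> > W")
      case far: True
      have "(W / \<tau>)\<^sup>2 \<le> ((ln (real n) - L) / \<tau>)\<^sup>2"
        using far W \<tau> by (subst abs_le_square_iff[symmetric]) (auto simp: divide_right_mono)
      then have "exp (- ((ln (real n) - L) / \<tau>)\<^sup>2 / 2) \<le> e" by (simp add: e_def)
      then have "f n \<le> (ln (real n)) ^ 3 * real n powr (-\<sigma>) * e" unfolding f_def
        using cube lnn by (intro mult_mono mult_right_mono) (auto simp: mangoldt_nonneg)
      also have "\<dots> \<le> g n" using c0 by (auto simp: g_def mult_ac)
      finally show ?thesis .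
    next
      case near: False
      then have np: "\<not> prime n" using none by blast
      have nL: "ln (real n) \<le> L + 1" "L - 1 \<le> ln (real n)" using near W by auto
      then have nP: "n \<in> P" using True np by (simp add: P_def)
      have "f n \<le> (L + 1) ^ 3 * exp (1 - L) * 1" unfolding f_def
      proof (intro mult_mono)
        show "mangoldt n * (ln (real n))\<^sup>2 \<le> (L + 1) ^ 3"
          using cube[of n] power_mono[OF nL(1) lnn, of 3] by linarith
        have "L - 1 \<le> 1 * ln (real n)" using nL by simp
        also have "\<dots> \<le> \<sigma> * ln (real n)" using \<sigma> lnn by (intro mult_right_mono) auto
        finally show "real n powr (-\<sigma>) \<le> exp (1 - L)" using n2 by (simp add: powr_def)
      qed (use L in auto)
      also have "\<dots> \<le> g n" using nP lnn by (auto simp: g_def c_def e_def)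
      finally show ?thesis .
    qed
  qed
  have f0: "f n \<ge> 0" for n by (simp add: f_def mangoldt_nonneg)
  have sg: "summable g" unfolding g_def using sm3 smP by (intro summable_add) (auto simp: sums_iff)
  have sf: "summable f" by (rule summable_comparison_test'[OF sg, of 0]) (use f0 fg in auto)
  have "suminf f \<le> suminf g" by (rule suminf_le[OF fg sf sg])
  also have "\<dots> = e * (\<Sum>n. (ln (real n)) ^ 3 * real n powr (-\<sigma>)) + real (card P) * c"
    unfolding g_def using sm3 smP suminf_mult[OF summable_ln_pow_powr[OF \<sigma>, of 3], of e]
    by (subst suminf_add[symmetric]) (auto simp: sums_iff)
  also have "\<dots> \<le> e * (\<Sum>n. (ln (real n)) ^ 3 * real n powr (-\<sigma>)) + exp ((L + 1) / 2) * (2 * L + 3) * c"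
    using P c0 by (intro add_left_mono mult_right_mono) auto
  finally show ?thesis by (simp add: f_def e_def c_def)
qed

text \<open>By \<open>gaussian_mangoldt_bound\<close> the weighted sum of \<Lambda> agrees with that
  of the constant 1 up to O(\<tau>^(-1/4)), hence is large; without a prime in the window it would
  be small.\<close>

theorem prime_near:
  "\<exists>L0\<ge>1. \<forall>L\<ge>L0. \<exists>p. prime p \<and> \<bar>ln (real p) - L\<bar> \<le> L powr (-7/5)"
proof -
  obtain K where K: "K > 0" "\<And>\<sigma> \<tau> L. 1 < \<sigma> \<Longrightarrow> \<sigma> \<le> 2 \<Longrightarrow> 0 < \<tau> \<Longrightarrow> \<tau> \<le> 1 \<Longrightarrow>
    \<bar>\<Sum>n. (mangoldt n - 1) * (ln (real n))\<^sup>2 * real n powr (-\<sigma>) * exp (- ((ln (real n) - L) / \<tau>)\<^sup>2 / 2)\<bar> \<le> K * \<tau> powr (-1/4)"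
    using gaussian_mangoldt_bound by blast
  obtain C where C: "C > 0" "\<And>L. L \<ge> 1 \<Longrightarrow> (\<Sum>n. (ln (real n)) ^ 3 * real n powr (-(1 + 1 / L))) \<le> C * L ^ 4"
    using suminf_ln_cube_le by blast
  \<comment> \<open>The three error terms relative to sqrt L, the order of the main term L^2
    \<tau>.\<close>
  define D where "D = (\<lambda>L::real. K * (L powr (3/8) / sqrt L) + C * (exp (- (L powr (1/5)) / 2) * L ^ 4 / sqrt L)
     + exp ((L + 1) / 2) * (2 * L + 3) * ((L + 1) ^ 3 * exp (1 - L)) / sqrt L)"
  have "(D \<longlongrightarrow> K * 0 + C * 0 + 0) at_top"
    unfolding D_def
  proof (intro tendsto_add tendsto_mult tendsto_const)
    show "((\<lambda>L::real. L powr (3/8) / sqrt L) \<longlongrightarrow> 0) at_top" by real_asymp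
    show "((\<lambda>L::real. exp (- (L powr (1/5)) / 2) * L ^ 4 / sqrt L) \<longlongrightarrow> 0) at_top" by real_asymp
    show "((\<lambda>L::real. exp ((L + 1) / 2) * (2 * L + 3) * ((L + 1) ^ 3 * exp (1 - L)) / sqrt L) \<longlongrightarrow> 0) at_top" by real_asymp
  qed
  then have "\<forall>\<^sub>F L in at_top. D L < exp (-4) / 2"
    by (rule order_tendstoD) simp
  moreover have "\<forall>\<^sub>F L::real in at_top. 2 \<le> exp L * L powr (-3/2)" by real_asymp
  ultimately have "\<forall>\<^sub>F L in at_top. D L < exp (-4) / 2 \<and> 2 \<le> exp L * L powr (-3/2) \<and> L \<ge> 1"
    using eventually_ge_at_top[of 1] by eventually_elim auto
  then obtain L0 where L0: "\<And>L. L \<ge> L0 \<Longrightarrow> D L < exp (-4) / 2 \<and> 2 \<le> exp L * L powr (-3/2) \<and> L \<ge> 1"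
    by (auto simp: eventually_at_top_linorder)
  show ?thesis
  proof (intro exI[of _ "max 1 L0"] conjI allI impI, simp)
    fix L assume "L \<ge> max 1 L0"
    then have L: "L \<ge> 1" "D L < exp (-4) / 2" "2 \<le> exp L * L powr (-3/2)" using L0 by auto
    show "\<exists>p. prime p \<and> \<bar>ln (real p) - L\<bar> \<le> L powr (-7/5)"
    proof (rule ccontr)
      assume "\<not> ?thesis"
      then have none: "\<And>p. prime p \<Longrightarrow> \<bar>ln (real p) - L\<bar> > L powr (-7/5)" by (meson not_le)
      \<comment> \<open>Slightly narrower than the window W = L^(-7/5), so that (W/\<tau>)^2 =
        L^(1/5) grows, yet wide enough that L^2 \<tau> = L^(1/2) exceeds \<tau>^(-1/4) =
        L^(3/8).\<close>
      define \<tau> where "\<tau> = L powr (-3/2)"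
      define \<sigma> where "\<sigma> = 1 + 1 / L"
      have \<tau>: "0 < \<tau>" "\<tau> \<le> 1" using L powr_mono[of "-3/2" 0 L] by (auto simp: \<tau>_def)
      have \<sigma>: "1 < \<sigma>" "\<sigma> \<le> 2" using L by (auto simp: \<sigma>_def)
      define w where "w = (\<lambda>n. (ln (real n))\<^sup>2 * real n powr (-\<sigma>) * exp (- ((ln (real n) - L) / \<tau>)\<^sup>2 / 2))"
      have lnn: "ln (real n) \<ge> 0" for n by (cases "n = 0") auto
      have sw: "summable w"
      proof (rule summable_comparison_test'[OF summable_ln_pow_powr[OF \<sigma>(1), of 2], of 0])
        fix n show "norm (w n) \<le> (ln (real n))\<^sup>2 * real n powr (-\<sigma>)" unfolding w_def by (simp add: abs_mult mult_left_le)
      qed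
      have sm: "summable (\<lambda>n. mangoldt n * w n)"
      proof (rule summable_comparison_test'[OF summable_ln_pow_powr[OF \<sigma>(1), of 3], of 0])
        fix n
        have "mangoldt n * w n \<le> ln (real n) * ((ln (real n))\<^sup>2 * real n powr (-\<sigma>) * 1)"
          unfolding w_def using lnn by (intro mult_mono mangoldt_le_ln) auto
        then show "norm (mangoldt n * w n) \<le> (ln (real n)) ^ 3 * real n powr (-\<sigma>)"
          by (simp add: w_def abs_mult mangoldt_nonneg power3_eq_cube power2_eq_square mult_ac)
      qed
      have "exp (-4) / 2 * L\<^sup>2 * \<tau> \<le> suminf w" unfolding w_def
        by (rule suminf_ln_sq_gaussian_ge[OF L(1) \<tau>]) (use L sw in \<open>auto simp: \<tau>_def \<sigma>_def w_def\<close>)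
      moreover have "suminf w - K * \<tau> powr (-1/4) \<le> (\<Sum>n. mangoldt n * w n)"
      proof -
        have "(\<Sum>n. (mangoldt n - 1) * w n) = (\<Sum>n. mangoldt n * w n - w n)" by (simp add: algebra_simps)
        also have "\<dots> = (\<Sum>n. mangoldt n * w n) - suminf w" by (rule suminf_diff[OF sm sw, symmetric])
        finally have "\<bar>(\<Sum>n. mangoldt n * w n) - suminf w\<bar> \<le> K * \<tau> powr (-1/4)"
          using K(2)[OF \<sigma> \<tau>, of L] by (simp add: w_def mult.assoc)
        then show ?thesis by linarith
      qed
      moreover have "(\<Sum>n. mangoldt n * w n) \<le> exp (- (L powr (-7/5) / \<tau>)\<^sup>2 / 2) * (\<Sum>n. (ln (real n)) ^ 3 * real n powr (-\<sigma>))
         + exp ((L + 1) / 2) * (2 * L + 3) * ((L + 1) ^ 3 * exp (1 - L))"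
        using suminf_mangoldt_gaussian_le[OF L(1) _ _ \<tau>(1) none] L powr_mono[of "-7/5" 0 L]
        by (simp add: w_def \<sigma>_def mult.assoc)
      moreover have "exp (- (L powr (-7/5) / \<tau>)\<^sup>2 / 2) * (\<Sum>n. (ln (real n)) ^ 3 * real n powr (-\<sigma>))
         \<le> exp (- (L powr (1/5)) / 2) * (C * L ^ 4)"
      proof -
        have "(L powr (-7/5) / \<tau>)\<^sup>2 = L powr (1/5)"
          unfolding \<tau>_def using L by (simp add: powr_diff[symmetric] powr_powr flip: powr_numeral)
        then show ?thesis using C(2)[OF L(1)] by (simp add: \<sigma>_def mult_left_mono)
      qed
      ultimately have "exp (-4) / 2 * L\<^sup>2 * \<tau> \<le> K * \<tau> powr (-1/4) + exp (- (L powr (1/5)) / 2) * (C * L ^ 4)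
         + exp ((L + 1) / 2) * (2 * L + 3) * ((L + 1) ^ 3 * exp (1 - L))" by linarith
      also have "\<tau> powr (-1/4) = L powr (3/8)" by (simp add: \<tau>_def powr_powr)
      also have "K * L powr (3/8) + exp (- (L powr (1/5)) / 2) * (C * L ^ 4)
         + exp ((L + 1) / 2) * (2 * L + 3) * ((L + 1) ^ 3 * exp (1 - L)) = D L * sqrt L"
        using L by (simp add: D_def field_simps)
      also have "\<dots> < exp (-4) / 2 * sqrt L" using L by (intro mult_strict_right_mono) auto
      also have "sqrt L = L\<^sup>2 * \<tau>"
        using L by (simp add: \<tau>_def powr_half_sqrt[symmetric] powr_add[symmetric] flip: powr_numeral)
      finally show False by simp
    qed
  qed
qed

section \<open>A modulus dividing many powers minus one\<close>

lemma Lcm_pos: "Lcm {1..m::nat} > 0"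
proof -
  have "Lcm {1..m} \<noteq> 0" by (subst Lcm_0_iff) auto
  then show ?thesis by blast
qed

text \<open>The integral of \<open>x\<^sup>k (1 - x)\<^sup>k\<close> over \<open>{0..1}\<close> is positive, at most \<open>4\<^sup>-\<^sup>k\<close>, and becomes an integer when multiplied
  by the least common multiple.\<close>

lemma four_power_le_Lcm: "(4::nat) ^ k \<le> Lcm {1..2 * k + 1}"
proof -
  define E where "E = Lcm {1..2 * k + 1}"
  define F where "F = (\<lambda>x::real. \<Sum>j\<le>k. (-1) ^ j * real (k choose j) * (x ^ (k + j + 1) / real (k + j + 1)))"
  have dF: "(F has_real_derivative x ^ k * (1 - x) ^ k) (at x)" for x
  proof -
    have "(F has_real_derivative (\<Sum>j\<le>k. (-1) ^ j * real (k choose j) * x ^ (k + j))) (at x)"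
      unfolding F_def
    proof (rule DERIV_sum)
      fix j
      have "((\<lambda>x::real. x ^ (k + j + 1) / real (k + j + 1)) has_real_derivative
         real (k + j + 1) * x ^ (k + j) / real (k + j + 1)) (at x)"
        by (rule DERIV_cdivide) (use DERIV_pow[of "k + j + 1" x] in simp)
      then have "((\<lambda>x::real. x ^ (k + j + 1) / real (k + j + 1)) has_real_derivative x ^ (k + j)) (at x)"
        by (simp del: of_nat_add of_nat_Suc)
      then show "((\<lambda>x. (-1) ^ j * real (k choose j) * (x ^ (k + j + 1) / real (k + j + 1))) has_real_derivative
        (-1) ^ j * real (k choose j) * x ^ (k + j)) (at x)" by (rule DERIV_cmult)
    qed
    also have "(\<Sum>j\<le>k. (-1) ^ j * real (k choose j) * x ^ (k + j)) = x ^ k * (\<Sum>j\<le>k. real (k choose j) * (-x) ^ j * 1 ^ (k - j))"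
      unfolding sum_distrib_left
    proof (rule sum.cong[OF refl])
      fix j have "(-x) ^ j = (-1) ^ j * x ^ j" by (metis mult_minus1 power_mult_distrib)
      then show "(-1) ^ j * real (k choose j) * x ^ (k + j) = x ^ k * (real (k choose j) * (-x) ^ j * 1 ^ (k - j))"
        by (simp add: power_add)
    qed
    also have "(\<Sum>j\<le>k. real (k choose j) * (-x) ^ j * 1 ^ (k - j)) = (1 - x) ^ k"
      using binomial_ring[of "-x" 1 k] by simp
    finally show ?thesis .
  qed
  obtain z where z: "0 < z" "z < 1" "F 1 - F 0 = (1 - 0) * (z ^ k * (1 - z) ^ k)"
    using MVT2[of 0 1 F "\<lambda>x. x ^ k * (1 - x) ^ k"] dF by auto
  have F0: "F 0 = 0" by (simp add: F_def)
  have F1: "F 1 = (z * (1 - z)) ^ k" using z F0 by (simp add: power_mult_distrib)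
  have "z * (1 - z) \<le> 1 / 4" using zero_le_power2[of "z - 1 / 2"] by (simp add: power2_eq_square algebra_simps del: zero_le_power2)
  then have le: "F 1 \<le> (1 / 4) ^ k" unfolding F1 using z by (intro power_mono) auto
  have pos: "F 1 > 0" unfolding F1 using z by auto
  have "real E * F 1 \<in> \<int>"
  proof -
    have "real E * F 1 = (\<Sum>j\<le>k. (-1) ^ j * real (k choose j) * (real E / real (k + j + 1)))"
      by (simp add: F_def sum_distrib_left mult_ac)
    also have "\<dots> \<in> \<int>"
    proof (intro Ints_sum Ints_mult)
      fix j assume j: "j \<in> {..k}"
      have "(k + j + 1) dvd E" unfolding E_def using j by (intro dvd_Lcm) auto
      then have "real E / real (k + j + 1) = real (E div (k + j + 1))" by (simp only: real_of_nat_div)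
      then show "real E / real (k + j + 1) \<in> \<int>" by (simp only: Ints_of_nat)
    qed (auto intro: Ints_power)
    finally show ?thesis .
  qed
  moreover have E0: "E > 0" unfolding E_def by (rule Lcm_pos)
  ultimately have "1 \<le> real E * F 1"
    using pos Ints_nonzero_abs_ge1[of "real E * F 1"] by (auto simp: abs_mult)
  also have "\<dots> \<le> real E * (1 / 4) ^ k" using le by (intro mult_left_mono) auto
  finally have "4 ^ k \<le> real E" by (simp add: power_divide field_simps)
  then show ?thesis unfolding E_def by (metis of_nat_le_iff of_nat_numeral of_nat_power)
qed

section \<open>The exponent of the unit group compared with the modulus\<close>

definition max_exp :: "nat \<Rightarrow> nat \<Rightarrow> nat" where
  "max_exp l m = (GREATEST e. l ^ e \<le> m)"

lemma max_exp:
  assumes "l \<ge> 2" "m \<ge> 1"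
  shows "l ^ max_exp l m \<le> m" "l ^ k \<le> m \<Longrightarrow> k \<le> max_exp l m"
proof -
  have b: "k \<le> m" if "l ^ k \<le> m" for k
  proof -
    have "k < 2 ^ k" by (rule less_exp)
    also have "2 ^ k \<le> l ^ k" using assms by (intro power_mono) auto
    finally show ?thesis using that by simp
  qed
  show "l ^ max_exp l m \<le> m" unfolding max_exp_def
    by (rule GreatestI_nat[of _ 0 m]) (use b assms in auto)
  show "k \<le> max_exp l m" if "l ^ k \<le> m" unfolding max_exp_def
    by (rule Greatest_le_nat[of _ k m]) (use b that in auto)
qed

definition primes_le :: "nat \<Rightarrow> nat set" where
  "primes_le m = {l. prime l \<and> l \<le> m}"

lemma finite_primes_le [simp]: "finite (primes_le m)"
  unfolding primes_le_def by (rule finite_subset[of _ "{..m}"]) auto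

lemma Lcm_eq_prod_prime_powers:
  assumes m: "m \<ge> 1"
  shows "Lcm {1..m} = (\<Prod>l\<in>primes_le m. l ^ max_exp l m)"
proof -
  define R where "R = (\<Prod>l\<in>primes_le m. l ^ max_exp l m)"
  have R0: "R \<noteq> 0" unfolding R_def by (auto simp: primes_le_def)
  have mR: "multiplicity p R = (if p \<in> primes_le m then max_exp p m else 0)" if "prime p" for p
    unfolding R_def using that by (intro multiplicity_prod_prime_powers) (auto simp: primes_le_def)
  have "i dvd R" if i: "i \<in> {1..m}" for i
  proof (rule multiplicity_le_imp_dvd)
    fix p :: nat assume p: "prime p"
    have d: "p ^ multiplicity p i dvd i" by (rule multiplicity_dvd)
    then have le: "p ^ multiplicity p i \<le> m" using i dvd_imp_le[OF d] by auto
    show "multiplicity p i \<le> multiplicity p R"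
    proof (cases "p \<le> m")
      case True
      then show ?thesis using mR[OF p] p max_exp(2)[OF prime_ge_2_nat[OF p] m le] by (simp add: primes_le_def)
    next
      case False
      then have "\<not> p dvd i" using i dvd_imp_le[of p i] by auto
      then show ?thesis by (simp add: not_dvd_imp_multiplicity_0)
    qed
  qed (use i in auto)
  then have "Lcm {1..m} dvd R" by (intro Lcm_least) auto
  moreover have "R dvd Lcm {1..m}"
  proof (rule multiplicity_le_imp_dvd[OF R0])
    fix p :: nat assume p: "prime p"
    show "multiplicity p R \<le> multiplicity p (Lcm {1..m})"
    proof (cases "p \<in> primes_le m")
      case True
      have "p ^ max_exp p m dvd Lcm {1..m}"
        using max_exp(1)[OF prime_ge_2_nat[OF p] m] prime_gt_0_nat[OF p] by (intro dvd_Lcm) (auto simp: Suc_le_eq)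
      then show ?thesis using mR[OF p] True Lcm_pos[of m] p by (auto intro!: multiplicity_geI)
    qed (use mR[OF p] in auto)
  qed
  ultimately show ?thesis unfolding R_def by (rule dvd_antisym)
qed

text \<open>If l^e is the exact power of a prime l \<le> m in the lcm of 1, ..., m, the unit group
  modulo l^(e+1) has order l^e (l - 1), whose two coprime factors both occur among 1, ..., m. So the
  extra factor l is free: raising a unit to the lcm still gives 1, while the modulus becomes nearly
  the square of the lcm.\<close>

definition lcm_mod :: "nat \<Rightarrow> nat" where
  "lcm_mod m = Lcm {1..m} * (\<Prod>l\<in>primes_le m. l)"

lemma lcm_mod_pos: "lcm_mod m > 0"
  using Lcm_pos[of m] by (auto simp: lcm_mod_def primes_le_def intro!: Nat.gr0I)

lemma prime_dvd_lcm_mod: "prime l \<Longrightarrow> l \<le> m \<Longrightarrow> l dvd lcm_mod m"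
  unfolding lcm_mod_def by (intro dvd_mult dvd_prodI) (auto simp: primes_le_def)

lemma lcm_mod_eq_prod:
  assumes "m \<ge> 1"
  shows "lcm_mod m = (\<Prod>l\<in>primes_le m. l ^ Suc (max_exp l m))"
  unfolding lcm_mod_def Lcm_eq_prod_prime_powers[OF assms] by (simp add: prod.distrib mult.commute)

lemma lcm_mod_dvd_power_minus_1:
  assumes m: "m \<ge> 1" and n: "coprime n (lcm_mod m)"
  shows "int (lcm_mod m) dvd int n ^ Lcm {1..m} - 1"
proof (cases "n = 0 \<or> n = 1")
  case True
  then show ?thesis
  proof
    assume "n = 0"
    then show ?thesis using n by simp
  qed simp
next
  case False
  define E where "E = Lcm {1..m}"
  have E0: "E > 0" unfolding E_def by (rule Lcm_pos)
  define y where "y = n ^ E - 1"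
  have n2: "n \<ge> 2" using False by linarith
  have "n ^ E > 1" using n2 E0 by (intro one_less_power) auto
  then have y: "y > 0" "int y = int n ^ E - 1" by (auto simp: y_def of_nat_diff)
  have "lcm_mod m dvd y"
  proof (rule multiplicity_le_imp_dvd)
    fix p :: nat assume p: "prime p"
    have mM: "multiplicity p (lcm_mod m) = (if p \<in> primes_le m then Suc (max_exp p m) else 0)"
      unfolding lcm_mod_eq_prod[OF m] using p by (intro multiplicity_prod_prime_powers) (auto simp: primes_le_def)
    show "multiplicity p (lcm_mod m) \<le> multiplicity p y"
    proof (cases "p \<in> primes_le m")
      case True
      define e where "e = max_exp p m"
      have pm: "p \<le> m" using True by (simp add: primes_le_def)
      have "p ^ e dvd E" unfolding E_def e_def
        using max_exp(1)[OF prime_ge_2_nat[OF p] m] prime_gt_0_nat[OF p] by (intro dvd_Lcm) (auto simp: Suc_le_eq)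
      moreover have "(p - 1) dvd E" unfolding E_def
        using pm prime_ge_2_nat[OF p] by (intro dvd_Lcm) auto
      moreover have "coprime (p ^ e) (p - 1)"
      proof -
        have "coprime p (p - 1)" using prime_gt_0_nat[OF p] coprime_diff_one_right_nat by simp
        then show ?thesis by simp
      qed
      ultimately have "p ^ e * (p - 1) dvd E" by (intro divides_mult)
      then have "totient (p ^ Suc e) dvd E" by (simp only: totient_prime_power_Suc[OF p])
      then obtain k where k: "E = totient (p ^ Suc e) * k" by (rule dvdE)
      have "coprime n p" using n prime_dvd_lcm_mod[OF p pm] by (meson coprime_common_divisor coprime_def dvd_trans)
      then have "[n ^ totient (p ^ Suc e) = 1] (mod p ^ Suc e)" by (intro euler_theorem) simp
      then have "[(n ^ totient (p ^ Suc e)) ^ k = 1 ^ k] (mod p ^ Suc e)" by (rule cong_pow)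
      then have "[n ^ E = 1] (mod p ^ Suc e)" by (simp add: k power_mult)
      then have "p ^ Suc e dvd y" unfolding y_def using n2 by (subst (asm) cong_sym_eq, subst (asm) cong_altdef_nat) auto
      then show ?thesis using mM True y(1) p by (auto simp: e_def intro!: multiplicity_geI)
    qed (use mM in auto)
  qed (use lcm_mod_pos[of m] in auto)
  then have "int (lcm_mod m) dvd int y" by simp
  then show ?thesis by (simp add: y(2) E_def)
qed

text \<open>One prime factor l of b is lifted at a time: y = 1 modulo l, so 1 + y + ... + y^(l-1) is
  divisible by l and y^l - 1 gains the factor l. Thus a modulus is enlarged by b at the cost of a
  factor b in the exponent.\<close>

lemma mult_dvd_power_minus_1:
  fixes x M :: int
  assumes "M dvd x - 1" "b > 0" "\<And>l. prime l \<Longrightarrow> l dvd b \<Longrightarrow> int l dvd M"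
  shows "M * int b dvd x ^ b - 1"
  using assms(2,3)
proof (induction b rule: less_induct)
  case (less b)
  show ?case
  proof (cases "b = 1")
    case True
    then show ?thesis using assms(1) by simp
  next
    case False
    then obtain l where l: "prime l" "l dvd b" using prime_factor_nat by blast
    then obtain b' where b: "b = b' * l" by (metis dvd_def mult.commute)
    have b': "b' > 0" "b' < b" using b less.prems(1) prime_gt_1_nat[OF l(1)] by auto
    have IH: "M * int b' dvd x ^ b' - 1"
      by (rule less.IH[OF b'(2,1)]) (use less.prems(2) b in auto)
    define y where "y = x ^ b'"
    have "int l dvd y - 1" using less.prems(2)[OF l] IH by (metis dvd_mult_left dvd_trans y_def)
    then have "[y = 1] (mod int l)" by (simp add: cong_iff_dvd_diff)
    then have "[(\<Sum>i<l. y ^ i) = (\<Sum>i<l. 1 ^ i)] (mod int l)" by (intro cong_sum cong_pow)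
    then have "int l dvd (\<Sum>i<l. y ^ i)" by (simp add: cong_dvd_iff)
    then have "(M * int b') * int l dvd (y - 1) * (\<Sum>i<l. y ^ i)" using IH by (intro mult_dvd_mono) (auto simp: y_def)
    also have "(y - 1) * (\<Sum>i<l. y ^ i) = y ^ l - 1" by (rule power_diff_1_eq[symmetric])
    also have "y ^ l = x ^ b" by (simp add: y_def b power_mult)
    finally show ?thesis by (simp add: b mult_ac)
  qed
qed

text \<open>Primes with m/l < l enter the lcm to the first power and \<open>lcm_mod\<close> to the
  second. The others number at most sqrt m, and each spoils the comparison by a factor at most m.
  Hence the exponent is at most about the square root of the modulus.\<close>

lemma Lcm_sq_le:
  assumes m: "m \<ge> 1"
  shows "real (Lcm {1..m}) ^ 2 \<le> real (lcm_mod m) * real m powr sqrt (real m)"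
proof -
  define P where "P = (\<Prod>l\<in>primes_le m. real l)"
  define Q where "Q = {l \<in> primes_le m. l * l \<le> m}"
  have "real (Lcm {1..m}) = (\<Prod>l\<in>primes_le m. real l ^ max_exp l m)"
    unfolding Lcm_eq_prod_prime_powers[OF m] by simp
  also have "\<dots> \<le> (\<Prod>l\<in>primes_le m. real l * (if l \<in> Q then real m else 1))"
  proof (rule prod_mono, intro conjI)
    fix l assume l: "l \<in> primes_le m"
    then have p: "prime l" by (simp add: primes_le_def)
    have l2: "l \<ge> 2" using prime_ge_2_nat[OF p] .
    show "real l ^ max_exp l m \<le> real l * (if l \<in> Q then real m else 1)"
    proof (cases "l \<in> Q")
      case True
      have "l ^ max_exp l m \<le> 1 * m" using max_exp(1)[OF l2 m] by simp
      also have "\<dots> \<le> l * m" using l2 by (intro mult_right_mono) auto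
      finally show ?thesis using True by (simp flip: of_nat_power of_nat_mult)
    next
      case False
      then have "l ^ 2 > m" using l by (auto simp: Q_def power2_eq_square)
      then have "max_exp l m < 2"
        using max_exp(1)[OF l2 m] l2 by (metis dual_order.strict_trans2 leI not_less power_increasing one_le_numeral dual_order.trans)
      then have "l ^ max_exp l m \<le> l ^ 1" using l2 by (intro power_increasing) auto
      then show ?thesis using False by (simp flip: of_nat_power)
    qed
  qed auto
  also have "\<dots> = P * real m ^ card Q"
  proof -
    have "(\<Prod>l\<in>primes_le m. if l \<in> Q then real m else 1) = (\<Prod>l\<in>primes_le m \<inter> Q. real m)"
      by (subst prod.inter_restrict) auto
    also have "primes_le m \<inter> Q = Q" by (auto simp: Q_def)
    finally show ?thesis by (simp add: prod.distrib P_def)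
  qed
  finally have 1: "real (Lcm {1..m}) \<le> P * real m ^ card Q" .
  have "card Q \<le> card {1..nat \<lfloor>sqrt (real m)\<rfloor>}"
  proof (rule card_mono)
    show "Q \<subseteq> {1..nat \<lfloor>sqrt (real m)\<rfloor>}"
    proof
      fix l assume l: "l \<in> Q"
      then have "real l * real l \<le> real m" by (simp add: Q_def flip: of_nat_mult)
      then have "real l \<le> sqrt (real m)" by (intro real_le_rsqrt) (simp add: power2_eq_square)
      then have "l \<le> nat \<lfloor>sqrt (real m)\<rfloor>" by (rule le_nat_floor)
      moreover have "l \<ge> 1" using l by (auto simp: Q_def primes_le_def dest: prime_ge_1_nat)
      ultimately show "l \<in> {1..nat \<lfloor>sqrt (real m)\<rfloor>}" by simp
    qed
  qed simp
  then have "real (card Q) \<le> sqrt (real m)" by (simp add: le_nat_iff le_floor_iff)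
  then have "real m powr real (card Q) \<le> real m powr sqrt (real m)" using m by (intro powr_mono) auto
  then have 2: "real m ^ card Q \<le> real m powr sqrt (real m)" using m by (simp add: powr_realpow)
  have "real (Lcm {1..m}) ^ 2 \<le> real (Lcm {1..m}) * (P * real m ^ card Q)"
    unfolding power2_eq_square using 1 by (intro mult_left_mono) auto
  also have "\<dots> = real (lcm_mod m) * real m ^ card Q" by (simp add: lcm_mod_def P_def)
  also have "\<dots> \<le> real (lcm_mod m) * real m powr sqrt (real m)" using 2 by (intro mult_left_mono) auto
  finally show ?thesis .
qed

text \<open>The gaps between consecutive moduli are polynomial in m, small enough to be bridged by a
  cheap extra factor.\<close>

lemma lcm_mod_Suc_le: "lcm_mod (Suc m) \<le> (Suc m) ^ 2 * lcm_mod m"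
proof -
  have "{1..Suc m} = insert (Suc m) {1..m}" by auto
  then have "Lcm {1..Suc m} = lcm (Suc m) (Lcm {1..m})" by (simp only: Lcm_insert)
  also have "\<dots> \<le> Suc m * Lcm {1..m}"
    by (rule dvd_imp_le[OF lcm_least[OF dvd_triv_left dvd_triv_right]]) (use Lcm_pos[of m] in simp)
  finally have 1: "Lcm {1..Suc m} \<le> Suc m * Lcm {1..m}" .
  have "primes_le (Suc m) = (if prime (Suc m) then insert (Suc m) (primes_le m) else primes_le m)"
    by (auto simp: primes_le_def le_Suc_eq)
  moreover have "Suc m \<notin> primes_le m" by (simp add: primes_le_def)
  ultimately have 2: "(\<Prod>l\<in>primes_le (Suc m). l) \<le> Suc m * (\<Prod>l\<in>primes_le m. l)" by auto
  show ?thesis unfolding lcm_mod_def using mult_mono[OF 1 2] by (simp add: power2_eq_square mult_ac del: mult_Suc mult_Suc_right)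
qed

lemma Lcm_le_lcm_mod: "Lcm {1..m} \<le> lcm_mod m"
proof -
  have "(\<Prod>l\<in>primes_le m. l) \<ge> 1" by (intro prod_ge_1) (auto simp: primes_le_def dest: prime_ge_1_nat)
  then show ?thesis unfolding lcm_mod_def by simp
qed

text \<open>The largest admissible \<open>lcm_mod m\<close> is stretched towards g by b = 2^i c: the
  power of 2 closes the gap up to a factor of about 2, and c between K and 2 K refines the match to
  relative error 1/K. Since b is O(m^2) for fixed K and m = O(ln g), the exponent
  \<open>f = E * b\<close> stays below g^(1/2 + o(1)); 57/100 is a convenient exponent above
  1/2.\<close>

lemma universal_modulus:
  assumes K: "K \<ge> (1::nat)"
  shows "\<exists>g0. \<forall>g\<ge>g0. \<exists>g' f. 0 < f \<and> 0 < g' \<and> g' \<le> g \<and> (1 - 1 / real K) * real g \<le> real g' \<and>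
    real f \<le> real g powr (57/100) \<and> (\<forall>n. coprime n g' \<longrightarrow> int g' dvd int n ^ f - 1)"
proof -
  \<comment> \<open>Up to the factor 2 K, this bounds the excess of f over sqrt g, relative to
    g^(7/100).\<close>
  define h where "h = (\<lambda>g::real. (2 + 2 * ln g) powr (sqrt (2 + 2 * ln g) / 2) * (3 + 2 * ln g) ^ 2 / g powr (7/100))"
  have "(h \<longlongrightarrow> 0) at_top" unfolding h_def by real_asymp
  then have "\<forall>\<^sub>F g in at_top. h g < 1 / (2 * real K)" by (rule order_tendstoD) (use K in auto)
  then obtain G where G: "\<And>g. g \<ge> G \<Longrightarrow> h g < 1 / (2 * real K)" by (auto simp: eventually_at_top_linorder)
  \<comment> \<open>The second bound forces m \<ge> 2 K + 2, so that 2 and all primes below 2 K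
    divide \<open>lcm_mod m\<close>, as \<open>mult_dvd_power_minus_1\<close> requires of the primes
    of b.\<close>
  define g0 where "g0 = max (nat \<lceil>G\<rceil>) (K * lcm_mod (2 * K + 2))"
  show ?thesis
  proof (rule exI[of _ g0], intro allI impI)
    fix g assume g: "g \<ge> g0"
    have gG: "real g \<ge> G" using g by (simp add: g0_def)
    have gK: "K * lcm_mod (2 * K + 2) \<le> g" using g by (simp add: g0_def)
    have lb: "m \<le> lcm_mod m" for m
    proof (cases "m = 0")
      case False
      then have "m dvd Lcm {1..m}" by (intro dvd_Lcm) auto
      then have "m \<le> Lcm {1..m}" using Lcm_pos dvd_imp_le by blast
      then show ?thesis using Lcm_le_lcm_mod[of m] by simp
    qed simp
    define m where "m = (GREATEST m. K * lcm_mod m \<le> g)"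
    have bd: "y \<le> g" if "K * lcm_mod y \<le> g" for y
    proof -
      have "1 * y \<le> K * lcm_mod y" using K lb[of y] by (intro mult_mono) auto
      then show ?thesis using that by simp
    qed
    have m1: "K * lcm_mod m \<le> g" unfolding m_def by (rule GreatestI_nat[of "\<lambda>m. K * lcm_mod m \<le> g", OF gK, of g]) (use bd in auto)
    have m2: "2 * K + 2 \<le> m" unfolding m_def by (rule Greatest_le_nat[of "\<lambda>m. K * lcm_mod m \<le> g", OF gK, of g]) (use bd in auto)
    have "\<not> K * lcm_mod (Suc m) \<le> g"
      using Greatest_le_nat[of "\<lambda>m. K * lcm_mod m \<le> g" "Suc m" g] bd unfolding m_def[symmetric] by auto
    then have m3: "g < K * ((Suc m)\<^sup>2 * lcm_mod m)"
      using mult_le_mono2[OF lcm_mod_Suc_le[of m], of K] by linarith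
    define M where "M = lcm_mod m"
    have M0: "M > 0" unfolding M_def by (rule lcm_mod_pos)
    define i where "i = (GREATEST i. 2 ^ i * (K * M) \<le> g)"
    have bdi: "y \<le> g" if "2 ^ y * (K * M) \<le> g" for y
    proof -
      have "2 ^ y * 1 \<le> 2 ^ y * (K * M)" using K M0 by (intro mult_left_mono) (auto simp: Suc_le_eq)
      then show ?thesis using that less_exp[of y] by linarith
    qed
    have i0: "2 ^ 0 * (K * M) \<le> g" using m1 by (simp add: M_def)
    have i1: "2 ^ i * (K * M) \<le> g" unfolding i_def by (rule GreatestI_nat[of "\<lambda>i. 2 ^ i * (K * M) \<le> g", OF i0, of g]) (use bdi in auto)
    have i2: "g < 2 ^ Suc i * (K * M)"
      using Greatest_le_nat[of "\<lambda>i. 2 ^ i * (K * M) \<le> g" "Suc i" g] bdi unfolding i_def[symmetric]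
      by (metis Suc_n_not_le_n leI)
    define c where "c = g div (2 ^ i * M)"
    have q0: "2 ^ i * M > 0" using M0 by simp
    have c1: "K \<le> c" unfolding c_def using i1 q0 by (simp add: less_eq_div_iff_mult_less_eq mult_ac)
    have c2: "c < 2 * K" unfolding c_def using i2 q0 by (simp add: div_less_iff_less_mult mult_ac)
    define b where "b = 2 ^ i * c"
    have b0: "b > 0" using c1 K by (simp add: b_def)
    define E where "E = Lcm {1..m}"
    define g' f where "g' = M * b" and "f = E * b"
    have g'_eq: "g' = 2 ^ i * M * c" by (simp add: g'_def b_def)
    have g'g: "g' \<le> g" unfolding g'_eq c_def by simp
    have "g mod (2 ^ i * M) < 2 ^ i * M" using q0 by simp
    then have "g < g' + 2 ^ i * M" unfolding g'_eq c_def using mult_div_mod_eq[of "2 ^ i * M" g] by linarith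
    moreover have "real (2 ^ i * M) \<le> real g / real K"
    proof -
      have "real (2 ^ i * (K * M)) \<le> real g" using i1 of_nat_mono by blast
      then show ?thesis using K by (simp add: field_simps)
    qed
    ultimately have "real g \<le> real g' + real g / real K"
      using of_nat_mono[of g "g' + 2 ^ i * M", where 'a = real] by simp
    then have low: "(1 - 1 / real K) * real g \<le> real g'" by (simp add: algebra_simps)
    have "(Suc m)\<^sup>2 * (K * M) = K * ((Suc m)\<^sup>2 * lcm_mod m)" by (simp only: M_def mult_ac)
    then have "2 ^ i * (K * M) < (Suc m)\<^sup>2 * (K * M)" using i1 m3 by linarith
    then have p2: "2 ^ i \<le> (Suc m)\<^sup>2" using mult_less_cancel2 by (metis less_imp_le)
    have fle: "real f \<le> real E * (real m + 1)\<^sup>2 * (2 * real K)"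
    proof -
      have "f \<le> E * ((Suc m)\<^sup>2 * (2 * K))" unfolding f_def b_def using p2 c2 by (intro mult_mono) auto
      then have "real f \<le> real (E * ((Suc m)\<^sup>2 * (2 * K)))" by (rule of_nat_mono)
      then show ?thesis by (simp add: add.commute mult_ac)
    qed
    have m_ge1: "m \<ge> 1" using m2 by simp
    have Mg: "real M \<le> real g"
    proof -
      have "1 * M \<le> K * M" using K by (intro mult_right_mono) auto
      then have "M \<le> g" using m1 unfolding M_def by linarith
      then show ?thesis by simp
    qed
    \<comment> \<open>The lower bound 4^k for the lcm turns \<open>M \<le> g\<close> into a
      logarithmic bound for m.\<close>
    have mln: "real m \<le> 2 + 2 * ln (real g)"
    proof -
      define k where "k = (m - 1) div 2"
      have k: "2 * k + 1 \<le> m" "m \<le> 2 * k + 2" using m_ge1 by (auto simp: k_def)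
      have "4 ^ k \<le> Lcm {1..2 * k + 1}" by (rule four_power_le_Lcm)
      also have "\<dots> \<le> Lcm {1..m}"
        by (rule dvd_imp_le[OF _ Lcm_pos]) (use k in \<open>auto intro!: Lcm_subset\<close>)
      also have "\<dots> \<le> M" unfolding M_def by (rule Lcm_le_lcm_mod)
      finally have "real (4 ^ k) \<le> real M" by (rule of_nat_mono)
      then have "4 ^ k \<le> real g" using Mg by simp
      then have "ln (4 ^ k) \<le> ln (real g)" using Mg M0 by (subst ln_le_cancel_iff) auto
      moreover have "ln (4::real) \<ge> 1"
      proof -
        have "ln (4::real) = 2 * ln 2" using ln_realpow[of 2 2] by simp
        then show ?thesis using ln2_ge_two_thirds by simp
      qed
      then have "real k * 1 \<le> real k * ln 4" by (intro mult_left_mono) auto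
      moreover have "ln (4 ^ k :: real) = real k * ln 4" by (simp add: ln_realpow)
      moreover have "real m \<le> 2 * real k + 2" using k(2) of_nat_mono[of m "2 * k + 2"] by simp
      ultimately show ?thesis by linarith
    qed
    define x where "x = 2 + 2 * ln (real g)"
    have gpos: "real g > 0" using Mg M0 by simp
    have E_le: "real E \<le> sqrt (real g) * x powr (sqrt x / 2)"
    proof -
      have "real E ^ 2 \<le> real M * real m powr sqrt (real m)" unfolding E_def M_def by (rule Lcm_sq_le[OF m_ge1])
      also have "\<dots> \<le> real g * x powr sqrt x"
      proof (rule mult_mono)
        have "real m powr sqrt (real m) \<le> real m powr sqrt x" using m_ge1 mln by (intro powr_mono) (auto simp: x_def)
        also have "\<dots> \<le> x powr sqrt x" using mln by (intro powr_mono2) (auto simp: x_def)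
        finally show "real m powr sqrt (real m) \<le> x powr sqrt x" .
      qed (use Mg in auto)
      also have "\<dots> = (sqrt (real g) * x powr (sqrt x / 2)) ^ 2"
      proof -
        have "(x powr (sqrt x / 2)) ^ 2 = x powr sqrt x" by (simp add: powr_powr flip: powr_numeral)
        then show ?thesis using gpos by (simp add: power_mult_distrib)
      qed
      finally show ?thesis by (rule power2_le_imp_le) (use gpos in auto)
    qed
    have "real f \<le> (sqrt (real g) * x powr (sqrt x / 2)) * (x + 1)\<^sup>2 * (2 * real K)"
      using fle E_le mln by (elim order_trans, intro mult_right_mono mult_mono power_mono) (auto simp: x_def)
    also have "\<dots> = sqrt (real g) * real g powr (7/100) * (h (real g) * (2 * real K))"
      using gpos by (simp add: h_def x_def field_simps)
    also have "\<dots> \<le> sqrt (real g) * real g powr (7/100) * 1"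
      using G[OF gG] K by (intro mult_left_mono) (auto simp: field_simps)
    also have "\<dots> = real g powr (57/100)"
      using gpos by (simp add: powr_half_sqrt[symmetric] powr_add[symmetric])
    finally have f_le: "real f \<le> real g powr (57/100)" .
    have dv: "int g' dvd int n ^ f - 1" if n: "coprime n g'" for n
    proof -
      have "coprime n (lcm_mod m)" using n by (simp add: g'_def M_def)
      then have "int M dvd int n ^ E - 1" unfolding M_def E_def by (rule lcm_mod_dvd_power_minus_1[OF m_ge1])
      then have "int M * int b dvd (int n ^ E) ^ b - 1"
      proof (rule mult_dvd_power_minus_1[OF _ b0])
        fix l :: nat assume l: "prime l" "l dvd b"
        then have "l dvd 2 ^ i \<or> l dvd c" unfolding b_def by (simp add: prime_dvd_mult_iff)
        then have "l \<le> m"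
        proof
          assume "l dvd 2 ^ i"
          then have "l dvd 2" using l(1) prime_dvd_power by blast
          then have "l \<le> 2" by (rule dvd_imp_le) simp
          then show ?thesis using m2 by simp
        next
          assume "l dvd c"
          then have "l \<le> c" using c1 K by (intro dvd_imp_le) auto
          then show ?thesis using c2 m2 by simp
        qed
        then show "int l dvd int M" unfolding M_def using prime_dvd_lcm_mod[OF l(1)] by simp
      qed
      then show ?thesis by (simp add: g'_def f_def power_mult)
    qed
    show "\<exists>g' f. 0 < f \<and> 0 < g' \<and> g' \<le> g \<and> (1 - 1 / real K) * real g \<le> real g' \<and>
      real f \<le> real g powr (57/100) \<and> (\<forall>n. coprime n g' \<longrightarrow> int g' dvd int n ^ f - 1)"
      using dv f_le low g'g b0 M0 Lcm_pos[of m] by (intro exI[of _ g'] exI[of _ f]) (auto simp: g'_def f_def E_def)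
  qed
qed

section \<open>Sidon sets from finite fields\<close>

lemma (in cring) power_add_binomial:
  assumes x: "x \<in> carrier R" and y: "y \<in> carrier R"
  shows "(x \<oplus> y) [^] (n::nat) = (\<Oplus>k\<in>{..n}. add_pow R (n choose k) (x [^] k \<otimes> y [^] (n - k)))"
proof (induction n)
  case 0
  then show ?case by simp
next
  case (Suc n)
  define z where "z = (\<lambda>k. x [^] k \<otimes> y [^] (Suc n - k))"
  have z [simp]: "z k \<in> carrier R" for k using x y by (simp add: z_def)
  have A: "(\<Oplus>k\<in>{..n}. add_pow R (n choose k) (x [^] k \<otimes> y [^] (n - k))) \<otimes> x = (\<Oplus>k\<in>{..Suc n}. add_pow R (if k = 0 then 0 else n choose (k - 1)) (z k))"
  proof -
    have "(\<Oplus>k\<in>{..n}. add_pow R (n choose k) (x [^] k \<otimes> y [^] (n - k))) \<otimes> x = (\<Oplus>k\<in>{..n}. (add_pow R (n choose k) (x [^] k \<otimes> y [^] (n - k))) \<otimes> x)"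
      using x y by (intro finsum_ldistr) auto
    also have "\<dots> = (\<Oplus>k\<in>{..n}. add_pow R (n choose k) (z (Suc k)))"
    proof (rule finsum_cong')
      fix k assume k: "k \<in> {..n}"
      have "(x [^] k \<otimes> y [^] (n - k)) \<otimes> x = z (Suc k)"
        unfolding z_def using x y by (simp add: m_ac)
      then show "(add_pow R (n choose k) (x [^] k \<otimes> y [^] (n - k))) \<otimes> x = add_pow R (n choose k) (z (Suc k))"
        using x y by (subst add_pow_ldistr) auto
    qed (use x y in auto)
    also have "\<dots> = (\<Oplus>k\<in>{..n}. add_pow R (if Suc k = 0 then 0 else n choose (Suc k - 1)) (z (Suc k))) \<oplus> add_pow R (if (0::nat) = 0 then 0::nat else n choose (0 - 1)) (z 0)"
      by (simp add: Pi_def)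
    also have "\<dots> = (\<Oplus>k\<in>{..Suc n}. add_pow R (if k = 0 then 0 else n choose (k - 1)) (z k))"
      by (rule finsum_Suc2[symmetric]) (auto simp: Pi_def)
    finally show ?thesis .
  qed
  have B: "(\<Oplus>k\<in>{..n}. add_pow R (n choose k) (x [^] k \<otimes> y [^] (n - k))) \<otimes> y = (\<Oplus>k\<in>{..Suc n}. add_pow R (n choose k) (z k))"
  proof -
    have "(\<Oplus>k\<in>{..n}. add_pow R (n choose k) (x [^] k \<otimes> y [^] (n - k))) \<otimes> y = (\<Oplus>k\<in>{..n}. (add_pow R (n choose k) (x [^] k \<otimes> y [^] (n - k))) \<otimes> y)"
      using x y by (intro finsum_ldistr) auto
    also have "\<dots> = (\<Oplus>k\<in>{..n}. add_pow R (n choose k) (z k))"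
    proof (rule finsum_cong')
      fix k assume k: "k \<in> {..n}"
      then have "Suc n - k = Suc (n - k)" by auto
      then have "(x [^] k \<otimes> y [^] (n - k)) \<otimes> y = z k"
        unfolding z_def using x y by (simp add: m_assoc)
      then show "(add_pow R (n choose k) (x [^] k \<otimes> y [^] (n - k))) \<otimes> y = add_pow R (n choose k) (z k)"
        using x y by (subst add_pow_ldistr) auto
    qed (use x y in auto)
    also have "\<dots> = add_pow R (n choose (Suc n)) (z (Suc n)) \<oplus> (\<Oplus>k\<in>{..n}. add_pow R (n choose k) (z k))"
      by (simp add: Pi_def binomial_eq_0)
    also have "\<dots> = (\<Oplus>k\<in>{..Suc n}. add_pow R (n choose k) (z k))"
      by (rule finsum_Suc[symmetric]) (auto simp: Pi_def)
    finally show ?thesis .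
  qed
  have "(x \<oplus> y) [^] Suc n = (\<Oplus>k\<in>{..Suc n}. add_pow R (if k = 0 then 0 else n choose (k - 1)) (z k)) \<oplus> (\<Oplus>k\<in>{..Suc n}. add_pow R (n choose k) (z k))"
    using x y Suc A B by (simp add: r_distr Pi_def)
  also have "\<dots> = (\<Oplus>k\<in>{..Suc n}. add_pow R (if k = 0 then 0 else n choose (k - 1)) (z k) \<oplus> add_pow R (n choose k) (z k))"
    by (rule finsum_addf[symmetric]) (auto simp: Pi_def)
  also have "\<dots> = (\<Oplus>k\<in>{..Suc n}. add_pow R (Suc n choose k) (z k))"
  proof (rule finsum_cong')
    fix k :: nat
    have "(Suc n choose k) = (if k = 0 then 0 else n choose (k - 1)) + (n choose k)" by (cases k) auto
    then show "add_pow R (if k = 0 then 0 else n choose (k - 1)) (z k) \<oplus> add_pow R (n choose k) (z k) = add_pow R (Suc n choose k) (z k)"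
      using add.nat_pow_mult[OF z[of k]] by presburger
  qed (auto simp: Pi_def)
  finally show ?case by (simp add: z_def)
qed

text \<open>The inner binomial coefficients are multiples of p, and \<open>ch\<close> makes
  multiples of p vanish.\<close>

lemma (in cring) frobenius:
  assumes p: "prime (p::nat)" and ch: "add_pow R (p) \<one> = \<zero>" and x: "x \<in> carrier R" and y: "y \<in> carrier R"
  shows "(x \<oplus> y) [^] p = x [^] p \<oplus> y [^] p"
proof -
  have pz: "add_pow R (p) w = \<zero>" if "w \<in> carrier R" for w
    using add_pow_ldistr[of \<one> w p] ch that by simp
  define z where "z = (\<lambda>k. add_pow R (p choose k) (x [^] k \<otimes> y [^] (p - k)))"
  obtain r where r: "p = Suc (Suc r)" using prime_ge_2_nat[OF p] by (metis add_2_eq_Suc le_Suc_ex)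
  have z0: "z (Suc k) = \<zero>" if "k \<le> r" for k
  proof -
    have "p dvd (p choose Suc k)" using that p r by (intro dvd_choose_prime) auto
    then obtain c where c: "p choose Suc k = p * c" by (rule dvdE)
    show ?thesis unfolding z_def c using x y add.nat_pow_pow[of "x [^] Suc k \<otimes> y [^] (p - Suc k)" p c] pz by (simp add: mult.commute)
  qed
  have zc: "z k \<in> carrier R" for k using x y by (simp add: z_def)
  have "(x \<oplus> y) [^] p = (\<Oplus>k\<in>{..Suc (Suc r)}. z k)"
    unfolding z_def r[symmetric] by (rule power_add_binomial[OF x y])
  also have "\<dots> = z (Suc (Suc r)) \<oplus> (\<Oplus>k\<in>{..Suc r}. z k)" by (rule finsum_Suc) (simp add: Pi_def zc)
  also have "(\<Oplus>k\<in>{..Suc r}. z k) = (\<Oplus>k\<in>{..r}. z (Suc k)) \<oplus> z 0" by (rule finsum_Suc2) (simp add: Pi_def zc)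
  also have "(\<Oplus>k\<in>{..r}. z (Suc k)) = (\<Oplus>k\<in>{..r}. \<zero>)" by (rule finsum_cong') (auto simp: z0)
  also have "(\<Oplus>k\<in>{..r}. \<zero>) = \<zero>" by simp
  also have "z (Suc (Suc r)) = x [^] p" using x y unfolding z_def r[symmetric] by simp
  also have "z 0 = y [^] p" using x y unfolding z_def by simp
  finally show ?thesis using x y by simp
qed

lemma (in cring) frobenius_pow:
  assumes p: "prime (p::nat)" and ch: "add_pow R (p) \<one> = \<zero>" and x: "x \<in> carrier R" and y: "y \<in> carrier R"
  shows "(x \<oplus> y) [^] (p ^ k) = x [^] (p ^ k) \<oplus> y [^] (p ^ k)"
proof (induction k)
  case 0
  then show ?case using x y by simp
next
  case (Suc k)
  have "(x \<oplus> y) [^] (p ^ Suc k) = ((x \<oplus> y) [^] (p ^ k)) [^] p"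
    using x y by (simp add: nat_pow_pow mult.commute)
  also have "\<dots> = (x [^] (p ^ k)) [^] p \<oplus> (y [^] (p ^ k)) [^] p"
    unfolding Suc using x y by (intro frobenius[OF p ch]) auto
  finally show ?case using x y by (simp add: nat_pow_pow mult.commute)
qed

lemma (in cring) frobenius_pow_minus:
  assumes p: "prime (p::nat)" and ch: "add_pow R (p) \<one> = \<zero>" and x: "x \<in> carrier R"
  shows "(\<ominus> x) [^] (p ^ k) = \<ominus> (x [^] (p ^ k))"
proof -
  have "p ^ k > 0" using prime_gt_0_nat[OF p] by simp
  then have "\<zero> = (x \<oplus> \<ominus> x) [^] (p ^ k)" using x by (simp add: r_neg nat_pow_zero)
  also have "\<dots> = x [^] (p ^ k) \<oplus> (\<ominus> x) [^] (p ^ k)" using x by (intro frobenius_pow[OF p ch]) auto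
  finally show ?thesis using x by (metis a_inv_closed add.inv_equality a_comm nat_pow_closed)
qed

text \<open>Polynomials are coefficient lists with the leading coefficient first; appending an entry
  multiplies by X and adds a constant. The list is therefore X^n - w.\<close>

lemma (in ring) binomial_poly:
  assumes "n > 0" "w \<in> carrier R" "\<one> \<noteq> \<zero>"
  shows "monom \<one> (n - 1) @ [\<ominus> w] \<in> carrier (poly_ring R)"
    and "Polynomials.degree (monom \<one> (n - 1) @ [\<ominus> w]) = n"
    and "x \<in> carrier R \<Longrightarrow> eval (monom \<one> (n - 1) @ [\<ominus> w]) x = x [^] n \<ominus> w"
proof -
  have m: "set (monom \<one> (n - 1)) \<subseteq> carrier R" by (auto simp: monom_def)
  show "monom \<one> (n - 1) @ [\<ominus> w] \<in> carrier (poly_ring R)"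
    unfolding univ_poly_carrier[symmetric] polynomial_def using assms m by (auto simp: monom_def)
  show "Polynomials.degree (monom \<one> (n - 1) @ [\<ominus> w]) = n" using assms by (simp add: monom_def)
  assume x: "x \<in> carrier R"
  have "eval (monom \<one> (n - 1) @ [\<ominus> w]) x = (x [^] (n - 1)) \<otimes> x \<oplus> \<ominus> w"
    using eval_append_aux[OF m _ x, of "\<ominus> w"] eval_monom[OF one_closed x] assms x by simp
  also have "(x [^] (n - 1)) \<otimes> x = x [^] n" using assms nat_pow_Suc[of x "n - 1"] by simp
  finally show "eval (monom \<one> (n - 1) @ [\<ominus> w]) x = x [^] n \<ominus> w" by (simp add: a_minus_def)
qed

lemma (in field) card_roots_of_unity_le:
  assumes n: "(n::nat) > 0"
  shows "finite {x \<in> carrier R. x [^] n = \<one>}" "card {x \<in> carrier R. x [^] n = \<one>} \<le> n"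
proof -
  define P where "P = monom \<one> (n - 1) @ [\<ominus> \<one>]"
  note P = binomial_poly[OF n one_closed one_not_zero, folded P_def]
  have eq: "{x \<in> carrier R. x [^] n = \<one>} = set_mset (roots P)"
    using roots_mem_iff_is_root[OF P(1)] P(3) by (auto simp: is_root_def P_def)
  show "finite {x \<in> carrier R. x [^] n = \<one>}" unfolding eq by simp
  have "card (set_mset (roots P)) \<le> size (roots P)" by (simp add: size_multiset_overloaded_eq sum_mono order.trans[OF _ sum_mono[of _ "\<lambda>_. 1"]] card_eq_sum Suc_le_eq del: sum_constant)
  also have "\<dots> \<le> n" using size_roots_le_degree[OF P(1)] P(2) by simp
  finally show "card {x \<in> carrier R. x [^] n = \<one>} \<le> n" by (simp add: eq)
qed

lemma (in algebraically_closed) exists_poly_root: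
  assumes "P \<in> carrier (poly_ring L)" "Polynomials.degree P > 0"
  shows "\<exists>x\<in>carrier L. eval P x = \<zero>"
proof -
  have "splitted P" by (rule roots_over_carrier[OF assms(1)])
  then have "roots P \<noteq> {#}" using assms(2) unfolding splitted_def by auto
  then obtain x where "x \<in># roots P" by blast
  then show ?thesis using roots_mem_iff_is_root[OF assms(1)] by (auto simp: is_root_def)
qed

lemma (in algebraically_closed) exists_nth_root:
  assumes "(n::nat) > 0" "w \<in> carrier L"
  shows "\<exists>x\<in>carrier L. x [^] n = w"
proof -
  have "Polynomials.degree (monom \<one> (n - 1) @ [\<ominus> w]) > 0"
    unfolding binomial_poly(2)[OF assms one_not_zero] by (rule assms)
  from exists_poly_root[OF binomial_poly(1)[OF assms one_not_zero] this]
  obtain x where x: "x \<in> carrier L" "eval (monom \<one> (n - 1) @ [\<ominus> w]) x = \<zero>" by blast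
  then have "x [^] n \<ominus> w = \<zero>" using binomial_poly(3)[OF assms one_not_zero] by simp
  then show ?thesis using x assms by auto
qed

text \<open>\<open>replicate l \<one>\<close> is the coefficient list of 1 + X + ... + X^(l-1). A
  root r of it satisfies r^l = 1, and r = 1 would make l times 1 vanish, which \<open>ch\<close>
  excludes.\<close>

lemma (in algebraically_closed) exists_nontrivial_root_of_unity:
  assumes l: "(l::nat) \<ge> 2" and ch: "add_pow L (l) \<one> \<noteq> \<zero>"
  shows "\<exists>r\<in>carrier L. r [^] l = \<one> \<and> r \<noteq> \<one>"
proof -
  have set: "set (replicate k \<one>) \<subseteq> carrier L" for k by auto
  have "replicate l \<one> \<in> carrier (poly_ring L)"
    unfolding univ_poly_carrier[symmetric] polynomial_def using l by (cases l) auto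
  then obtain r where r: "r \<in> carrier L" "eval (replicate l \<one>) r = \<zero>"
    using exists_poly_root[of "replicate l \<one>"] l by auto
  have geo: "eval (replicate k \<one>) r \<otimes> (r \<ominus> \<one>) = r [^] k \<ominus> \<one>" for k
  proof (induction k)
    case (Suc k)
    have ec: "eval (replicate k \<one>) r \<in> carrier L" using eval_in_carrier[OF set r(1)] .
    have "eval (replicate (Suc k) \<one>) r \<otimes> (r \<ominus> \<one>) = (r [^] k \<oplus> eval (replicate k \<one>) r) \<otimes> (r \<ominus> \<one>)"
      using r by simp
    also have "\<dots> = r [^] k \<otimes> (r \<ominus> \<one>) \<oplus> (r [^] k \<ominus> \<one>)"
      using r ec Suc by (simp add: l_distr)
    also have "\<dots> = r [^] Suc k \<ominus> \<one>"
    proof -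
      define u where "u = r [^] k"
      have u: "u \<in> carrier L" using r by (simp add: u_def)
      have "u \<otimes> (r \<ominus> \<one>) \<oplus> (u \<ominus> \<one>) = u \<otimes> r \<ominus> \<one>" using u r(1) by algebra
      then show ?thesis by (simp add: u_def)
    qed
    finally show ?case .
  qed (use r in \<open>simp add: r_neg a_minus_def\<close>)
  have "r [^] l \<ominus> \<one> = \<zero>" using geo[of l] r by simp
  then have rl: "r [^] l = \<one>" using r by simp
  have "eval (replicate k \<one>) \<one> = add_pow L (k) \<one>" for k
    by (induction k) (auto simp: add.nat_pow_Suc2 eval_in_carrier simp del: add.nat_pow_Suc)
  then have "r \<noteq> \<one>" using r ch by auto
  then show ?thesis using r rl by blast
qed

text \<open>If \<open>w\<close> has order \<open>n'\<close> and \<open>z\<close> is an \<open>l\<close>-th root of \<open>w\<close>, then \<open>z\<close> or its product with a nontrivial \<open>l\<close>-th root of unity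
  has order \<open>l n'\<close>.\<close>

lemma (in algebraically_closed) exists_element_of_order:
  assumes "(n::nat) > 0" and ch: "\<And>l. prime l \<Longrightarrow> l dvd n \<Longrightarrow> add_pow L (l) \<one> \<noteq> \<zero>"
  shows "\<exists>z\<in>Units L. group.ord (units_of L) z = n"
  using assms
proof (induction n rule: less_induct)
  case (less n)
  interpret G: comm_group "units_of L" by (rule units_comm_group)
  have pw: "x [^]\<^bsub>units_of L\<^esub> k = x [^] k" if "x \<in> Units L" for x and k :: nat using units_of_pow[OF that] .
  note [simp] = units_of_carrier units_of_one units_of_mult
  show ?case
  proof (cases "n = 1")
    case True
    then show ?thesis using G.ord_id G.one_closed by (metis units_of_carrier)
  next
    case False
    then obtain l where l: "prime l" "l dvd n" using prime_factor_nat by blast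
    then obtain n' where n: "n = l * n'" by (auto simp: dvd_def)
    have n': "n' > 0" "n' < n" using n less.prems(1) prime_gt_1_nat[OF l(1)] by auto
    obtain w where w: "w \<in> Units L" "G.ord w = n'"
      using less.IH[OF n'(2,1)] less.prems(2) n by auto
    have lpos: "l > 0" using prime_gt_0_nat[OF l(1)] .
    obtain z0 where z0: "z0 \<in> carrier L" "z0 [^] l = w" using exists_nth_root[OF lpos, of w] w by (auto simp: field_Units)
    have z0n: "z0 \<noteq> \<zero>" using z0 w lpos by (auto simp: nat_pow_zero field_Units)
    obtain r where r: "r \<in> carrier L" "r [^] l = \<one>" "r \<noteq> \<one>"
      using exists_nontrivial_root_of_unity[OF prime_ge_2_nat[OF l(1)] less.prems(2)[OF l]] by blast
    have rn: "r \<noteq> \<zero>" using r lpos by (auto simp: nat_pow_zero)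
    have good: "G.ord z = n" if z: "z \<in> Units L" "z [^] l = w" "l dvd G.ord z" for z
    proof -
      have "n' = G.ord z div gcd (G.ord z) l" using G.ord_pow_gen[of z l] lpos z w(2) pw by simp
      moreover have "gcd (G.ord z) l = l" using z(3) by (simp add: gcd_nat.absorb2)
      ultimately show ?thesis using z(3) n by (simp add: dvd_mult_div_cancel)
    qed
    have bad: "G.ord z = n'" if z: "z \<in> Units L" "z [^] l = w" "\<not> l dvd G.ord z" for z
    proof -
      have "n' = G.ord z div gcd (G.ord z) l" using G.ord_pow_gen[of z l] lpos z w(2) pw by simp
      moreover have "gcd (G.ord z) l = 1" using z(3) l(1) by (metis coprime_commute coprime_imp_gcd_eq_1 prime_imp_coprime)
      ultimately show ?thesis by simp
    qed
    have zc: "z0 \<in> Units L" "r \<in> Units L" "z0 \<otimes> r \<in> Units L"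
      using z0 z0n r rn by (auto simp: integral_iff field_Units)
    have zr: "(z0 \<otimes> r) [^] l = w" using z0 r w by (simp add: nat_pow_distrib Units_closed)
    show ?thesis
    proof (cases "l dvd G.ord z0 \<or> l dvd G.ord (z0 \<otimes> r)")
      case True
      then show ?thesis using good zc z0(2) zr by blast
    next
      case False
      then have "G.ord z0 = n'" "G.ord (z0 \<otimes> r) = n'" using bad zc z0(2) zr by blast+
      then have "z0 [^] n' = \<one>" "(z0 \<otimes> r) [^] n' = \<one>"
        using G.pow_ord_eq_1[of z0] G.pow_ord_eq_1[of "z0 \<otimes> r"] zc pw by auto
      then have "r [^] n' = \<one>" using z0 r by (simp add: nat_pow_distrib)
      then have "G.ord r dvd n'" using G.pow_eq_id[of r] zc(2) pw by simp
      moreover have "G.ord r = l"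
      proof -
        have "G.ord r dvd l" using r G.pow_eq_id[of r] zc(2) pw by simp
        moreover have "G.ord r \<noteq> 1" using r G.ord_eq_1[of r] zc(2) by simp
        ultimately show ?thesis using l(1) by (metis prime_nat_iff)
      qed
      moreover have "G.ord z0 = n'" using \<open>G.ord z0 = n'\<close> .
      ultimately show ?thesis using False by simp
    qed
  qed
qed

section \<open>The Bose-Chowla set\<close>

lemma (in field) prime_char_unique:
  assumes p: "prime (p::nat)" and ch: "add_pow R p \<one> = \<zero>" and l: "prime l" "l \<noteq> p"
  shows "add_pow R l \<one> \<noteq> \<zero>"
proof
  assume z: "add_pow R l \<one> = \<zero>"
  have "gcd p l = 1" using p l by (metis coprime_imp_gcd_eq_1 primes_coprime)
  then obtain x y where xy: "p * x = l * y + 1" using bezout_nat[of p l] prime_gt_0_nat[OF p] by auto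
  have mul: "add_pow R (k * c) \<one> = \<zero>" if "add_pow R k \<one> = \<zero>" for k c :: nat
    using add.nat_pow_pow[of \<one> c k] that by (simp add: mult.commute)
  have "add_pow R (l * y + 1) \<one> = add_pow R (l * y) \<one> \<oplus> \<one>" by simp
  then have "\<zero> = \<one>" using mul[OF ch, of x] mul[OF z, of y] xy by simp
  then show False using one_not_zero by simp
qed

text \<open>Let \<zeta> have order q^2 - 1 and let F be the fixed points of x -> x^q, a field of q
  elements inside L. For a in F, \<zeta> + a is fixed by x -> x^(q^2), hence a power of \<zeta>; S
  consists of the exponents. A coincidence of differences reads (\<zeta> + a)(\<zeta> + b') =
  (\<zeta> + a')(\<zeta> + b), which is linear in \<zeta> over F because the squares cancel, while
  \<zeta> is not in F. The congruence is stated with sums because subtraction of naturals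
  truncates.\<close>

lemma (in algebraically_closed) bose_chowla_aux:
  fixes p f :: nat
  assumes p: "prime p" and ch: "add_pow L p \<one> = \<zero>" and f: "f > 0"
  defines "q \<equiv> p ^ f"
  shows "\<exists>S\<subseteq>{..<q\<^sup>2 - 1}. card S = q \<and>
    (\<forall>a\<in>S. \<forall>b\<in>S. \<forall>a'\<in>S. \<forall>b'\<in>S. a \<noteq> b \<and> [a + b' = a' + b] (mod q\<^sup>2 - 1) \<longrightarrow> a = a' \<and> b = b')"
proof -
  define N where "N = q\<^sup>2 - 1"
  have "p ^ 1 \<le> p ^ f" using prime_ge_1_nat[OF p] f by (intro power_increasing) auto
  then have q2: "q \<ge> 2" unfolding q_def using prime_ge_2_nat[OF p] by simp
  have Nfac: "N = (q - 1) * (q + 1)"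
    unfolding N_def using q2 by (cases q) (auto simp: power2_eq_square)
  have Npos: "N > 0" using Nfac q2 by simp
  have SucN: "Suc N = q\<^sup>2" unfolding N_def using q2 by simp
  have q2pow: "q\<^sup>2 = p ^ (2 * f)" by (simp add: q_def power_mult[symmetric] mult.commute)
  interpret G: comm_group "units_of L" by (rule units_comm_group)
  have pw: "x [^]\<^bsub>units_of L\<^esub> k = x [^] k" if "x \<in> Units L" for x and k :: nat using units_of_pow[OF that] .
  note [simp] = units_of_carrier units_of_one units_of_mult
  have "\<exists>z\<in>Units L. group.ord (units_of L) z = N"
  proof (rule exists_element_of_order[OF Npos])
    fix l :: nat assume l: "prime l" "l dvd N"
    have "l \<noteq> p"
    proof
      assume "l = p"
      then have "p dvd q\<^sup>2 - 1" using l by (simp add: N_def)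
      moreover have "p dvd q\<^sup>2" unfolding q2pow using f by simp
      ultimately have "p dvd 1" using SucN N_def by (metis dvd_add_right_iff plus_1_eq_Suc add.commute)
      then show False using p by auto
    qed
    then show "add_pow L l \<one> \<noteq> \<zero>" using prime_char_unique[OF p ch l(1)] by simp
  qed
  then obtain \<zeta> where \<zeta>: "\<zeta> \<in> Units L" "G.ord \<zeta> = N" by blast
  have \<zeta>c: "\<zeta> \<in> carrier L" using \<zeta> by auto
  have one: "\<zeta> [^] k = \<one> \<longleftrightarrow> N dvd k" for k :: nat
    using G.pow_eq_id[of \<zeta> k] \<zeta> pw by simp
  have pm: "\<zeta> [^] m = \<zeta> [^] (m mod N)" for m :: nat
  proof -
    have "\<zeta> [^] m = \<zeta> [^] (N * (m div N) + m mod N)" by simp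
    also have "\<dots> = (\<zeta> [^] N) [^] (m div N) \<otimes> \<zeta> [^] (m mod N)" using \<zeta>c nat_pow_mult[of \<zeta> "N * (m div N)" "m mod N"] nat_pow_pow[of \<zeta> N "m div N"] by simp
    also have "\<zeta> [^] N = \<one>" using one by simp
    finally show ?thesis using \<zeta>c by simp
  qed
  have inj0: "i = j" if "\<zeta> [^] i = \<zeta> [^] j" "i < N" "j < N" "i \<le> j" for i j :: nat
  proof -
    have "\<zeta> [^] j = \<zeta> [^] i \<otimes> \<zeta> [^] (j - i)" using nat_pow_mult[OF \<zeta>c, of i "j - i"] that(4) by simp
    then have "\<zeta> [^] i \<otimes> \<zeta> [^] (j - i) = \<zeta> [^] i \<otimes> \<one>" using that \<zeta>c by simp
    moreover have "\<zeta> [^] i \<noteq> \<zero>" using \<zeta> Units_pow_closed[OF \<zeta>(1), of i] field_Units by auto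
    ultimately have "\<zeta> [^] (j - i) = \<one>" using \<zeta>c m_lcancel[of "\<zeta> [^] i" "\<zeta> [^] (j - i)" \<one>] by simp
    then have "N dvd j - i" using one by simp
    then show ?thesis using that by (metis diff_is_0_eq dvd_imp_le leD le_antisym less_imp_diff_less not_gr_zero)
  qed
  have inj: "i = j" if "\<zeta> [^] i = \<zeta> [^] j" "i < N" "j < N" for i j :: nat
    using inj0[of i j] inj0[of j i] that by (cases "i \<le> j") auto
  \<comment> \<open>x^N = 1 has at most N roots, and the N distinct powers of \<zeta> already
    exhaust them.\<close>
  have K: "\<exists>i<N. x = \<zeta> [^] i" if x: "x \<in> carrier L" "x [^] N = \<one>" for x
  proof -
    have sub: "(\<lambda>i. \<zeta> [^] i) ` {..<N} \<subseteq> {x \<in> carrier L. x [^] N = \<one>}"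
    proof safe
      fix i :: nat
      have "(\<zeta> [^] i) [^] N = \<zeta> [^] (i * N)" using \<zeta>c by (simp add: nat_pow_pow)
      also have "\<dots> = \<one>" using one by simp
      finally show "(\<zeta> [^] i) [^] N = \<one>" .
    qed (use \<zeta>c in auto)
    have "card ((\<lambda>i. \<zeta> [^] i) ` {..<N}) = N" using inj by (subst card_image) (auto simp: inj_on_def)
    then have "(\<lambda>i. \<zeta> [^] i) ` {..<N} = {x \<in> carrier L. x [^] N = \<one>}"
      using card_roots_of_unity_le[OF Npos] sub by (intro card_seteq) auto
    then show ?thesis using x by blast
  qed
  define F where "F = {x \<in> carrier L. x [^] q = x}"
  have Fc: "x \<in> carrier L" if "x \<in> F" for x using that by (simp add: F_def)
  have Feq: "F = insert \<zero> {x \<in> carrier L. x [^] (q - 1) = \<one>}"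
  proof (intro equalityI subsetI)
    fix x assume x: "x \<in> F"
    have "x [^] (q - 1) \<otimes> x = \<one> \<otimes> x" using x q2 nat_pow_Suc[of x "q - 1"] by (simp add: F_def)
    then show "x \<in> insert \<zero> {x \<in> carrier L. x [^] (q - 1) = \<one>}" using x m_rcancel[of x "x [^] (q - 1)" \<one>] by (auto simp: F_def)
  next
    fix x assume x: "x \<in> insert \<zero> {x \<in> carrier L. x [^] (q - 1) = \<one>}"
    then show "x \<in> F"
    proof
      assume "x = \<zero>" then show ?thesis using q2 by (simp add: F_def nat_pow_zero)
    next
      assume "x \<in> {x \<in> carrier L. x [^] (q - 1) = \<one>}"
      then show ?thesis using q2 nat_pow_Suc[of x "q - 1"] by (simp add: F_def)
    qed
  qed
  \<comment> \<open>F is 0 together with the powers of \<zeta>^(q+1), an element of order q -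
    1.\<close>
  have cardF: "card F = q" "finite F"
  proof -
    define U where "U = {x \<in> carrier L. x [^] (q - 1) = \<one>}"
    have U: "finite U" "card U \<le> q - 1" unfolding U_def using q2 card_roots_of_unity_le[of "q - 1"] by auto
    have "(\<lambda>j. \<zeta> [^] ((q + 1) * j)) ` {..<q - 1} \<subseteq> U"
    proof safe
      fix j :: nat
      have "(q + 1) * j * (q - 1) = N * j" by (simp only: Nfac mult_ac)
      then have "(\<zeta> [^] ((q + 1) * j)) [^] (q - 1) = \<zeta> [^] (N * j)" using nat_pow_pow[OF \<zeta>c, of "(q + 1) * j" "q - 1"] by metis
      also have "\<dots> = \<one>" using one by simp
      finally show "\<zeta> [^] ((q + 1) * j) \<in> U" using \<zeta>c by (simp add: U_def)
    qed
    moreover have "card ((\<lambda>j. \<zeta> [^] ((q + 1) * j)) ` {..<q - 1}) = q - 1"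
    proof (subst card_image)
      show "inj_on (\<lambda>j. \<zeta> [^] ((q + 1) * j)) {..<q - 1}"
      proof (rule inj_onI)
        fix i j assume ij: "i \<in> {..<q - 1}" "j \<in> {..<q - 1}" "\<zeta> [^] ((q + 1) * i) = \<zeta> [^] ((q + 1) * j)"
        have "N = (q + 1) * (q - 1)" by (simp only: Nfac mult.commute)
        then have "(q + 1) * i < N" "(q + 1) * j < N" using ij mult_less_mono2[of i "q - 1" "q + 1"] mult_less_mono2[of j "q - 1" "q + 1"] by simp_all
        then have "(q + 1) * i = (q + 1) * j" using inj ij(3) by blast
        then show "i = j" by (simp only: mult_cancel1) simp
      qed
    qed simp
    ultimately have "q - 1 \<le> card U" using U(1) card_mono by metis
    then have "card U = q - 1" using U by simp
    moreover have "\<zero> \<notin> U" using q2 by (simp add: U_def nat_pow_zero)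
    ultimately show "card F = q" "finite F" unfolding Feq U_def[symmetric] using U q2 by auto
  qed
  have Fadd: "x \<oplus> y \<in> F" if "x \<in> F" "y \<in> F" for x y
    using that frobenius_pow[OF p ch, of x y f] by (auto simp: F_def q_def)
  have Fmin: "\<ominus> x \<in> F" if "x \<in> F" for x
    using that frobenius_pow_minus[OF p ch, of x f] by (auto simp: F_def q_def)
  have Fmul: "x \<otimes> y \<in> F" if "x \<in> F" "y \<in> F" for x y
    using that by (auto simp: F_def nat_pow_distrib)
  have \<zeta>F: "\<zeta> \<notin> F"
  proof
    assume "\<zeta> \<in> F"
    moreover have "\<zeta> \<noteq> \<zero>" using \<zeta> field_Units by auto
    ultimately have "\<zeta> [^] (q - 1) = \<one>" unfolding Feq by auto
    then have "N dvd q - 1" using one by simp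
    then have "N \<le> q - 1" using q2 by (intro dvd_imp_le) auto
    moreover have "(q - 1) * (q + 1) > (q - 1) * 1" using q2 by (intro mult_strict_left_mono) auto
    ultimately show False using Nfac by (metis leD mult_1_right)
  qed
  have unit: "\<zeta> \<oplus> a \<noteq> \<zero>" "(\<zeta> \<oplus> a) [^] N = \<one>" if a: "a \<in> F" for a
  proof -
    show nz: "\<zeta> \<oplus> a \<noteq> \<zero>"
    proof
      assume "\<zeta> \<oplus> a = \<zero>"
      then have "\<zeta> = \<ominus> a" using \<zeta>c Fc[OF a] by (simp add: minus_equality)
      then show False using Fmin[OF a] \<zeta>F by simp
    qed
    have aQ: "a [^] (q\<^sup>2) = a"
      using a nat_pow_pow[of a q q] by (simp add: F_def power2_eq_square)
    have zQ: "\<zeta> [^] (q\<^sup>2) = \<zeta>" using one[of N] \<zeta>c by (simp flip: SucN)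
    have "(\<zeta> \<oplus> a) [^] (q\<^sup>2) = \<zeta> [^] (q\<^sup>2) \<oplus> a [^] (q\<^sup>2)"
      unfolding q2pow using \<zeta>c Fc[OF a] by (intro frobenius_pow[OF p ch])
    then have "(\<zeta> \<oplus> a) [^] N \<otimes> (\<zeta> \<oplus> a) = \<one> \<otimes> (\<zeta> \<oplus> a)"
      using aQ zQ \<zeta>c Fc[OF a] by (simp flip: SucN)
    then show "(\<zeta> \<oplus> a) [^] N = \<one>" using nz \<zeta>c Fc[OF a] m_rcancel[of "\<zeta> \<oplus> a" "(\<zeta> \<oplus> a) [^] N" \<one>] by simp
  qed
  have "\<forall>a\<in>F. \<exists>i<N. \<zeta> \<oplus> a = \<zeta> [^] i" using K unit \<zeta>c Fc by simp
  then obtain ix where ix: "\<And>a. a \<in> F \<Longrightarrow> ix a < N" "\<And>a. a \<in> F \<Longrightarrow> \<zeta> [^] ix a = \<zeta> \<oplus> a" by metis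
  have ixinj: "inj_on ix F"
  proof (rule inj_onI)
    fix a b assume ab: "a \<in> F" "b \<in> F" "ix a = ix b"
    then have "\<zeta> \<oplus> a = \<zeta> \<oplus> b" using ix(2) by metis
    then show "a = b" using \<zeta>c Fc ab by simp
  qed
  have sidon: "a = a' \<and> b = b'" if F: "a \<in> F" "b \<in> F" "a' \<in> F" "b' \<in> F"
    and ne: "ix a \<noteq> ix b" and cg: "[ix a + ix b' = ix a' + ix b] (mod N)" for a b a' b'
  proof -
    note c = \<zeta>c Fc[OF F(1)] Fc[OF F(2)] Fc[OF F(3)] Fc[OF F(4)]
    have "\<zeta> [^] (ix a + ix b') = \<zeta> [^] (ix a' + ix b)" using pm[of "ix a + ix b'"] pm[of "ix a' + ix b"] cg by (simp add: cong_def)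
    then have eq: "(\<zeta> \<oplus> a) \<otimes> (\<zeta> \<oplus> b') = (\<zeta> \<oplus> a') \<otimes> (\<zeta> \<oplus> b)"
      using ix(2) F \<zeta>c by (simp add: nat_pow_mult[symmetric])
    define x y where "x = (a \<oplus> b') \<ominus> (a' \<oplus> b)" and "y = a' \<otimes> b \<ominus> a \<otimes> b'"
    have xF: "x \<in> F" and yF: "y \<in> F" unfolding x_def y_def a_minus_def using F by (intro Fadd Fmin Fmul; simp)+
    have xc: "x \<in> carrier L" "y \<in> carrier L" using Fc xF yF by auto
    have "\<zeta> \<otimes> x \<ominus> y = (\<zeta> \<oplus> a) \<otimes> (\<zeta> \<oplus> b') \<ominus> (\<zeta> \<oplus> a') \<otimes> (\<zeta> \<oplus> b)"
      unfolding x_def y_def using c by algebra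
    also have "\<dots> = \<zero>" using eq c by simp
    finally have xy: "\<zeta> \<otimes> x = y" using c xc by simp
    \<comment> \<open>Raising \<zeta> x = y to the power q fixes x and y, so a nonzero x would give
      \<zeta>^q = \<zeta>.\<close>
    have x0: "x = \<zero>"
    proof (rule ccontr)
      assume "x \<noteq> \<zero>"
      have "(\<zeta> [^] q) \<otimes> x = y" using xy xF yF \<zeta>c nat_pow_distrib[of \<zeta> x q] by (simp add: F_def)
      then have "(\<zeta> [^] q) \<otimes> x = \<zeta> \<otimes> x" using xy by simp
      then have "\<zeta> [^] q = \<zeta>" using \<open>x \<noteq> \<zero>\<close> \<zeta>c Fc[OF xF] m_rcancel[of x "\<zeta> [^] q" \<zeta>] by simp
      then show False using \<zeta>F \<zeta>c by (simp add: F_def)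
    qed
    then have y0: "y = \<zero>" using xy \<zeta>c by simp
    have e1: "a \<oplus> b' = a' \<oplus> b" using x0 c unfolding x_def by simp
    have e2: "a' \<otimes> b = a \<otimes> b'" using y0 c unfolding y_def by simp
    \<comment> \<open>The pairs {a, b'} and {a', b} have equal sum and product, so b is a or b'; the
      former is excluded.\<close>
    have "(a \<ominus> b) \<otimes> (b' \<ominus> b) = (a \<otimes> b' \<ominus> a' \<otimes> b) \<oplus> b \<otimes> ((a' \<oplus> b) \<ominus> (a \<oplus> b'))"
      using c by algebra
    also have "\<dots> = \<zero>" using e1 e2 c by (simp add: a_minus_def r_neg)
    finally have "(a \<ominus> b) \<otimes> (b' \<ominus> b) = \<zero>" .
    moreover have "a \<ominus> b \<noteq> \<zero>" using ne c by auto
    ultimately have "b' \<ominus> b = \<zero>" using integral[of "a \<ominus> b" "b' \<ominus> b"] c by auto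
    then have "b' = b" using c by simp
    then show ?thesis using e1 c by simp
  qed
  show ?thesis
  proof (intro exI[of _ "ix ` F"] conjI ballI impI)
    show "ix ` F \<subseteq> {..<q\<^sup>2 - 1}" using ix(1) by (auto simp: N_def)
    show "card (ix ` F) = q" using cardF card_image[OF ixinj] by simp
    fix s t s' t' assume "s \<in> ix ` F" "t \<in> ix ` F" "s' \<in> ix ` F" "t' \<in> ix ` F"
      and st: "s \<noteq> t \<and> [s + t' = s' + t] (mod q\<^sup>2 - 1)"
    then obtain a b a' b' where F: "a \<in> F" "b \<in> F" "a' \<in> F" "b' \<in> F" and "s = ix a" "t = ix b" "s' = ix a'" "t' = ix b'" by blast
    then show "s = s'" "t = t'" using sidon[OF F] st by (auto simp: N_def)
  qed
qed

text \<open>The construction in the algebraic closure of the residue field modulo p; the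
  characteristic is carried along the embedding.\<close>

lemma bose_chowla:
  fixes p f :: nat
  assumes p: "prime p" and f: "f > 0"
  defines "q \<equiv> p ^ f"
  shows "\<exists>S\<subseteq>{..<q\<^sup>2 - 1}. card S = q \<and>
    (\<forall>a\<in>S. \<forall>b\<in>S. \<forall>a'\<in>S. \<forall>b'\<in>S. a \<noteq> b \<and> [a + b' = a' + b] (mod q\<^sup>2 - 1) \<longrightarrow> a = a' \<and> b = b')"
proof -
  define R where "R = residue_ring (int p)"
  interpret R: residues_prime p R by (unfold_locales) (use p in \<open>auto simp: R_def\<close>)
  interpret R: field R by (rule R.is_field)
  define L where "L = R.alg_closure"
  interpret L: algebraic_closure L "R.indexed_const ` carrier R" unfolding L_def by (rule R.alg_closureE(1))
  have h: "R.indexed_const \<in> ring_hom R L" unfolding L_def by (rule R.alg_closureE(2))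
  have R_pow: "add_pow R k \<one>\<^bsub>R\<^esub> = int k mod int p" for k :: nat
  proof (induction k)
    case 0
    then show ?case by (simp add: R.res_zero_eq)
  next
    case (Suc k)
    then show ?case using prime_gt_1_nat[OF p] by (simp add: R.res_add_eq R.res_one_eq mod_simps add.commute)
  qed
  have "add_pow L k \<one>\<^bsub>L\<^esub> = R.indexed_const (add_pow R k \<one>\<^bsub>R\<^esub>)" for k :: nat
  proof (induction k)
    case 0
    have "R.indexed_const \<zero>\<^bsub>R\<^esub> = \<zero>\<^bsub>L\<^esub>" by (rule ring_hom_zero[OF h]) unfold_locales
    then show ?case by simp
  next
    case (Suc k)
    then show ?case using ring_hom_add[OF h, of "add_pow R k \<one>\<^bsub>R\<^esub>" "\<one>\<^bsub>R\<^esub>"] ring_hom_one[OF h] by simp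
  qed
  then have "add_pow L p \<one>\<^bsub>L\<^esub> = R.indexed_const \<zero>\<^bsub>R\<^esub>" by (simp add: R_pow R.res_zero_eq)
  also have "\<dots> = \<zero>\<^bsub>L\<^esub>" by (rule ring_hom_zero[OF h]) unfold_locales
  finally show ?thesis unfolding q_def by (intro L.bose_chowla_aux p f)
qed

section \<open>Folding a modular Sidon set\<close>

lemma diff_rep_eq_card:
  "diff_rep A d = card {n \<in> A. n - d \<in> A}"
proof -
  have "{(a, a'). a \<in> A \<and> a' \<in> A \<and> d = a - a'} = (\<lambda>n. (n, n - d)) ` {n \<in> A. n - d \<in> A}"
    by (auto simp: image_iff)
  moreover have "inj_on (\<lambda>n. (n, n - d)) {n \<in> A. n - d \<in> A}" by (auto simp: inj_on_def)
  ultimately show ?thesis unfolding diff_rep_def by (simp add: card_image)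
qed

definition sidon_mod :: "int \<Rightarrow> int set \<Rightarrow> bool" where
  "sidon_mod M S \<longleftrightarrow> (\<forall>a\<in>S. \<forall>b\<in>S. \<forall>a'\<in>S. \<forall>b'\<in>S. a \<noteq> b \<and> [a - b = a' - b'] (mod M) \<longrightarrow> a = a' \<and> b = b')"

lemma sidon_modD:
  "sidon_mod M S \<Longrightarrow> a \<in> S \<Longrightarrow> b \<in> S \<Longrightarrow> a' \<in> S \<Longrightarrow> b' \<in> S \<Longrightarrow> a \<noteq> b \<Longrightarrow> [a - b = a' - b'] (mod M) \<Longrightarrow> a = a' \<and> b = b'"
  unfolding sidon_mod_def by blast

text \<open>The source of the bound g: a residue class modulo v splits into g classes modulo g
  v.\<close>

lemma mod_mult_div_less:
  fixes x g v :: int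
  assumes "g > 0" "v > 0" "v dvd x"
  shows "\<exists>l. 0 \<le> l \<and> l < g \<and> [x = l * v] (mod g * v)"
proof -
  obtain k where k: "x = v * k" using assms by (auto simp: dvd_def)
  have "[k * v = (k mod g) * v] (mod g * v)"
    by (metis cong_def mod_mod_trivial mod_mult_mult2)
  then show ?thesis using assms by (intro exI[of _ "k mod g"]) (auto simp: k mult.commute)
qed

text \<open>Two elements of S that agree modulo v differ by l v modulo g v for one of g values l,
  and by the Sidon property each value determines the first of the two elements. So dropping at most
  g elements makes reduction modulo v injective.\<close>

lemma sidon_mod_remove_collisions:
  fixes S :: "int set" and g v :: nat
  assumes S: "finite S" "sidon_mod (int g * int v) S" "S \<subseteq> {0..<int g * int v}" and g: "g > 0" and v: "v > 0"
  shows "\<exists>B\<subseteq>S. card S \<le> card B + g \<and> inj_on (\<lambda>b. b mod int v) B"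
proof -
  define C where "C = {a \<in> S. \<exists>b\<in>S. a \<noteq> b \<and> [a = b] (mod int v)}"
  have "\<forall>a\<in>C. \<exists>b l. b \<in> S \<and> a \<noteq> b \<and> 0 \<le> l \<and> l < int g \<and> [a - b = l * int v] (mod int g * int v)"
  proof
    fix a assume "a \<in> C"
    then obtain b where b: "b \<in> S" "a \<noteq> b" "[a = b] (mod int v)" by (auto simp: C_def)
    then have "int v dvd a - b" by (simp add: cong_iff_dvd_diff)
    then obtain l where "0 \<le> l \<and> l < int g \<and> [a - b = l * int v] (mod int g * int v)"
      using mod_mult_div_less[of "int g" "int v"] g v by auto
    then show "\<exists>b l. b \<in> S \<and> a \<noteq> b \<and> 0 \<le> l \<and> l < int g \<and> [a - b = l * int v] (mod int g * int v)" using b by blast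
  qed
  then obtain \<beta> l where bl: "\<And>a. a \<in> C \<Longrightarrow> \<beta> a \<in> S \<and> a \<noteq> \<beta> a \<and> 0 \<le> l a \<and> l a < int g \<and> [a - \<beta> a = l a * int v] (mod int g * int v)"
    by metis
  have "inj_on l C"
  proof (rule inj_onI)
    fix a a' assume a: "a \<in> C" "a' \<in> C" "l a = l a'"
    then have "[a - \<beta> a = a' - \<beta> a'] (mod int g * int v)" using bl by (metis cong_sym cong_trans)
    then show "a = a'" using sidon_modD[OF S(2), of a "\<beta> a" a' "\<beta> a'"] bl a by (auto simp: C_def)
  qed
  then have "card C \<le> card {0..<int g}" using bl by (intro card_inj_on_le[of l]) auto
  then have cC: "card C \<le> g" by simp
  show ?thesis
  proof (intro exI[of _ "S - C"] conjI)
    have "S = (S - C) \<union> C" by (auto simp: C_def)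
    then have "card S \<le> card (S - C) + card C" using card_Un_le[of "S - C" C] by simp
    then show "card S \<le> card (S - C) + g" using cC by linarith
    show "inj_on (\<lambda>b. b mod int v) (S - C)" by (auto simp: inj_on_def C_def cong_def)
  qed auto
qed

text \<open>Averaging over the shift t: each n lands in B for exactly \<open>card B\<close> of the v
  shifts.\<close>

lemma exists_dense_window:
  fixes B :: "int set" and N v :: nat
  assumes B: "B \<subseteq> {0..<int v}" and v: "v > 0"
  shows "\<exists>t. N * card B \<le> v * card {n \<in> {1..int N}. (n + t) mod int v \<in> B}"
proof (rule ccontr)
  assume "\<not> ?thesis"
  then have lt: "v * card {n \<in> {1..int N}. (n + t) mod int v \<in> B} < N * card B" for t by (meson not_le)
  have fB: "finite B" using B by (rule finite_subset) auto
  have "(\<Sum>t\<in>{0..<int v}. card {n \<in> {1..int N}. (n + t) mod int v \<in> B}) = (\<Sum>t\<in>{0..<int v}. \<Sum>n\<in>{1..int N}. if (n + t) mod int v \<in> B then 1 else 0)"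
    by (simp add: sum.If_cases Int_def)
  also have "\<dots> = (\<Sum>n\<in>{1..int N}. \<Sum>t\<in>{0..<int v}. if (n + t) mod int v \<in> B then 1 else 0)" by (rule sum.swap)
  also have "\<dots> = (\<Sum>n\<in>{1..int N}. card B)"
  proof (rule sum.cong[OF refl])
    fix n assume "n \<in> {1..int N}"
    have "(\<Sum>t\<in>{0..<int v}. if (n + t) mod int v \<in> B then 1 else 0) = card {t \<in> {0..<int v}. (n + t) mod int v \<in> B}"
      by (simp add: sum.If_cases Int_def)
    also have "\<dots> = card B"
    proof (rule bij_betw_same_card[of "\<lambda>t. (n + t) mod int v"], rule bij_betwI[of _ _ _ "\<lambda>b. (b - n) mod int v"])
      fix b assume "b \<in> B"
      then have "0 \<le> b" "b < int v" using B by auto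
      then have e: "(n + (b - n) mod int v) mod int v = b" by (simp add: mod_simps)
      then show "(n + (b - n) mod int v) mod int v = b" .
    next
      fix t assume "t \<in> {t \<in> {0..<int v}. (n + t) mod int v \<in> B}"
      then show "((n + t) mod int v - n) mod int v = t" by (auto simp: mod_simps)
    next
      show "(\<lambda>b. (b - n) mod int v) \<in> B \<rightarrow> {t \<in> {0..<int v}. (n + t) mod int v \<in> B}"
        using B v by (auto simp: mod_simps subset_eq)
    qed auto
    finally show "(\<Sum>t\<in>{0..<int v}. if (n + t) mod int v \<in> B then 1 else 0) = card B" .
  qed
  also have "\<dots> = N * card B" by simp
  finally have eq: "(\<Sum>t\<in>{0..<int v}. card {n \<in> {1..int N}. (n + t) mod int v \<in> B}) = N * card B" .
  have "v * (N * card B) = (\<Sum>t\<in>{0..<int v}. v * card {n \<in> {1..int N}. (n + t) mod int v \<in> B})"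
    using eq by (simp add: sum_distrib_left[symmetric])
  also have "\<dots> < (\<Sum>t\<in>{0..<int v}. N * card B)" using v lt by (intro sum_strict_mono) auto
  also have "\<dots> = v * (N * card B)" by simp
  finally show False by simp
qed

text \<open>If n and n - d lie in A, their lifts \<beta> n and \<beta> (n - d) to B differ by d + l
  v modulo g v, with g choices for l. The Sidon property recovers \<beta> n from l, and N \<le> v
  recovers n from \<beta> n. The term \<open>N * g\<close> pays for the elements dropped to make
  reduction injective.\<close>

lemma fold_sidon_mod:
  fixes S :: "int set" and g v N :: nat
  assumes S: "sidon_mod (int g * int v) S" "S \<subseteq> {0..<int g * int v}" and g: "g > 0" and v: "v > 0" and N: "N \<le> v"
  shows "\<exists>A\<subseteq>{1..int N}. N * card S \<le> v * card A + N * g \<and> (\<forall>d. 1 \<le> d \<and> d < int N \<longrightarrow> diff_rep A d \<le> g)"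
proof -
  have fS: "finite S" using S(2) by (rule finite_subset) auto
  obtain B where B: "B \<subseteq> S" "card S \<le> card B + g" "inj_on (\<lambda>b. b mod int v) B"
    using sidon_mod_remove_collisions[OF fS S g v] by blast
  define B' where "B' = (\<lambda>b. b mod int v) ` B"
  have cB': "card B' = card B" unfolding B'_def using B(3) by (rule card_image)
  have "B' \<subseteq> {0..<int v}" using v by (auto simp: B'_def)
  then obtain t where t: "N * card B' \<le> v * card {n \<in> {1..int N}. (n + t) mod int v \<in> B'}"
    using exists_dense_window[of B' v N] v by blast
  define A where "A = {n \<in> {1..int N}. (n + t) mod int v \<in> B'}"
  have "\<forall>n\<in>A. \<exists>b\<in>B. [b = n + t] (mod int v)" by (auto simp: A_def B'_def cong_def)
  then obtain \<beta> where \<beta>: "\<And>n. n \<in> A \<Longrightarrow> \<beta> n \<in> B \<and> [\<beta> n = n + t] (mod int v)" by metis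
  have rep: "diff_rep A d \<le> g" if d: "1 \<le> d" "d < int N" for d
  proof -
    define C where "C = {n \<in> A. n - d \<in> A}"
    have "\<forall>n\<in>C. \<exists>l. 0 \<le> l \<and> l < int g \<and> [\<beta> n - \<beta> (n - d) - d = l * int v] (mod int g * int v)"
    proof
      fix n assume n: "n \<in> C"
      have "[\<beta> n - \<beta> (n - d) - d = (n + t) - (n - d + t) - d] (mod int v)"
        using \<beta>[of n] \<beta>[of "n - d"] n by (intro cong_diff) (auto simp: C_def)
      then have "int v dvd \<beta> n - \<beta> (n - d) - d" by (simp add: cong_0_iff)
      then show "\<exists>l. 0 \<le> l \<and> l < int g \<and> [\<beta> n - \<beta> (n - d) - d = l * int v] (mod int g * int v)"
        using mod_mult_div_less[of "int g" "int v"] g v by auto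
    qed
    then obtain l where l: "\<And>n. n \<in> C \<Longrightarrow> 0 \<le> l n \<and> l n < int g \<and> [\<beta> n - \<beta> (n - d) - d = l n * int v] (mod int g * int v)" by metis
    have "inj_on l C"
    proof (rule inj_onI)
      fix n m assume nm: "n \<in> C" "m \<in> C" "l n = l m"
      have mem: "n \<in> A" "n - d \<in> A" "m \<in> A" "m - d \<in> A" using nm by (auto simp: C_def)
      have "[\<beta> n - \<beta> (n - d) - d = \<beta> m - \<beta> (m - d) - d] (mod int g * int v)"
        using l[OF nm(1)] l[OF nm(2)] nm(3) by (metis cong_sym cong_trans)
      then have cg: "[\<beta> n - \<beta> (n - d) = \<beta> m - \<beta> (m - d)] (mod int g * int v)"
        by (simp add: cong_iff_dvd_diff algebra_simps)
      \<comment> \<open>The Sidon property speaks of distinct elements only; equal lifts would make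
        v divide d, impossible for 1 \<le> d < N \<le> v.\<close>
      have "\<beta> n \<noteq> \<beta> (n - d)"
      proof
        assume "\<beta> n = \<beta> (n - d)"
        then have "[n + t = n - d + t] (mod int v)" using \<beta>[OF mem(1)] \<beta>[OF mem(2)] by (metis cong_sym cong_trans)
        then have "int v dvd d" by (simp add: cong_iff_dvd_diff)
        then show False using d N zdvd_imp_le[of "int v" d] by auto
      qed
      then have "\<beta> n = \<beta> m" using sidon_modD[OF S(1) _ _ _ _ _ cg] \<beta> mem B(1) by blast
      then have "[n + t = m + t] (mod int v)" using \<beta>[OF mem(1)] \<beta>[OF mem(3)] by (metis cong_sym cong_trans)
      then have "int v dvd n - m" by (simp add: cong_iff_dvd_diff)
      moreover have "\<bar>n - m\<bar> < int v" using mem N by (auto simp: A_def)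
      ultimately show "n = m" using zdvd_not_zless[of "\<bar>n - m\<bar>" "int v"] by (cases "n = m") auto
    qed
    then have "card C \<le> card {0..<int g}" using l by (intro card_inj_on_le[of l]) auto
    then show ?thesis unfolding diff_rep_eq_card C_def by simp
  qed
  have "N * card S \<le> N * card B' + N * g" using mult_le_mono2[OF B(2), of N] by (simp add: cB' distrib_left)
  also have "\<dots> \<le> v * card A + N * g" using t by (simp add: A_def)
  finally show ?thesis using rep by (intro exI[of _ A]) (auto simp: A_def)
qed

section \<open>Random subsets\<close>

text \<open>For A within U, the probability of A when the elements of U are chosen independently
  with probability p.\<close>

definition subset_weight :: "'a set \<Rightarrow> real \<Rightarrow> 'a set \<Rightarrow> real" where
  "subset_weight U p A = p ^ card A * (1 - p) ^ card (U - A)"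

text \<open>The product of p + b(x) over U, with b = 0 on T and 1 - p elsewhere, expands into
  exactly the sets containing T.\<close>

lemma sum_subset_weight_superset:
  assumes U: "finite U" and T: "T \<subseteq> U"
  shows "(\<Sum>A\<in>Pow U. subset_weight U p A * (if T \<subseteq> A then 1 else 0)) = p ^ card T"
proof -
  have fT: "finite T" using U T finite_subset by blast
  define b where "b = (\<lambda>x. if x \<in> T then 0 else 1 - p)"
  have "(\<Prod>x\<in>U. p + b x) = (\<Sum>A\<in>Pow U. (\<Prod>x\<in>A. p) * (\<Prod>x\<in>U - A. b x))"
    using U by (rule prod_add)
  also have "\<dots> = (\<Sum>A\<in>Pow U. subset_weight U p A * (if T \<subseteq> A then 1 else 0))"
  proof (rule sum.cong[OF refl])
    fix A assume A: "A \<in> Pow U"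
    show "(\<Prod>x\<in>A. p) * (\<Prod>x\<in>U - A. b x) = subset_weight U p A * (if T \<subseteq> A then 1 else 0)"
    proof (cases "T \<subseteq> A")
      case True
      then have "(\<Prod>x\<in>U - A. b x) = (\<Prod>x\<in>U - A. 1 - p)" by (intro prod.cong) (auto simp: b_def)
      then show ?thesis using True by (simp add: subset_weight_def)
    next
      case False
      then obtain x where "x \<in> T" "x \<notin> A" by blast
      then have "(\<Prod>x\<in>U - A. b x) = 0" using T U by (intro prod_zero) (auto simp: b_def)
      then show ?thesis using False by simp
    qed
  qed
  finally have "(\<Sum>A\<in>Pow U. subset_weight U p A * (if T \<subseteq> A then 1 else 0)) = (\<Prod>x\<in>U. p + b x)" by simp
  also have "\<dots> = (\<Prod>x\<in>U. if x \<in> T then p else 1)" by (intro prod.cong) (auto simp: b_def)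
  also have "\<dots> = (\<Prod>x\<in>U \<inter> T. p)" using U by (rule prod.inter_restrict[symmetric])
  also have "U \<inter> T = T" using T by auto
  finally show ?thesis by simp
qed

lemma sum_subset_weight_power:
  assumes U: "finite U"
  shows "(\<Sum>A\<in>Pow U. subset_weight U p A * y ^ card A) = (1 - p + p * y) ^ card U"
proof -
  have "(\<Prod>x\<in>U. p * y + (1 - p)) = (\<Sum>A\<in>Pow U. (\<Prod>x\<in>A. p * y) * (\<Prod>x\<in>U - A. 1 - p))"
    using U by (rule prod_add)
  also have "\<dots> = (\<Sum>A\<in>Pow U. subset_weight U p A * y ^ card A)"
    by (intro sum.cong) (auto simp: subset_weight_def power_mult_distrib)
  finally show ?thesis by (simp add: add.commute)
qed

text \<open>An exponential moment of the number of pairs inside A. Expanding (1 + s)^count over sets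
  J of contained pairs leaves the probability that A contains the union of the pairs in J, which is
  p^(2 |J|) by disjointness.\<close>

lemma sum_subset_weight_pairs:
  assumes U: "finite U" and I: "finite I" and P: "\<And>n. n \<in> I \<Longrightarrow> P n \<subseteq> U \<and> card (P n) = 2"
    and disj: "disjoint_family_on P I"
  shows "(\<Sum>A\<in>Pow U. subset_weight U p A * (1 + s) ^ card {n \<in> I. P n \<subseteq> A}) = (1 + s * p\<^sup>2) ^ card I"
proof -
  have pw: "(1 + s) ^ card {n \<in> I. P n \<subseteq> A} = (\<Sum>J\<in>Pow I. s ^ card J * (if (\<Union>n\<in>J. P n) \<subseteq> A then 1 else 0))" for A
  proof -
    have "(1 + s) ^ card {n \<in> I. P n \<subseteq> A} = (\<Prod>n\<in>I. if P n \<subseteq> A then 1 + s else 1)"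
      using I by (simp add: prod.If_cases Int_def)
    also have "\<dots> = (\<Prod>n\<in>I. (if P n \<subseteq> A then s else 0) + 1)" by (intro prod.cong) auto
    also have "\<dots> = (\<Sum>J\<in>Pow I. (\<Prod>n\<in>J. if P n \<subseteq> A then s else 0) * (\<Prod>n\<in>I - J. 1))"
      using I by (rule prod_add)
    also have "\<dots> = (\<Sum>J\<in>Pow I. s ^ card J * (if (\<Union>n\<in>J. P n) \<subseteq> A then 1 else 0))"
    proof (rule sum.cong[OF refl])
      fix J assume "J \<in> Pow I"
      then have J: "finite J" using I finite_subset by auto
      show "(\<Prod>n\<in>J. if P n \<subseteq> A then s else 0) * (\<Prod>n\<in>I - J. 1) = s ^ card J * (if (\<Union>n\<in>J. P n) \<subseteq> A then 1 else 0)"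
      proof (cases "(\<Union>n\<in>J. P n) \<subseteq> A")
        case True
        then have "(\<Prod>n\<in>J. if P n \<subseteq> A then s else 0) = (\<Prod>n\<in>J. s)" by (intro prod.cong) auto
        then show ?thesis using True by simp
      next
        case False
        then have "(\<Prod>n\<in>J. if P n \<subseteq> A then s else 0) = 0" using J by (intro prod_zero) auto
        then show ?thesis using False by simp
      qed
    qed
    finally show ?thesis .
  qed
  have "(\<Sum>A\<in>Pow U. subset_weight U p A * (1 + s) ^ card {n \<in> I. P n \<subseteq> A}) =
     (\<Sum>A\<in>Pow U. \<Sum>J\<in>Pow I. s ^ card J * (subset_weight U p A * (if (\<Union>n\<in>J. P n) \<subseteq> A then 1 else 0)))"
    unfolding pw sum_distrib_left by (intro sum.cong refl) (simp add: mult_ac)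
  also have "\<dots> = (\<Sum>J\<in>Pow I. \<Sum>A\<in>Pow U. s ^ card J * (subset_weight U p A * (if (\<Union>n\<in>J. P n) \<subseteq> A then 1 else 0)))"
    by (rule sum.swap)
  also have "\<dots> = (\<Sum>J\<in>Pow I. s ^ card J * p ^ card (\<Union>n\<in>J. P n))"
  proof (rule sum.cong[OF refl])
    fix J assume "J \<in> Pow I"
    then show "(\<Sum>A\<in>Pow U. s ^ card J * (subset_weight U p A * (if (\<Union>n\<in>J. P n) \<subseteq> A then 1 else 0))) = s ^ card J * p ^ card (\<Union>n\<in>J. P n)"
      using P by (subst sum_distrib_left[symmetric], subst sum_subset_weight_superset[OF U]) auto
  qed
  also have "\<dots> = (\<Sum>J\<in>Pow I. (\<Prod>n\<in>J. s * p\<^sup>2) * (\<Prod>n\<in>I - J. 1))"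
  proof (rule sum.cong[OF refl])
    fix J assume J: "J \<in> Pow I"
    then have fJ: "finite J" using I finite_subset by auto
    have "card (\<Union>n\<in>J. P n) = (\<Sum>n\<in>J. card (P n))"
      using fJ J P U disj by (intro card_UN_disjoint') (auto intro: finite_subset disjoint_family_on_mono)
    also have "\<dots> = 2 * card J" using J P by (simp add: subset_eq)
    finally show "s ^ card J * p ^ card (\<Union>n\<in>J. P n) = (\<Prod>n\<in>J. s * p\<^sup>2) * (\<Prod>n\<in>I - J. 1)"
      by (simp add: power_mult power_mult_distrib)
  qed
  also have "\<dots> = (\<Prod>n\<in>I. s * p\<^sup>2 + 1)" using I by (rule prod_add[symmetric])
  finally show ?thesis by (simp add: add.commute)
qed

lemma subset_weight_nonneg: "0 \<le> p \<Longrightarrow> p \<le> 1 \<Longrightarrow> 0 \<le> subset_weight U p A"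
  by (simp add: subset_weight_def)

lemma sum_subset_weight: "finite U \<Longrightarrow> (\<Sum>A\<in>Pow U. subset_weight U p A) = 1"
  using sum_subset_weight_power[of U p 1] by simp

lemma markov_subset_weight:
  assumes U: "finite U" and p: "0 \<le> p" "p \<le> 1" and h: "\<And>A. A \<in> Pow U \<Longrightarrow> h A \<ge> (0::real)" and c: "c > 0"
  shows "(\<Sum>A\<in>{A \<in> Pow U. h A \<ge> c}. subset_weight U p A) \<le> (\<Sum>A\<in>Pow U. subset_weight U p A * h A) / c"
proof -
  have "(\<Sum>A\<in>{A \<in> Pow U. h A \<ge> c}. subset_weight U p A) * c = (\<Sum>A\<in>{A \<in> Pow U. h A \<ge> c}. subset_weight U p A * c)"
    by (rule sum_distrib_right)
  also have "\<dots> \<le> (\<Sum>A\<in>{A \<in> Pow U. h A \<ge> c}. subset_weight U p A * h A)"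
    using p by (intro sum_mono mult_left_mono) (auto intro: subset_weight_nonneg)
  also have "\<dots> \<le> (\<Sum>A\<in>Pow U. subset_weight U p A * h A)"
    using U p h by (intro sum_mono2) (auto intro!: mult_nonneg_nonneg subset_weight_nonneg)
  finally show ?thesis using c by (simp add: field_simps)
qed

text \<open>Within one class the pairs \<open>{n, n - d}\<close> are disjoint, so they are independent for a random set.\<close>

definition diff_class :: "nat \<Rightarrow> int \<Rightarrow> bool \<Rightarrow> int set" where
  "diff_class N d i = {n \<in> {d + 1..int N}. even ((n - 1) div d) = i}"

text \<open>An exponential moment bound for one class. The deviation is measured against N and not
  against the size of the class, so the bound is uniform over all classes, small ones
  included.\<close>

lemma diff_class_bad_weight:
  fixes N :: nat and d :: int and p \<kappa> :: real
  assumes d: "1 \<le> d" and p: "0 < p" "p \<le> 1" and \<kappa>: "0 < \<kappa>" "\<kappa> \<le> 1"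
  shows "(\<Sum>A\<in>{A \<in> Pow {1..int N}. real (card {n \<in> diff_class N d i. {n, n - d} \<subseteq> A}) \<ge> p\<^sup>2 * real (card (diff_class N d i)) + \<kappa> * p\<^sup>2 * real N}. subset_weight {1..int N} p A)
    \<le> exp (- \<kappa>\<^sup>2 * p\<^sup>2 * real N / 8)"
proof -
  define I where "I = diff_class N d i"
  define U where "U = {1..int N}"
  \<comment> \<open>With |I| \<le> N and \<kappa> \<le> 1 the exponent is at most p^2 N (2 s^2 -
    \<kappa> s), which is minimal at s = \<kappa>/4 with value -\<kappa>^2 p^2 N / 8.\<close>
  define s where "s = \<kappa> / 4"
  have s: "0 < s" "s \<le> 1" using \<kappa> by (auto simp: s_def)
  define t where "t = p\<^sup>2 * real (card I) + \<kappa> * p\<^sup>2 * real N"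
  have finI: "finite I" unfolding I_def diff_class_def by (rule finite_subset[of _ "{d + 1..int N}"]) auto
  have cI: "card I \<le> N"
  proof -
    have "card I \<le> card {1..int N}" unfolding I_def diff_class_def using d by (intro card_mono) auto
    then show ?thesis by simp
  qed
  have P: "{n, n - d} \<subseteq> U \<and> card {n, n - d} = 2" if "n \<in> I" for n
    using that d by (auto simp: I_def diff_class_def U_def card_insert_if)
  have shift: "even ((n - d - 1) div d) \<noteq> even ((n - 1) div d)" for n
  proof -
    have "((n - d - 1) + d) div d = (n - d - 1) div d + 1" using d by (intro div_add_self2) auto
    then have "(n - 1) div d = (n - d - 1) div d + 1" by simp
    then show ?thesis by simp
  qed
  have disj: "disjoint_family_on (\<lambda>n. {n, n - d}) I"
    unfolding disjoint_family_on_def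
  proof (intro ballI impI)
    fix m n assume mn: "m \<in> I" "n \<in> I" "m \<noteq> n"
    have par: "even ((m - 1) div d) = even ((n - 1) div d)" using mn by (auto simp: I_def diff_class_def)
    have "m \<noteq> n - d" "n \<noteq> m - d" using par shift[of n] shift[of m] by auto
    then show "{m, m - d} \<inter> {n, n - d} = {}" using mn by auto
  qed
  define Y where "Y = (\<lambda>A. real (card {n \<in> I. {n, n - d} \<subseteq> A}))"
  have eq: "{A \<in> Pow U. Y A \<ge> t} = {A \<in> Pow U. (1 + s) powr (Y A) \<ge> (1 + s) powr t}"
    using s by (auto intro!: powr_mono)
  have "(\<Sum>A\<in>{A \<in> Pow U. Y A \<ge> t}. subset_weight U p A) \<le> (\<Sum>A\<in>Pow U. subset_weight U p A * (1 + s) powr (Y A)) / (1 + s) powr t"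
    unfolding eq using p s by (intro markov_subset_weight) (auto simp: U_def)
  also have "(\<Sum>A\<in>Pow U. subset_weight U p A * (1 + s) powr (Y A)) = (\<Sum>A\<in>Pow U. subset_weight U p A * (1 + s) ^ card {n \<in> I. {n, n - d} \<subseteq> A})"
    unfolding Y_def using s by (intro sum.cong refl) (simp add: powr_realpow)
  also have "\<dots> = (1 + s * p\<^sup>2) ^ card I" by (rule sum_subset_weight_pairs[OF _ finI P disj]) (auto simp: U_def)
  also have "(1 + s * p\<^sup>2) ^ card I / (1 + s) powr t \<le> exp (s * p\<^sup>2) ^ card I / exp (t * (s - s\<^sup>2))"
  proof (rule frac_le)
    show "(1 + s * p\<^sup>2) ^ card I \<le> exp (s * p\<^sup>2) ^ card I" using s by (intro power_mono exp_ge_add_one_self) auto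
    have "s - s\<^sup>2 \<le> ln (1 + s)" using s by (intro ln_one_plus_pos_lower_bound) auto
    moreover have "t \<ge> 0" using \<kappa> by (simp add: t_def)
    ultimately have "t * (s - s\<^sup>2) \<le> t * ln (1 + s)" by (intro mult_left_mono)
    then show "exp (t * (s - s\<^sup>2)) \<le> (1 + s) powr t" using s by (simp add: powr_def)
  qed auto
  also have "\<dots> = exp (real (card I) * (s * p\<^sup>2) - t * (s - s\<^sup>2))" by (simp add: exp_diff exp_of_nat_mult)
  also have "\<dots> \<le> exp (- \<kappa>\<^sup>2 * p\<^sup>2 * real N / 8)"
  proof -
    have "real (card I) * (s * p\<^sup>2) - t * (s - s\<^sup>2) = p\<^sup>2 * (real (card I) * s\<^sup>2 + \<kappa> * real N * s\<^sup>2 - \<kappa> * real N * s)"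
      by (simp add: t_def algebra_simps)
    also have "\<dots> \<le> p\<^sup>2 * (real N * s\<^sup>2 + 1 * real N * s\<^sup>2 - \<kappa> * real N * s)"
      using cI \<kappa> by (intro mult_left_mono add_mono diff_mono mult_right_mono) auto
    also have "\<dots> = - \<kappa>\<^sup>2 * p\<^sup>2 * real N / 8" by (simp add: s_def power2_eq_square field_simps)
    finally show ?thesis by simp
  qed
  finally show ?thesis unfolding Y_def t_def I_def U_def .
qed

lemma diff_rep_le_card:
  assumes "finite A"
  shows "diff_rep A d \<le> card A"
  unfolding diff_rep_eq_card using assms by (intro card_mono) auto

lemma diff_rep_eq_classes:
  assumes A: "A \<subseteq> {1..int N}"
  shows "diff_rep A d = card {n \<in> diff_class N d True. {n, n - d} \<subseteq> A} + card {n \<in> diff_class N d False. {n, n - d} \<subseteq> A}"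
proof -
  have fin: "finite (diff_class N d i)" for i
    unfolding diff_class_def by (rule finite_subset[of _ "{d + 1..int N}"]) auto
  have f: "finite {n \<in> diff_class N d i. Q n}" for i Q by (rule finite_subset[OF _ fin[of i]]) auto
  have eq: "{n \<in> A. n - d \<in> A} = {n \<in> diff_class N d True. {n, n - d} \<subseteq> A} \<union> {n \<in> diff_class N d False. {n, n - d} \<subseteq> A}"
    using A by (fastforce simp: diff_class_def)
  have disj: "{n \<in> diff_class N d True. {n, n - d} \<subseteq> A} \<inter> {n \<in> diff_class N d False. {n, n - d} \<subseteq> A} = {}"
    by (auto simp: diff_class_def)
  show ?thesis unfolding diff_rep_eq_card eq by (rule card_Un_disjoint[OF f f disj])
qed

lemma card_diff_class_le:
  assumes "d \<ge> 1"
  shows "card (diff_class N d True) + card (diff_class N d False) \<le> N"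
proof -
  have fin: "finite (diff_class N d i)" for i
    unfolding diff_class_def by (rule finite_subset[of _ "{d + 1..int N}"]) auto
  have "card (diff_class N d True) + card (diff_class N d False) = card (diff_class N d True \<union> diff_class N d False)"
    by (intro card_Un_disjoint[symmetric] fin) (auto simp: diff_class_def)
  also have "\<dots> \<le> card {1..int N}" using assms by (intro card_mono) (auto simp: diff_class_def)
  finally show ?thesis by simp
qed

text \<open>The exponential moment for the lower tail, with base y = 1/(1 + \<eta>) < 1: the mean of
  y^|A| is (1 - \<alpha> \<eta>)^N.\<close>

lemma small_subset_weight:
  fixes N :: nat and \<alpha> \<eta> :: real
  assumes \<eta>: "\<eta> > 0" and \<alpha>: "\<alpha> > 0" and p: "(1 + \<eta>) * \<alpha> \<le> 1"
  shows "(\<Sum>A\<in>{A \<in> Pow {1..int N}. real (card A) \<le> \<alpha> * real N}. subset_weight {1..int N} ((1 + \<eta>) * \<alpha>) A)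
    \<le> exp (- (\<eta> - ln (1 + \<eta>)) * (\<alpha> * real N))"
proof -
  define U where "U = {1..int N}"
  define q where "q = (1 + \<eta>) * \<alpha>"
  define y where "y = inverse (1 + \<eta>)"
  have y: "0 < y" "y < 1" using \<eta> by (auto simp: y_def field_simps)
  have q: "0 < q" "q \<le> 1" using \<alpha> \<eta> p by (auto simp: q_def)
  have eq: "{A \<in> Pow U. real (card A) \<le> \<alpha> * real N} \<subseteq> {A \<in> Pow U. y ^ card A \<ge> y powr (\<alpha> * real N)}"
    using y by (auto simp: powr_realpow[symmetric] intro!: powr_mono')
  have "(\<Sum>A\<in>{A \<in> Pow U. real (card A) \<le> \<alpha> * real N}. subset_weight U q A) \<le> (\<Sum>A\<in>{A \<in> Pow U. y ^ card A \<ge> y powr (\<alpha> * real N)}. subset_weight U q A)"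
    using q eq by (intro sum_mono2) (auto simp: U_def intro: subset_weight_nonneg)
  also have "\<dots> \<le> (\<Sum>A\<in>Pow U. subset_weight U q A * y ^ card A) / y powr (\<alpha> * real N)"
    using q y by (intro markov_subset_weight) (auto simp: U_def)
  also have "(\<Sum>A\<in>Pow U. subset_weight U q A * y ^ card A) = (1 - q + q * y) ^ card U"
    by (rule sum_subset_weight_power) (simp add: U_def)
  also have "1 - q + q * y = 1 + (- (\<alpha> * \<eta>))" using \<eta> by (simp add: q_def y_def field_simps)
  also have "(1 + (- (\<alpha> * \<eta>))) ^ card U / y powr (\<alpha> * real N) \<le> exp (- (\<alpha> * \<eta>)) ^ card U / y powr (\<alpha> * real N)"
  proof (intro divide_right_mono power_mono exp_ge_add_one_self)
    have "\<alpha> * \<eta> \<le> (1 + \<eta>) * \<alpha>" using \<alpha> by (simp add: algebra_simps)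
    then show "0 \<le> 1 + (- (\<alpha> * \<eta>))" using p by simp
  qed auto
  also have "\<dots> = exp (- (\<eta> - ln (1 + \<eta>)) * (\<alpha> * real N))"
  proof -
    have "exp (- (\<alpha> * \<eta>)) ^ card U = exp (- (\<alpha> * \<eta>) * real N)" by (simp add: U_def exp_of_nat_mult[symmetric] mult.commute)
    moreover have "y powr (\<alpha> * real N) = exp (- (\<alpha> * real N) * ln (1 + \<eta>))" using \<eta> by (simp add: y_def powr_def ln_inverse)
    ultimately show ?thesis by (simp add: exp_diff[symmetric] algebra_simps)
  qed
  finally show ?thesis by (simp add: U_def q_def)
qed

lemma random_regime:
  fixes \<epsilon> :: real
  assumes \<epsilon>: "0 < \<epsilon>" "\<epsilon> \<le> 1"
  shows "\<exists>C>0. \<forall>N \<alpha>. N \<ge> 2 \<and> 0 < \<alpha> \<and> \<alpha> < 1 \<and> C \<le> \<alpha>\<^sup>2 * real N \<and> C * ln (real N) \<le> \<alpha>\<^sup>2 * real N \<longrightarrow>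
    (\<exists>A\<subseteq>{1..int N}. \<alpha> * real N \<le> real (card A) \<and> (\<forall>d. 1 \<le> d \<and> d < int N \<longrightarrow> real (diff_rep A d) \<le> (1 + \<epsilon>) * (\<alpha>\<^sup>2 * real N)))"
proof -
  define \<eta> where "\<eta> = \<epsilon> / 10"
  have \<eta>: "0 < \<eta>" "\<eta> \<le> 1/10" using \<epsilon> by (auto simp: \<eta>_def)
  have fac: "(1 + 2 * \<eta>) * (1 + \<eta>)\<^sup>2 \<le> 1 + \<epsilon>"
  proof -
    have s: "\<eta>\<^sup>2 \<le> \<eta> / 10" using \<eta> mult_left_mono[of \<eta> "1/10" \<eta>] by (simp add: power2_eq_square)
    have c: "\<eta>\<^sup>2 * \<eta> \<le> \<eta> / 10" using s \<eta> mult_mono[of "\<eta>\<^sup>2" "\<eta> / 10" \<eta> 1] by simp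
    have "(1 + 2 * \<eta>) * (1 + \<eta>)\<^sup>2 = 1 + 4 * \<eta> + 5 * \<eta>\<^sup>2 + 2 * (\<eta>\<^sup>2 * \<eta>)" by (simp add: power2_eq_square algebra_simps)
    also have "\<dots> \<le> 1 + 10 * \<eta>" using s c \<eta> by linarith
    finally show ?thesis by (simp add: \<eta>_def)
  qed
  have fac1: "(1 + \<eta>)\<^sup>2 \<le> 1 + \<epsilon>"
  proof -
    have "1 * (1 + \<eta>)\<^sup>2 \<le> (1 + 2 * \<eta>) * (1 + \<eta>)\<^sup>2" using \<eta> by (intro mult_right_mono) auto
    then show ?thesis using fac by simp
  qed
  define c where "c = \<eta> - ln (1 + \<eta>)"
  have c: "c > 0"
  proof -
    have "ln (1 + \<eta>) \<le> \<eta>" using \<eta> by (intro ln_add_one_self_le_self) auto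
    moreover have "ln (1 + \<eta>) \<noteq> \<eta>" using \<eta> ln_eq_minus_one[of "1 + \<eta>"] by auto
    ultimately show ?thesis by (simp add: c_def)
  qed
  \<comment> \<open>With 48 / \<eta>^2, each of the at most 2 N events \<open>bad\<close> has
    probability at most exp(-3) / N; with 2 / c, the event \<open>bad0\<close> of too few elements
    has probability at most exp(-2). Together these stay below 1.\<close>
  define C where "C = max (48 / \<eta>\<^sup>2) (2 / c)"
  have C: "C > 0" "C \<ge> 48 / \<eta>\<^sup>2" "C \<ge> 2 / c" using \<eta> c by (auto simp: C_def less_max_iff_disj)
  show ?thesis
  proof (intro exI[of _ C] conjI allI impI, fact C(1))
    fix N :: nat and \<alpha> :: real
    assume H: "N \<ge> 2 \<and> 0 < \<alpha> \<and> \<alpha> < 1 \<and> C \<le> \<alpha>\<^sup>2 * real N \<and> C * ln (real N) \<le> \<alpha>\<^sup>2 * real N"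
    define g where "g = \<alpha>\<^sup>2 * real N"
    have g: "C \<le> g" "C * ln (real N) \<le> g" using H by (auto simp: g_def)
    define U where "U = {1..int N}"
    have finU: "finite U" by (simp add: U_def)
    show "\<exists>A\<subseteq>{1..int N}. \<alpha> * real N \<le> real (card A) \<and> (\<forall>d. 1 \<le> d \<and> d < int N \<longrightarrow> real (diff_rep A d) \<le> (1 + \<epsilon>) * (\<alpha>\<^sup>2 * real N))"
    proof (cases "(1 + \<eta>) * \<alpha> \<ge> 1")
      \<comment> \<open>The inflated density would reach or exceed 1; at such \<alpha> the full
        interval already has few enough representations.\<close>
      case True
      have "real (diff_rep U d) \<le> (1 + \<epsilon>) * (\<alpha>\<^sup>2 * real N)" for d
      proof -
        have "real (diff_rep U d) \<le> 1\<^sup>2 * real N" using diff_rep_le_card[OF finU, of d] by (simp add: U_def)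
        also have "\<dots> \<le> ((1 + \<eta>) * \<alpha>)\<^sup>2 * real N" using True by (intro mult_right_mono power_mono) auto
        also have "\<dots> = (1 + \<eta>)\<^sup>2 * (\<alpha>\<^sup>2 * real N)" by (simp add: power_mult_distrib)
        also have "\<dots> \<le> (1 + \<epsilon>) * (\<alpha>\<^sup>2 * real N)" using fac1 by (intro mult_right_mono) auto
        finally show ?thesis .
      qed
      moreover have "\<alpha> * real N \<le> real (card U)" using H by (simp add: U_def mult_left_le_one_le)
      ultimately show ?thesis by (intro exI[of _ U]) (auto simp: U_def)
    next
      case False
      define p where "p = (1 + \<eta>) * \<alpha>"
      have p: "0 < p" "p \<le> 1" using False H \<eta> by (auto simp: p_def)
      define bad0 where "bad0 = {A \<in> Pow U. real (card A) \<le> \<alpha> * real N}"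
      define bad where "bad = (\<lambda>(d,i). {A \<in> Pow U. real (card {n \<in> diff_class N d i. {n, n - d} \<subseteq> A}) \<ge> p\<^sup>2 * real (card (diff_class N d i)) + \<eta> * p\<^sup>2 * real N})"
      define D where "D = {1..<int N} \<times> (UNIV :: bool set)"
      have cD: "card D \<le> 2 * N" and finD: "finite D" by (auto simp: D_def card_cartesian_product)
      have w0: "(\<Sum>A\<in>bad0. subset_weight U p A) \<le> 1/4"
      proof -
        have "(\<Sum>A\<in>bad0. subset_weight U p A) \<le> exp (- c * (\<alpha> * real N))"
          unfolding bad0_def U_def p_def c_def using H \<eta> p by (intro small_subset_weight) (auto simp: p_def)
        also have "\<dots> \<le> exp (-2)"
        proof -
          have "\<alpha>\<^sup>2 * real N \<le> \<alpha> * real N" using H by (intro mult_right_mono) (auto simp: power2_eq_square mult_left_le_one_le)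
          then have "2 / c \<le> \<alpha> * real N" using C(3) g by (simp add: g_def)
          then have "2 \<le> c * (\<alpha> * real N)" using c by (simp add: field_simps)
          then show ?thesis by simp
        qed
        also have "\<dots> \<le> 1/4"
        proof -
          have "2 \<le> exp (1::real)" using exp_ge_add_one_self[of 1] by simp
          then have "2 * 2 \<le> exp 1 * exp (1::real)" by (intro mult_mono) auto
          then have "4 \<le> exp (2::real)" by (simp flip: exp_add)
          then show ?thesis by (simp add: exp_minus field_simps)
        qed
        finally show ?thesis .
      qed
      have wd: "(\<Sum>A\<in>bad x. subset_weight U p A) \<le> exp (- (ln (real N) + 3))" if "x \<in> D" for x
      proof -
        obtain d i where x: "x = (d, i)" "1 \<le> d" using \<open>x \<in> D\<close> by (auto simp: D_def)
        have "(\<Sum>A\<in>bad x. subset_weight U p A) \<le> exp (- \<eta>\<^sup>2 * p\<^sup>2 * real N / 8)"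
          unfolding x bad_def U_def prod.case using x p \<eta> by (intro diff_class_bad_weight) auto
        also have "\<dots> \<le> exp (- (ln (real N) + 3))"
        proof -
          have "\<alpha>\<^sup>2 * real N \<le> p\<^sup>2 * real N" using H \<eta> by (intro mult_right_mono power_mono) (auto simp: p_def mult_le_cancel_right1)
          then have pg: "g \<le> p\<^sup>2 * real N" by (simp add: g_def)
          have "ln (real N) \<ge> 0" using H by simp
          then have "48 / \<eta>\<^sup>2 * ln (real N) \<le> C * ln (real N)" using C by (intro mult_right_mono) auto
          then have "48 / \<eta>\<^sup>2 * ln (real N) + 48 / \<eta>\<^sup>2 \<le> 2 * (p\<^sup>2 * real N)" using g C pg by linarith
          then have "\<eta>\<^sup>2 * (48 / \<eta>\<^sup>2 * ln (real N) + 48 / \<eta>\<^sup>2) \<le> \<eta>\<^sup>2 * (2 * (p\<^sup>2 * real N))" by (intro mult_left_mono) auto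
          then have "48 * ln (real N) + 48 \<le> 2 * (\<eta>\<^sup>2 * p\<^sup>2 * real N)" using \<eta> by (simp add: algebra_simps)
          then show ?thesis using \<open>ln (real N) \<ge> 0\<close> by simp
        qed
        finally show ?thesis .
      qed
      have e3: "2 * real N * exp (- (ln (real N) + 3)) \<le> 1/4"
      proof -
        have "exp (- (ln (real N) + 3)) = exp (-3) / real N" using H by (simp add: exp_diff exp_minus field_simps exp_add)
        moreover have "8 \<le> exp (3::real)"
        proof -
          have "2 \<le> exp (1::real)" using exp_ge_add_one_self[of 1] by simp
          then have "2 ^ 3 \<le> exp (1::real) ^ 3" by (intro power_mono) auto
          then show ?thesis by (simp flip: exp_of_nat_mult)
        qed
        then have "exp (-3) \<le> (1/8 :: real)" by (simp add: exp_minus field_simps)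
        moreover have "2 * real N * (exp (-3) / real N) = 2 * exp (-3)" using H by simp
        ultimately show ?thesis by simp
      qed
      have "\<exists>A\<in>Pow U. A \<notin> bad0 \<and> (\<forall>x\<in>D. A \<notin> bad x)"
      proof (rule ccontr)
        assume "\<not> ?thesis"
        then have cover: "\<And>A. A \<in> Pow U \<Longrightarrow> A \<in> bad0 \<or> (\<exists>x\<in>D. A \<in> bad x)" by blast
        have w: "subset_weight U p A \<ge> 0" for A using p by (intro subset_weight_nonneg) auto
        have "1 = (\<Sum>A\<in>Pow U. subset_weight U p A)" using sum_subset_weight[OF finU] by simp
        also have "\<dots> \<le> (\<Sum>A\<in>Pow U. subset_weight U p A * of_bool (A \<in> bad0) + (\<Sum>x\<in>D. subset_weight U p A * of_bool (A \<in> bad x)))"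
        proof (rule sum_mono)
          fix A assume A: "A \<in> Pow U"
          have nn: "0 \<le> (\<Sum>x\<in>D. subset_weight U p A * of_bool (A \<in> bad x))" using w by (intro sum_nonneg) auto
          from cover[OF A] show "subset_weight U p A \<le> subset_weight U p A * of_bool (A \<in> bad0) + (\<Sum>x\<in>D. subset_weight U p A * of_bool (A \<in> bad x))"
          proof
            assume "A \<in> bad0" then show ?thesis using nn by simp
          next
            assume "\<exists>x\<in>D. A \<in> bad x"
            then obtain x where x: "x \<in> D" "A \<in> bad x" by blast
            have "subset_weight U p A * of_bool (A \<in> bad x) \<le> (\<Sum>x\<in>D. subset_weight U p A * of_bool (A \<in> bad x))"
              using x finD w by (intro member_le_sum) auto
            then show ?thesis using x w[of A] by (auto simp: add_increasing)
          qed
        qed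
        also have "\<dots> = (\<Sum>A\<in>Pow U. subset_weight U p A * of_bool (A \<in> bad0)) + (\<Sum>x\<in>D. \<Sum>A\<in>Pow U. subset_weight U p A * of_bool (A \<in> bad x))"
          by (simp only: sum.distrib sum.swap[of _ "Pow U"])
        also have "(\<Sum>A\<in>Pow U. subset_weight U p A * of_bool (A \<in> bad0)) = (\<Sum>A\<in>bad0. subset_weight U p A)"
          using finU by (intro sum.mono_neutral_cong_right) (auto simp: bad0_def)
        also have "(\<Sum>x\<in>D. \<Sum>A\<in>Pow U. subset_weight U p A * of_bool (A \<in> bad x)) = (\<Sum>x\<in>D. \<Sum>A\<in>bad x. subset_weight U p A)"
          using finU by (intro sum.cong refl sum.mono_neutral_cong_right) (auto simp: bad_def)
        also have "(\<Sum>A\<in>bad0. subset_weight U p A) + (\<Sum>x\<in>D. \<Sum>A\<in>bad x. subset_weight U p A) \<le> 1/4 + (\<Sum>x\<in>D. exp (- (ln (real N) + 3)))"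
          by (intro add_mono sum_mono w0 wd)
        also have "\<dots> = 1/4 + real (card D) * exp (- (ln (real N) + 3))" by simp
        also have "\<dots> \<le> 1/4 + 2 * real N * exp (- (ln (real N) + 3))"
        proof -
          have "real (card D) \<le> 2 * real N" using of_nat_mono[OF cD, where 'a = real] by simp
          then show ?thesis by (intro add_left_mono mult_right_mono) auto
        qed
        finally show False using e3 by simp
      qed
      then obtain A where A: "A \<subseteq> U" "A \<notin> bad0" "\<And>d i. 1 \<le> d \<Longrightarrow> d < int N \<Longrightarrow> A \<notin> bad (d, i)" by (auto simp: D_def)
      have "real (diff_rep A d) \<le> (1 + \<epsilon>) * (\<alpha>\<^sup>2 * real N)" if d: "1 \<le> d" "d < int N" for d
      proof -
        have lt: "real (card {n \<in> diff_class N d i. {n, n - d} \<subseteq> A}) \<le> p\<^sup>2 * real (card (diff_class N d i)) + \<eta> * p\<^sup>2 * real N" for i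
          using A(3)[OF d, of i] A(1) by (auto simp: bad_def)
        have "real (diff_rep A d) \<le> p\<^sup>2 * (real (card (diff_class N d True)) + real (card (diff_class N d False))) + 2 * \<eta> * p\<^sup>2 * real N"
          using lt[of True] lt[of False] diff_rep_eq_classes[of A N d] A(1) by (simp add: U_def algebra_simps)
        also have "\<dots> \<le> p\<^sup>2 * real N + 2 * \<eta> * p\<^sup>2 * real N"
          using of_nat_mono[OF card_diff_class_le[OF d(1), of N], where 'a = real] by (intro add_right_mono mult_left_mono) auto
        also have "\<dots> = (1 + 2 * \<eta>) * (1 + \<eta>)\<^sup>2 * (\<alpha>\<^sup>2 * real N)"
        proof -
          have "p\<^sup>2 = (1 + \<eta>)\<^sup>2 * \<alpha>\<^sup>2" by (simp add: p_def power_mult_distrib)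
          then show ?thesis by (simp only:) (simp add: algebra_simps)
        qed
        also have "\<dots> \<le> (1 + \<epsilon>) * (\<alpha>\<^sup>2 * real N)" using fac by (intro mult_right_mono) auto
        finally show ?thesis .
      qed
      moreover have "\<alpha> * real N \<le> real (card A)" using A(1,2) by (auto simp: bad0_def)
      ultimately show ?thesis using A(1) by (intro exI[of _ A]) (auto simp: U_def)
    qed
  qed
qed

section \<open>The lower bound\<close>

lemma diff_rep_uminus: "diff_rep A (- d) = diff_rep A d"
proof -
  have "bij_betw (\<lambda>n. n + d) {n \<in> A. n - - d \<in> A} {n \<in> A. n - d \<in> A}"
    by (rule bij_betwI[of _ _ _ "\<lambda>n. n - d"]) auto
  then show ?thesis unfolding diff_rep_eq_card by (rule bij_betw_same_card)
qed

text \<open>Differences of size at least N do not occur, and d and -d have equally many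
  representations.\<close>

lemma diff_rep_le_of_ne_0:
  assumes A: "A \<subseteq> {1..int N}" and M: "\<And>d. 1 \<le> d \<Longrightarrow> d < int N \<Longrightarrow> diff_rep A d \<le> M" and d: "d \<noteq> 0"
  shows "diff_rep A d \<le> M"
proof -
  have pos: "diff_rep A e \<le> M" if "e \<ge> 1" for e
  proof (cases "e < int N")
    case False
    have "n - e \<notin> A" if "n \<in> A" for n
      using subsetD[OF A that] subsetD[OF A, of "n - e"] False by auto
    then have "{n \<in> A. n - e \<in> A} = {}" by blast
    then show ?thesis unfolding diff_rep_eq_card by (simp only: card.empty)
  qed (use M that in auto)
  show ?thesis
  proof (cases "d \<ge> 1")
    case False
    then have "diff_rep A (- d) \<le> M" using d by (intro pos) auto
    then show ?thesis by (simp add: diff_rep_uminus)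
  qed (use pos in auto)
qed

lemma window_second_moment:
  fixes N H M :: nat
  assumes A: "A \<subseteq> {1..int N}" and M: "\<And>d. 1 \<le> d \<Longrightarrow> d < int N \<Longrightarrow> diff_rep A d \<le> M"
  shows "(real H * real (card A))\<^sup>2 \<le> real (N + H) * (real H * real (card A) + (real H)\<^sup>2 * real M)"
proof -
  have finA: "finite A" using A by (rule finite_subset) auto
  \<comment> \<open>The N + H - 1 positions x at which the window can meet {1..N}; over them every
    element of A is counted exactly H times.\<close>
  define V where "V = {1 - int H..int N - 1}"
  have finV: "finite V" by (simp add: V_def)
  define f :: "int \<Rightarrow> real" where "f = (\<lambda>n. of_bool (n \<in> A))"
  define c where "c = (\<lambda>x. \<Sum>i\<in>{1..int H}. f (x + i))"
  have first: "(\<Sum>x\<in>V. c x) = real H * real (card A)"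
  proof -
    have "(\<Sum>x\<in>V. c x) = (\<Sum>i\<in>{1..int H}. \<Sum>x\<in>V. f (x + i))" unfolding c_def by (rule sum.swap)
    also have "\<dots> = (\<Sum>i\<in>{1..int H}. real (card A))"
    proof (rule sum.cong[OF refl])
      fix i assume i: "i \<in> {1..int H}"
      have "(\<Sum>x\<in>V. f (x + i)) = real (card {x \<in> V. x + i \<in> A})" unfolding f_def using finV by (simp add: Int_def)
      also have "card {x \<in> V. x + i \<in> A} = card A"
        by (rule bij_betw_same_card[of "\<lambda>x. x + i"], rule bij_betwI[of _ _ _ "\<lambda>n. n - i"])
          (use A i in \<open>auto simp: V_def subset_eq\<close>)
      finally show "(\<Sum>x\<in>V. f (x + i)) = real (card A)" .
    qed
    finally show ?thesis by simp
  qed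
  have "(\<Sum>x\<in>V. (c x)\<^sup>2) = (\<Sum>x\<in>V. \<Sum>i\<in>{1..int H}. \<Sum>j\<in>{1..int H}. f (x + i) * f (x + j))"
    unfolding c_def power2_eq_square sum_product ..
  also have "\<dots> = (\<Sum>i\<in>{1..int H}. \<Sum>x\<in>V. \<Sum>j\<in>{1..int H}. f (x + i) * f (x + j))" by (rule sum.swap)
  also have "\<dots> = (\<Sum>i\<in>{1..int H}. \<Sum>j\<in>{1..int H}. \<Sum>x\<in>V. f (x + i) * f (x + j))"
    by (intro sum.cong refl sum.swap)
  also have "\<dots> \<le> (\<Sum>i\<in>{1..int H}. \<Sum>j\<in>{1..int H}. (if i = j then real (card A) else 0) + real M)"
  proof (intro sum_mono)
    fix i j assume ij: "i \<in> {1..int H}" "j \<in> {1..int H}"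
    have "(\<Sum>x\<in>V. f (x + i) * f (x + j)) = real (card {x \<in> V. x + i \<in> A \<and> x + j \<in> A})"
      unfolding f_def using finV by (simp add: Int_def flip: of_bool_conj)
    also have "\<dots> \<le> real (diff_rep A (i - j))"
      unfolding diff_rep_eq_card using finA
      by (intro of_nat_mono card_inj_on_le[of "\<lambda>x. x + i"]) (auto simp: inj_on_def algebra_simps)
    \<comment> \<open>Only the diagonal needs the trivial bound by the size of A; M is added there
      too, to keep the sum simple.\<close>
    also have "\<dots> \<le> (if i = j then real (card A) else 0) + real M"
      using diff_rep_le_card[OF finA, of 0] diff_rep_le_of_ne_0[OF A M, of "i - j"] by auto
    finally show "(\<Sum>x\<in>V. f (x + i) * f (x + j)) \<le> (if i = j then real (card A) else 0) + real M" .
  qed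
  also have "\<dots> = real H * real (card A) + (real H)\<^sup>2 * real M"
    by (simp add: sum.distrib power2_eq_square algebra_simps)
  finally have second: "(\<Sum>x\<in>V. (c x)\<^sup>2) \<le> real H * real (card A) + (real H)\<^sup>2 * real M" .
  have "(real H * real (card A))\<^sup>2 \<le> (\<Sum>x\<in>V. (c x)\<^sup>2) * real (card V)"
    unfolding first[symmetric] by (rule sum_squared_le_sum_of_squares)
  also have "\<dots> \<le> (real H * real (card A) + (real H)\<^sup>2 * real M) * real (N + H)"
    using second by (intro mult_mono) (auto simp: V_def sum_nonneg)
  finally show ?thesis by (simp add: mult.commute)
qed

lemma diff_rep_lower_bound:
  fixes \<epsilon> \<alpha> :: real and N M :: nat
  assumes \<epsilon>: "0 < \<epsilon>" "\<epsilon> \<le> 1" and \<alpha>: "0 < \<alpha>" "\<alpha> < 1" and big: "\<alpha>\<^sup>2 * real N \<ge> 16 / \<epsilon>\<^sup>2"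
    and A: "A \<subseteq> {1..int N}" "\<alpha> * real N \<le> real (card A)" and M: "\<And>d. 1 \<le> d \<Longrightarrow> d < int N \<Longrightarrow> diff_rep A d \<le> M"
  shows "(1 - \<epsilon>) * (\<alpha>\<^sup>2 * real N) \<le> real M"
proof -
  define g where "g = \<alpha>\<^sup>2 * real N"
  \<comment> \<open>A window of length about \<delta> N loses a factor 1 + 2 \<delta> = 1 +
    \<epsilon>/4 to positions overhanging the ends, and a term \<alpha>/\<delta> = 8
    \<alpha>/\<epsilon> to the diagonal; \<open>big\<close> makes the latter at most (\<epsilon>/2)
    g.\<close>
  define \<delta> where "\<delta> = \<epsilon> / 8"
  have \<delta>: "0 < \<delta>" "\<delta> \<le> 1/8" using \<epsilon> by (auto simp: \<delta>_def)
  have \<epsilon>2: "\<epsilon>\<^sup>2 \<le> \<epsilon>" using \<epsilon> by (simp add: power2_eq_square mult_left_le)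
  have g16: "g \<ge> 16 / \<epsilon>\<^sup>2" using big by (simp add: g_def)
  have "16 / \<epsilon> \<le> 16 / \<epsilon>\<^sup>2" using \<epsilon> \<epsilon>2 by (intro divide_left_mono) auto
  then have g\<delta>: "g \<ge> 2 / \<delta>" using g16 by (simp add: \<delta>_def)
  have aN: "g \<le> \<alpha> * real N" unfolding g_def using \<alpha> by (intro mult_right_mono) (auto simp: power2_eq_square mult_left_le)
  have "\<alpha> * real N \<le> real N" using \<alpha> by (simp add: mult_left_le_one_le)
  then have gN: "g \<le> real N" using aN by linarith
  have "2 \<le> \<delta> * g" using g\<delta> \<delta> by (simp add: field_simps)
  also have "\<dots> \<le> \<delta> * real N" using gN \<delta> by (intro mult_left_mono) auto
  finally have dN: "2 \<le> \<delta> * real N" .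
  then have N0: "real N > 0" using \<delta> by (cases "N = 0") auto
  define H where "H = nat \<lceil>\<delta> * real N\<rceil>"
  have H: "\<delta> * real N \<le> real H" "real H \<le> 2 * \<delta> * real N"
  proof -
    show "\<delta> * real N \<le> real H" unfolding H_def by (rule real_nat_ceiling_ge)
    have "real H \<le> \<delta> * real N + 1" unfolding H_def using dN by linarith
    then show "real H \<le> 2 * \<delta> * real N" using dN by linarith
  qed
  have H0: "real H > 0" using H dN by linarith
  define k where "k = real (card A)"
  have k: "\<alpha> * real N \<le> k" using A by (simp add: k_def)
  have k0: "k > 0" using k aN g\<delta> \<delta> by (smt (verit) divide_pos_pos)
  have "(real H * k)\<^sup>2 \<le> real (N + H) * (real H * k + (real H)\<^sup>2 * real M)"
    unfolding k_def using A(1) M by (rule window_second_moment)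
  also have "\<dots> \<le> ((1 + 2 * \<delta>) * real N) * (real H * k + (real H)\<^sup>2 * real M)"
    using H k0 by (intro mult_right_mono) (auto simp: algebra_simps)
  finally have "(real H)\<^sup>2 * k\<^sup>2 \<le> (real H)\<^sup>2 * ((1 + 2 * \<delta>) * real N * (k / real H + real M))"
    using H0 by (simp add: power_mult_distrib power2_eq_square algebra_simps)
  then have "k\<^sup>2 \<le> (1 + 2 * \<delta>) * real N * (k / real H + real M)" using H0 by simp
  then have "k\<^sup>2 / ((1 + 2 * \<delta>) * real N) \<le> k / real H + real M" using N0 \<delta> by (simp add: divide_le_eq mult_ac)
  moreover have "k / real H \<le> k / (\<delta> * real N)" using H dN k0 by (intro divide_left_mono) auto
  ultimately have "k\<^sup>2 / ((1 + 2 * \<delta>) * real N) - k / (\<delta> * real N) \<le> real M" by linarith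
  moreover have "k\<^sup>2 / ((1 + 2 * \<delta>) * real N) - k / (\<delta> * real N) = k / real N * (k / (1 + 2 * \<delta>) - 1 / \<delta>)"
  proof -
    have "k\<^sup>2 / (s * n) - k / (e * n) = k / n * (k / s - 1 / e)" for s n e :: real
      by (simp add: right_diff_distrib power2_eq_square mult.commute)
    then show ?thesis .
  qed
  \<comment> \<open>The lower bound for M increases with k once its second factor is nonnegative, so
    sets of size \<alpha> N are the worst case.\<close>
  moreover have "(\<alpha> * real N) / real N * ((\<alpha> * real N) / (1 + 2 * \<delta>) - 1 / \<delta>) \<le> k / real N * (k / (1 + 2 * \<delta>) - 1 / \<delta>)"
  proof (intro mult_mono divide_right_mono diff_mono k)
    have "1 / \<delta> \<le> g / (1 + 2 * \<delta>)"
    proof -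
      have "(1 + 2 * \<delta>) / \<delta> \<le> 2 / \<delta>" using \<delta> by (intro divide_right_mono) auto
      then have "(1 + 2 * \<delta>) / \<delta> \<le> g" using g\<delta> by linarith
      then show ?thesis using \<delta> by (simp add: field_simps)
    qed
    also have "\<dots> \<le> \<alpha> * real N / (1 + 2 * \<delta>)" using aN \<delta> by (intro divide_right_mono) auto
    finally show "0 \<le> \<alpha> * real N / (1 + 2 * \<delta>) - 1 / \<delta>" by simp
  qed (use N0 k0 \<delta> in auto)
  moreover have "(\<alpha> * real N) / real N * ((\<alpha> * real N) / (1 + 2 * \<delta>) - 1 / \<delta>) = g / (1 + 2 * \<delta>) - \<alpha> / \<delta>"
    using N0 by (simp add: g_def power2_eq_square algebra_simps)
  moreover have "(1 - \<epsilon> / 2) * g \<le> g / (1 + 2 * \<delta>)"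
  proof -
    have "(1 - \<epsilon> / 2) * (1 + 2 * \<delta>) = 1 - \<epsilon> / 4 - \<epsilon>\<^sup>2 / 8" by (simp add: \<delta>_def algebra_simps power2_eq_square)
    also have "\<dots> \<le> 1" using \<epsilon> zero_le_power2[of \<epsilon>] by linarith
    finally have "(1 - \<epsilon> / 2) * (1 + 2 * \<delta>) * g \<le> 1 * g" using aN by (intro mult_right_mono) (auto simp: g_def)
    then show ?thesis using \<delta> by (simp add: pos_le_divide_eq mult_ac)
  qed
  moreover have "\<alpha> / \<delta> \<le> \<epsilon> / 2 * g"
  proof -
    have "\<alpha> / \<delta> \<le> 1 / \<delta>" using \<alpha> \<delta> by (intro divide_right_mono) auto
    also have "\<dots> = \<epsilon> / 2 * (16 / \<epsilon>\<^sup>2)" using \<epsilon> by (simp add: \<delta>_def power2_eq_square)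
    also have "\<dots> \<le> \<epsilon> / 2 * g" using g16 \<epsilon> by (intro mult_left_mono) auto
    finally show ?thesis .
  qed
  moreover have "(1 - \<epsilon>) * g = (1 - \<epsilon> / 2) * g - \<epsilon> / 2 * g" by (simp add: algebra_simps)
  ultimately have "(1 - \<epsilon>) * g \<le> real M" by linarith
  then show ?thesis by (simp add: g_def)
qed

section \<open>Sparse sets and the theorem\<close>

lemma sidon_mod_bose_chowla:
  fixes p f :: nat
  assumes p: "prime p" and f: "f > 0"
  defines "q \<equiv> p ^ f"
  shows "\<exists>S\<subseteq>{0..<int (q\<^sup>2 - 1)}. card S = q \<and> sidon_mod (int (q\<^sup>2 - 1)) S"
proof -
  obtain S where S: "S \<subseteq> {..<q\<^sup>2 - 1}" "card S = q"
    "\<forall>a\<in>S. \<forall>b\<in>S. \<forall>a'\<in>S. \<forall>b'\<in>S. a \<noteq> b \<and> [a + b' = a' + b] (mod q\<^sup>2 - 1) \<longrightarrow> a = a' \<and> b = b'"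
    using bose_chowla[OF p f] unfolding q_def by blast
  show ?thesis
  proof (intro exI[of _ "int ` S"] conjI)
    show "int ` S \<subseteq> {0..<int (q\<^sup>2 - 1)}" using S(1) by auto
    show "card (int ` S) = q" using S(2) by (simp add: card_image)
    show "sidon_mod (int (q\<^sup>2 - 1)) (int ` S)" unfolding sidon_mod_def
    proof (intro ballI impI)
      fix x y x' y' assume "x \<in> int ` S" "y \<in> int ` S" "x' \<in> int ` S" "y' \<in> int ` S" and h: "x \<noteq> y \<and> [x - y = x' - y'] (mod int (q\<^sup>2 - 1))"
      then obtain a b a' b' where m: "a \<in> S" "b \<in> S" "a' \<in> S" "b' \<in> S" and e: "x = int a" "y = int b" "x' = int a'" "y' = int b'" by blast
      have "[int (a + b') = int (a' + b)] (mod int (q\<^sup>2 - 1))"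
        using h unfolding e by (simp add: cong_iff_dvd_diff algebra_simps)
      then have cg: "[a + b' = a' + b] (mod q\<^sup>2 - 1)" by (simp only: cong_int_iff)
      have "a \<noteq> b" using h e by simp
      then show "x = x' \<and> y = y'" using S(3)[rule_format, OF m conjI[OF _ cg]] e by simp
    qed
  qed
qed

text \<open>With q^2 slightly above g' N, the modulus v = (q^2 - 1)/g' is slightly above N, and the
  folded set has density about q/v, that is about sqrt(g'/N). Taking g' above (1 + \<epsilon>/2) g
  makes this exceed \<alpha> by a margin that pays for the inaccuracy of q and for the collisions,
  while g' \<le> (1 + \<epsilon>) g is the bound on representations.\<close>

lemma structured_regime:
  fixes \<epsilon> C1 :: real
  assumes \<epsilon>: "0 < \<epsilon>" "\<epsilon> \<le> 1"
  shows "\<exists>G N0. \<forall>N \<alpha>. N \<ge> N0 \<and> 0 < \<alpha> \<and> \<alpha> < 1 \<and> G \<le> \<alpha>\<^sup>2 * real N \<and> \<alpha>\<^sup>2 * real N \<le> C1 * ln (real N) \<longrightarrow>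
    (\<exists>A\<subseteq>{1..int N}. \<alpha> * real N \<le> real (card A) \<and> (\<forall>d. 1 \<le> d \<and> d < int N \<longrightarrow> real (diff_rep A d) \<le> (1 + \<epsilon>) * (\<alpha>\<^sup>2 * real N)))"
proof -
  \<comment> \<open>ln q will overshoot its ideal value by at most 3 \<kappa>/2, and collisions cost
    at most a factor 1 - \<kappa>; the total 5 \<kappa>/2 = \<epsilon>/16 fits into the gain
    \<epsilon>/6 in density.\<close>
  define \<kappa> where "\<kappa> = \<epsilon> / 40"
  have \<kappa>: "0 < \<kappa>" "\<kappa> \<le> 1/40" using \<epsilon> by (auto simp: \<kappa>_def)
  define K where "K = nat \<lceil>8 / \<epsilon>\<rceil>"
  have K8: "8 / \<epsilon> \<le> real K" unfolding K_def by (rule real_nat_ceiling_ge)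
  have K1: "K \<ge> 1" using K8 \<epsilon> by (cases "K = 0") (auto simp: divide_le_0_iff)
  have invK: "1 / real K \<le> \<epsilon> / 8" using K8 K1 \<epsilon> by (simp add: field_simps)
  obtain g0 where g0: "\<And>g. g \<ge> g0 \<Longrightarrow> \<exists>g' f. 0 < f \<and> 0 < g' \<and> g' \<le> g \<and> (1 - 1 / real K) * real g \<le> real g' \<and>
    real f \<le> real g powr (57/100) \<and> (\<forall>n. coprime n g' \<longrightarrow> int g' dvd int n ^ f - 1)"
    using universal_modulus[OF K1] by blast
  obtain L0 where L0: "L0 \<ge> 1" "\<And>L. L \<ge> L0 \<Longrightarrow> \<exists>p. prime p \<and> \<bar>ln (real p) - L\<bar> \<le> L powr (-7/5)"
    using prime_near by blast
  \<comment> \<open>To bound f: \<open>gn\<close> will be at most l^(101/100), and (101/100)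
    (57/100) < 58/100.\<close>
  define F where "F = (\<lambda>l::real. l powr (58/100))"
  \<comment> \<open>The exponent of l is 58/100 - (7/5) (42/100) = -8/1000: the accuracy of
    \<open>prime_near\<close> just survives multiplication by f.\<close>
  have "\<forall>\<^sub>F l in at_top. F l * (2 * F l / l) powr (7/5) < \<kappa> / 2"
  proof (rule order_tendstoD)
    show "((\<lambda>l. F l * (2 * F l / l) powr (7/5)) \<longlongrightarrow> 0) at_top" unfolding F_def by real_asymp
  qed (use \<kappa> in auto)
  moreover have "\<forall>\<^sub>F l in at_top. L0 \<le> l / (2 * F l)"
  proof -
    have "filterlim (\<lambda>l. l / (2 * F l)) at_top at_top" unfolding F_def by real_asymp
    then show ?thesis by (simp add: filterlim_at_top)
  qed
  moreover have "\<forall>\<^sub>F l in at_top. l powr (101/100) < exp (l / (2 * F l) - 1)" unfolding F_def by real_asymp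
  moreover have "\<forall>\<^sub>F l in at_top. sqrt (l powr (101/100) / exp l) < \<kappa>"
    by (rule order_tendstoD[where y = 0]) (real_asymp, use \<kappa> in simp)
  moreover have "\<forall>\<^sub>F l in at_top. 2 * C1 \<le> l powr (1/100)"
  proof -
    have "filterlim (\<lambda>l::real. l powr (1/100)) at_top at_top" by real_asymp
    then show ?thesis by (simp add: filterlim_at_top)
  qed
  moreover have "\<forall>\<^sub>F l::real in at_top. 1 / \<kappa> \<le> exp l" using exp_at_top by (simp add: filterlim_at_top)
  moreover have "\<forall>\<^sub>F l::real in at_top. 1 \<le> l" by (rule eventually_ge_at_top)
  ultimately have "\<forall>\<^sub>F l in at_top. F l * (2 * F l / l) powr (7/5) < \<kappa> / 2 \<and> L0 \<le> l / (2 * F l) \<and> l powr (101/100) < exp (l / (2 * F l) - 1)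
     \<and> sqrt (l powr (101/100) / exp l) < \<kappa> \<and> 2 * C1 \<le> l powr (1/100) \<and> 1 / \<kappa> \<le> exp l \<and> 1 \<le> l"
    by eventually_elim auto
  then obtain l0 where l0: "\<And>l. l \<ge> l0 \<Longrightarrow> F l * (2 * F l / l) powr (7/5) < \<kappa> / 2 \<and> L0 \<le> l / (2 * F l) \<and> l powr (101/100) < exp (l / (2 * F l) - 1)
     \<and> sqrt (l powr (101/100) / exp l) < \<kappa> \<and> 2 * C1 \<le> l powr (1/100) \<and> 1 / \<kappa> \<le> exp l \<and> 1 \<le> l"
    by (auto simp: eventually_at_top_linorder)
  \<comment> \<open>4 / \<epsilon> makes the rounding in \<open>gn\<close> cost at most
    (\<epsilon>/4) g.\<close>
  define G where "G = max (real g0 + 1) (4 / \<epsilon>)"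
  define N0 where "N0 = max 1 (nat \<lceil>exp l0\<rceil>)"
  show ?thesis
  proof (rule exI[of _ G], rule exI[of _ N0], intro allI impI)
    fix N :: nat and \<alpha> :: real
    assume H: "N \<ge> N0 \<and> 0 < \<alpha> \<and> \<alpha> < 1 \<and> G \<le> \<alpha>\<^sup>2 * real N \<and> \<alpha>\<^sup>2 * real N \<le> C1 * ln (real N)"
    define g where "g = \<alpha>\<^sup>2 * real N"
    have g: "g \<ge> real g0 + 1" "g \<ge> 4 / \<epsilon>" using H by (auto simp: G_def g_def)
    have g_pos: "g \<ge> 1" using g(1) by linarith
    define l where "l = ln (real N)"
    have Npos: "real N \<ge> 1" using H by (auto simp: N0_def)
    have "exp l0 \<le> real N" using H by (auto simp: N0_def)
    then have "l0 \<le> l" unfolding l_def using Npos by (subst ln_ge_iff) auto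
    note l = l0[OF this]
    have expl: "exp l = real N" using Npos by (simp add: l_def)
    have l1: "l \<ge> 1" using l by blast
    have g_le: "2 * g \<le> l powr (101/100)"
    proof -
      have "2 * g \<le> 2 * C1 * l" using H by (simp add: g_def l_def)
      also have "\<dots> \<le> l powr (1/100) * l" using l by (intro mult_right_mono) auto
      also have "\<dots> = l powr (101/100)" using l1 powr_add[of l "1/100" 1] by simp
      finally show ?thesis .
    qed
    define gn where "gn = nat \<lfloor>(1 + \<epsilon>) * g\<rfloor>"
    have "1 * g \<le> (1 + \<epsilon>) * g" using \<epsilon> g_pos by (intro mult_right_mono) auto
    then have "real gn = of_int \<lfloor>(1 + \<epsilon>) * g\<rfloor>" unfolding gn_def using g_pos by simp
    then have gn1: "real gn \<le> (1 + \<epsilon>) * g" "(1 + \<epsilon>) * g - 1 \<le> real gn" by linarith+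
    then have "real g0 \<le> real gn" using \<open>1 * g \<le> (1 + \<epsilon>) * g\<close> g(1) by linarith
    then have gn2: "g0 \<le> gn" by simp
    obtain g' f where gf: "0 < f" "0 < g'" "g' \<le> gn" "(1 - 1 / real K) * real gn \<le> real g'"
      "real f \<le> real gn powr (57/100)" "\<And>n. coprime n g' \<Longrightarrow> int g' dvd int n ^ f - 1"
      using g0[OF gn2] by blast
    have g'_up: "real g' \<le> (1 + \<epsilon>) * g" using gf(3) gn1(1) by linarith
    have "(1 + \<epsilon>) * g \<le> 2 * g" using \<epsilon> g_pos by (intro mult_right_mono) auto
    then have g'_2g: "real g' \<le> 2 * g" and gn_2g: "real gn \<le> 2 * g" using g'_up gn1(1) by linarith+
    have g'_low: "(1 + \<epsilon> / 2) * g \<le> real g'"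
    proof -
      have "(1 + \<epsilon> / 2) * g \<le> (1 - \<epsilon> / 8) * ((1 + \<epsilon>) * g - 1)"
      proof -
        have "1 \<le> \<epsilon> / 4 * g" using g(2) \<epsilon> by (simp add: field_simps)
        moreover have "(1 - \<epsilon> / 8) * ((1 + \<epsilon>) * g - 1) = (1 + \<epsilon> / 2) * g + \<epsilon> / 4 * g + (\<epsilon> / 8 - \<epsilon>\<^sup>2 / 8) * g - 1 + \<epsilon> / 8"
          by (simp add: field_simps power2_eq_square)
        moreover have "0 \<le> (\<epsilon> / 8 - \<epsilon>\<^sup>2 / 8) * g" using \<epsilon> g_pos by (intro mult_nonneg_nonneg) (auto simp: power2_eq_square mult_left_le)
        ultimately show ?thesis using \<epsilon> by linarith
      qed
      also have "\<dots> \<le> (1 - 1 / real K) * real gn"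
      proof (rule mult_mono)
        show "0 \<le> (1 + \<epsilon>) * g - 1" using \<open>1 * g \<le> (1 + \<epsilon>) * g\<close> g_pos by linarith
        show "0 \<le> 1 - 1 / real K" using K1 by simp
      qed (use invK gn1 in auto)
      finally show ?thesis using gf(4) by linarith
    qed
    have fF: "real f \<le> F l"
    proof -
      have "real f \<le> real gn powr (57/100)" by (rule gf)
      also have "\<dots> \<le> (l powr (101/100)) powr (57/100)" using gn_2g g_le by (intro powr_mono2) auto
      also have "\<dots> = l powr (5757/10000)" by (simp add: powr_powr)
      also have "\<dots> \<le> F l" unfolding F_def using l1 by (intro powr_mono) auto
      finally show ?thesis .
    qed
    have fpos: "real f > 0" using gf by simp
    have g'1: "real g' \<ge> 1" using gf by simp
    \<comment> \<open>This aims at ln q = f L = ln sqrt(g' N) + \<kappa>. The offset \<kappa>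
      exceeds the error \<kappa>/2, which forces q^2 > g' N and hence v \<ge> N.\<close>
    define L where "L = (ln (real g' * real N) / 2 + \<kappa>) / real f"
    have lnge: "ln (real g' * real N) \<ge> l"
      using g'1 Npos by (simp add: l_def ln_mult)
    have L_ge: "l / (2 * F l) \<le> L"
    proof -
      have "l / (2 * F l) \<le> l / (2 * real f)" using fF fpos l1 by (intro divide_left_mono) auto
      also have "\<dots> = l / 2 / real f" by simp
      also have "\<dots> \<le> L" unfolding L_def using lnge \<kappa> by (intro divide_right_mono) auto
      finally show ?thesis .
    qed
    have LL0: "L \<ge> L0" using L_ge l by linarith
    then have L1: "L \<ge> 1" using L0(1) by linarith
    obtain p where p: "prime p" "\<bar>ln (real p) - L\<bar> \<le> L powr (-7/5)" using L0(2)[OF LL0] by blast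
    have w1: "L powr (-7/5) \<le> 1" using powr_mono[of "-7/5" 0 L] L1 by simp
    have Fpos: "F l > 0" unfolding F_def using l1 by simp
    have fw: "real f * L powr (-7/5) \<le> \<kappa> / 2"
    proof -
      have "L powr (-7/5) \<le> (l / (2 * F l)) powr (-7/5)"
        using L_ge l1 Fpos by (intro powr_mono2') auto
      also have "\<dots> = (2 * F l / l) powr (7/5)"
        using l1 Fpos by (simp add: powr_divide powr_minus field_simps)
      finally have "real f * L powr (-7/5) \<le> F l * (2 * F l / l) powr (7/5)" using fF by (intro mult_mono) auto
      then show ?thesis using l by linarith
    qed
    define q where "q = p ^ f"
    have p0: "real p > 0" using prime_gt_0_nat[OF p(1)] by simp
    have qpos: "real q > 0" unfolding q_def using p0 by simp
    have lnq: "ln (real q) = real f * ln (real p)" unfolding q_def using p0 by (simp add: ln_realpow)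
    have fL: "real f * L = ln (real g' * real N) / 2 + \<kappa>" unfolding L_def using fpos by simp
    have "\<bar>real f * ln (real p) - real f * L\<bar> = real f * \<bar>ln (real p) - L\<bar>"
      using fpos by (simp add: abs_mult right_diff_distrib[symmetric])
    also have "\<dots> \<le> real f * L powr (-7/5)" using p(2) fpos by (intro mult_left_mono) auto
    finally have dev: "\<bar>ln (real q) - (ln (real g' * real N) / 2 + \<kappa>)\<bar> \<le> \<kappa> / 2" using fw lnq fL by linarith
    define Y where "Y = sqrt (real g' * real N)"
    have Ypos: "Y > 0" unfolding Y_def using g'1 Npos by (intro real_sqrt_gt_zero mult_pos_pos) auto
    have lnY: "ln Y = ln (real g' * real N) / 2" unfolding Y_def using g'1 Npos by (simp add: ln_sqrt)
    have qlow: "Y * exp (\<kappa> / 2) \<le> real q"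
    proof -
      have "ln (Y * exp (\<kappa> / 2)) = ln Y + \<kappa> / 2" using Ypos by (simp add: ln_mult)
      then have "ln (Y * exp (\<kappa> / 2)) \<le> ln (real q)" using dev lnY by linarith
      then show ?thesis using Ypos qpos by (subst (asm) ln_le_cancel_iff) auto
    qed
    have qup: "real q \<le> Y * exp (3 * \<kappa> / 2)"
    proof -
      have "ln (Y * exp (3 * \<kappa> / 2)) = ln Y + 3 * \<kappa> / 2" using Ypos by (simp add: ln_mult)
      then have "ln (real q) \<le> ln (Y * exp (3 * \<kappa> / 2))" using dev lnY by linarith
      then show ?thesis using Ypos qpos by (subst (asm) ln_le_cancel_iff) auto
    qed
    \<comment> \<open>p even exceeds g': ln p is at least a positive power of l up to constants,
      while g' is at most l^(101/100).\<close>
    have "coprime p g'"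
    proof -
      have "real g' \<le> l powr (101/100)" using g'_2g g_le by linarith
      also have "\<dots> < exp (l / (2 * F l) - 1)" using l by blast
      also have "\<dots> \<le> exp (ln (real p))" using L_ge p(2) w1 by (subst exp_le_cancel_iff) linarith
      also have "\<dots> = real p" using p0 by simp
      finally have "g' < p" by simp
      then have "\<not> p dvd g'" using gf(2) by (auto dest: dvd_imp_le)
      then show ?thesis using p(1) by (simp add: prime_imp_coprime)
    qed
    then have "int g' dvd int q - 1" using gf(6)[of p] by (simp add: q_def)
    then have "int g' dvd (int q - 1) * (int q + 1)" by simp
    moreover have q1: "q \<ge> 1" using qpos by simp
    moreover have "int (q\<^sup>2 - 1) = (int q - 1) * (int q + 1)"
      using q1 by (simp add: of_nat_diff power2_eq_square algebra_simps)
    ultimately have "int g' dvd int (q\<^sup>2 - 1)" by simp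
    then have "g' dvd q\<^sup>2 - 1" by (simp only: int_dvd_int_iff)
    then obtain v where v: "q\<^sup>2 - 1 = g' * v" by (rule dvdE)
    have Y2: "Y\<^sup>2 = real g' * real N" unfolding Y_def using g'1 Npos by simp
    have q2big: "real g' * real N + 1 \<le> (real q)\<^sup>2"
    proof -
      have "1 \<le> \<kappa> * exp l" using l \<kappa> by (simp add: field_simps)
      then have "1 * 1 \<le> real g' * (\<kappa> * real N)" using g'1 expl by (intro mult_mono) auto
      then have "real g' * real N + 1 \<le> real g' * real N * (1 + \<kappa>)" by (simp add: algebra_simps)
      also have "\<dots> \<le> real g' * real N * exp \<kappa>" using exp_ge_add_one_self[of \<kappa>] by (intro mult_left_mono) auto
      also have "\<dots> = (Y * exp (\<kappa> / 2))\<^sup>2" by (simp add: power_mult_distrib Y2 exp_double[symmetric])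
      also have "\<dots> \<le> (real q)\<^sup>2" using qlow Ypos by (intro power_mono) auto
      finally show ?thesis .
    qed
    have gv: "real g' * real v = (real q)\<^sup>2 - 1"
    proof -
      have "real (q\<^sup>2 - 1) = (real q)\<^sup>2 - 1" using q1 by (simp add: of_nat_diff)
      then show ?thesis using v by (metis of_nat_mult)
    qed
    have "real g' * real N \<le> real g' * real v" using q2big gv by linarith
    then have Nv: "N \<le> v" using g'1 by simp
    have vpos: "v > 0" using Nv Npos by (cases v) auto
    obtain S where S: "S \<subseteq> {0..<int (q\<^sup>2 - 1)}" "card S = q" "sidon_mod (int (q\<^sup>2 - 1)) S"
      using sidon_mod_bose_chowla[OF p(1) gf(1)] unfolding q_def by blast
    have intv: "int (q\<^sup>2 - 1) = int g' * int v" unfolding v by (rule of_nat_mult)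
    obtain A where A: "A \<subseteq> {1..int N}" "N * card S \<le> v * card A + N * g'" "\<And>d. 1 \<le> d \<Longrightarrow> d < int N \<Longrightarrow> diff_rep A d \<le> g'"
      using fold_sidon_mod[OF S(3)[unfolded intv] S(1)[unfolded intv] gf(2) vpos Nv] by blast
    \<comment> \<open>Up to the 1 in q^2 - 1 this says (q - g')/v \<ge> \<alpha>, the density left
      after the collisions.\<close>
    have rat: "\<alpha> * (real q)\<^sup>2 \<le> real g' * (real q - real g')"
    proof -
      define r where "r = sqrt (real g' / real N)"
      have rY: "real g' = r * Y" unfolding r_def Y_def real_sqrt_mult[symmetric] using Npos g'1 by simp
      have r0: "r > 0" unfolding r_def using g'1 Npos by simp
      have rup: "r \<le> \<kappa>"
      proof -
        have "r \<le> sqrt (l powr (101/100) / exp l)" unfolding r_def expl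
          using g'_2g g_le Npos by (intro real_sqrt_le_mono divide_right_mono) auto
        then show ?thesis using l by linarith
      qed
      have rlow: "\<alpha> * (1 + \<epsilon> / 6) \<le> r"
      proof -
        have "(\<alpha> * (1 + \<epsilon> / 6))\<^sup>2 = \<alpha>\<^sup>2 * (1 + \<epsilon> / 6)\<^sup>2" by (simp add: power_mult_distrib)
        also have "\<dots> \<le> \<alpha>\<^sup>2 * (1 + \<epsilon> / 2)"
        proof (rule mult_left_mono)
          have "(1 + \<epsilon> / 6)\<^sup>2 = 1 + \<epsilon> / 3 + \<epsilon>\<^sup>2 / 36" by (simp add: power2_eq_square algebra_simps)
          moreover have "\<epsilon>\<^sup>2 \<le> \<epsilon>" using \<epsilon> by (simp add: power2_eq_square mult_left_le)
          ultimately show "(1 + \<epsilon> / 6)\<^sup>2 \<le> 1 + \<epsilon> / 2" using \<epsilon> by linarith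
        qed simp
        also have "\<dots> = (1 + \<epsilon> / 2) * g / real N" using Npos by (simp add: g_def)
        also have "\<dots> \<le> real g' / real N" using g'_low by (intro divide_right_mono) auto
        finally show ?thesis unfolding r_def by (rule real_le_rsqrt)
      qed
      define E where "E = exp (3 * \<kappa> / 2)"
      have E: "E > 0" by (simp add: E_def)
      have q_ge_Y: "Y \<le> real q"
      proof -
        have "Y * 1 \<le> Y * exp (\<kappa> / 2)" using Ypos \<kappa> by (intro mult_left_mono) auto
        then show ?thesis using qlow by simp
      qed
      have "1 \<le> (1 + \<epsilon> / 6) * ((1 - \<kappa>) * (1 - 3 * \<kappa> / 2))"
      proof -
        have "1 - 5 * \<kappa> / 2 \<le> (1 - \<kappa>) * (1 - 3 * \<kappa> / 2)" by (simp add: algebra_simps)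
        then have "(1 + \<epsilon> / 6) * (1 - 5 * \<kappa> / 2) \<le> (1 + \<epsilon> / 6) * ((1 - \<kappa>) * (1 - 3 * \<kappa> / 2))" using \<epsilon> by (intro mult_left_mono) auto
        moreover have "(1 + \<epsilon> / 6) * (1 - 5 * \<kappa> / 2) = 1 + \<epsilon> / 6 - \<epsilon> / 16 - \<epsilon>\<^sup>2 / 96" by (simp add: \<kappa>_def field_simps power2_eq_square)
        moreover have "\<epsilon>\<^sup>2 \<le> \<epsilon>" using \<epsilon> by (simp add: power2_eq_square mult_left_le)
        ultimately show ?thesis using \<epsilon> by linarith
      qed
      also have "\<dots> \<le> (1 + \<epsilon> / 6) * ((1 - \<kappa>) * exp (- (3 * \<kappa> / 2)))"
        using exp_ge_add_one_self[of "- (3 * \<kappa> / 2)"] \<epsilon> \<kappa> by (intro mult_left_mono) auto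
      finally have one: "1 \<le> (1 + \<epsilon> / 6) * ((1 - \<kappa>) * exp (- (3 * \<kappa> / 2)))" .
      have "1 * E \<le> (1 + \<epsilon> / 6) * ((1 - \<kappa>) * exp (- (3 * \<kappa> / 2))) * E"
        using one E by (intro mult_right_mono) auto
      also have "\<dots> = (1 + \<epsilon> / 6) * (1 - \<kappa>)" by (simp add: E_def exp_minus)
      finally have E_le: "E \<le> (1 + \<epsilon> / 6) * (1 - \<kappa>)" by simp
      have "\<alpha> * real q \<le> \<alpha> * (Y * E)" using qup H by (intro mult_left_mono) (auto simp: E_def)
      also have "\<dots> \<le> \<alpha> * (Y * ((1 + \<epsilon> / 6) * (1 - \<kappa>)))" using E_le Ypos H by (intro mult_left_mono) auto
      also have "\<dots> = (\<alpha> * (1 + \<epsilon> / 6)) * Y * (1 - \<kappa>)" by (simp add: mult_ac)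
      also have "\<dots> \<le> r * Y * (1 - \<kappa>)" using rlow Ypos \<kappa> by (intro mult_right_mono) auto
      also have "\<dots> = real g' * (1 - \<kappa>)" by (simp add: rY)
      finally have a1: "\<alpha> * real q \<le> real g' * (1 - \<kappa>)" .
      have a2: "real q * (1 - \<kappa>) \<le> real q - real g'"
      proof -
        have "real g' \<le> \<kappa> * Y" unfolding rY using rup Ypos by (intro mult_right_mono) auto
        also have "\<dots> \<le> \<kappa> * real q" using q_ge_Y \<kappa> by (intro mult_left_mono) auto
        finally show ?thesis by (simp add: algebra_simps)
      qed
      have "\<alpha> * (real q)\<^sup>2 = \<alpha> * real q * real q" by (simp add: power2_eq_square)
      also have "\<dots> \<le> real g' * (1 - \<kappa>) * real q" using a1 by (intro mult_right_mono) auto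
      also have "\<dots> = real g' * (real q * (1 - \<kappa>))" by (simp add: mult_ac)
      also have "\<dots> \<le> real g' * (real q - real g')" using a2 by (intro mult_left_mono) auto
      finally show ?thesis .
    qed
    have "\<alpha> * real N \<le> real (card A)"
    proof -
      have "real (N * card S) \<le> real (v * card A + N * g')" using A(2) by (rule of_nat_mono)
      then have cA: "real N * (real q - real g') \<le> real v * real (card A)" by (simp add: S(2) algebra_simps)
      have "real g' * (\<alpha> * real v) = \<alpha> * ((real q)\<^sup>2 - 1)" using gv by (simp add: mult_ac)
      also have "\<dots> \<le> \<alpha> * (real q)\<^sup>2" using H by (intro mult_left_mono) auto
      also have "\<dots> \<le> real g' * (real q - real g')" by (rule rat)
      finally have "\<alpha> * real v \<le> real q - real g'" using g'1 by simp
      then have "real N * (\<alpha> * real v) \<le> real N * (real q - real g')" by (intro mult_left_mono) auto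
      then have "real v * (\<alpha> * real N) \<le> real v * real (card A)" using cA by (simp add: mult_ac)
      then show ?thesis using vpos by simp
    qed
    moreover have "real (diff_rep A d) \<le> (1 + \<epsilon>) * (\<alpha>\<^sup>2 * real N)" if "1 \<le> d" "d < int N" for d
      using of_nat_mono[OF A(3)[OF that], where 'a = real] g'_up by (simp add: g_def)
    ultimately show "\<exists>A\<subseteq>{1..int N}. \<alpha> * real N \<le> real (card A) \<and> (\<forall>d. 1 \<le> d \<and> d < int N \<longrightarrow> real (diff_rep A d) \<le> (1 + \<epsilon>) * (\<alpha>\<^sup>2 * real N))"
      using A(1) by blast
  qed
qed

text \<open>The constant C1 of the random regime is fixed first; \<open>structured_regime\<close>
  accepts any constant in that place, so the two cases meet at C1 ln N without a gap.\<close>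

lemma diff_rep_upper_bound:
  fixes \<epsilon> :: real
  assumes \<epsilon>: "0 < \<epsilon>" "\<epsilon> \<le> 1"
  shows "\<exists>C N0. \<forall>N \<alpha>. N \<ge> N0 \<and> 0 < \<alpha> \<and> \<alpha> < 1 \<and> C \<le> \<alpha>\<^sup>2 * real N \<longrightarrow>
    (\<exists>A\<subseteq>{1..int N}. \<alpha> * real N \<le> real (card A) \<and> (\<forall>d. 1 \<le> d \<and> d < int N \<longrightarrow> real (diff_rep A d) \<le> (1 + \<epsilon>) * (\<alpha>\<^sup>2 * real N)))"
proof -
  obtain C1 where C1: "\<And>N \<alpha>. N \<ge> 2 \<and> 0 < \<alpha> \<and> \<alpha> < 1 \<and> C1 \<le> \<alpha>\<^sup>2 * real N \<and> C1 * ln (real N) \<le> \<alpha>\<^sup>2 * real N \<Longrightarrow>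
    \<exists>A\<subseteq>{1..int N}. \<alpha> * real N \<le> real (card A) \<and> (\<forall>d. 1 \<le> d \<and> d < int N \<longrightarrow> real (diff_rep A d) \<le> (1 + \<epsilon>) * (\<alpha>\<^sup>2 * real N))"
    using random_regime[OF \<epsilon>] by blast
  obtain G N0 where G: "\<And>N \<alpha>. N \<ge> N0 \<and> 0 < \<alpha> \<and> \<alpha> < 1 \<and> G \<le> \<alpha>\<^sup>2 * real N \<and> \<alpha>\<^sup>2 * real N \<le> C1 * ln (real N) \<Longrightarrow>
    \<exists>A\<subseteq>{1..int N}. \<alpha> * real N \<le> real (card A) \<and> (\<forall>d. 1 \<le> d \<and> d < int N \<longrightarrow> real (diff_rep A d) \<le> (1 + \<epsilon>) * (\<alpha>\<^sup>2 * real N))"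
    using structured_regime[OF \<epsilon>, of C1] by blast
  show ?thesis
  proof (rule exI[of _ "max C1 G"], rule exI[of _ "max 2 N0"], intro allI impI)
    fix N :: nat and \<alpha> :: real
    assume H: "N \<ge> max 2 N0 \<and> 0 < \<alpha> \<and> \<alpha> < 1 \<and> max C1 G \<le> \<alpha>\<^sup>2 * real N"
    show "\<exists>A\<subseteq>{1..int N}. \<alpha> * real N \<le> real (card A) \<and> (\<forall>d. 1 \<le> d \<and> d < int N \<longrightarrow> real (diff_rep A d) \<le> (1 + \<epsilon>) * (\<alpha>\<^sup>2 * real N))"
    proof (cases "C1 * ln (real N) \<le> \<alpha>\<^sup>2 * real N")
      case True
      then show ?thesis using C1[of N \<alpha>] H by auto
    next
      case False
      then show ?thesis using G[of N \<alpha>] H by auto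
    qed
  qed
qed

section \<open>From bounds for sets to the extremal function\<close>

lemma min_max_diff_rep_eq_Min_image:
  "min_max_diff_rep N \<alpha> = Min ((\<lambda>A. Max (diff_rep A ` {1..<int N})) ` {A. A \<subseteq> {1..int N} \<and> \<alpha> * real N \<le> real (card A)})"
proof -
  have "{diff_rep A d | d. 1 \<le> d \<and> d < int N} = diff_rep A ` {1..<int N}" for A by auto
  then show ?thesis unfolding min_max_diff_rep_def by (simp add: image_Collect)
qed

lemma finite_admissible: "finite {A. A \<subseteq> {1..int N} \<and> \<alpha> * real N \<le> real (card A)}"
  by (rule finite_subset[of _ "Pow {1..int N}"]) auto

lemma min_max_diff_rep_le:
  assumes N: "N \<ge> 2" and A: "A \<subseteq> {1..int N}" "\<alpha> * real N \<le> real (card A)"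
    and B: "\<And>d. 1 \<le> d \<Longrightarrow> d < int N \<Longrightarrow> real (diff_rep A d) \<le> B"
  shows "real (min_max_diff_rep N \<alpha>) \<le> B"
proof -
  have "min_max_diff_rep N \<alpha> \<le> Max (diff_rep A ` {1..<int N})"
    unfolding min_max_diff_rep_eq_Min_image using A finite_admissible by (intro Min_le) auto
  moreover have "Max (diff_rep A ` {1..<int N}) \<in> diff_rep A ` {1..<int N}" using N by (intro Max_in) auto
  then obtain d where "1 \<le> d" "d < int N" "Max (diff_rep A ` {1..<int N}) = diff_rep A d" by auto
  ultimately show ?thesis using B[of d] by simp
qed

lemma min_max_diff_rep_ge:
  assumes N: "N \<ge> 2" and \<alpha>: "\<alpha> \<le> 1"
    and B: "\<And>A M. A \<subseteq> {1..int N} \<Longrightarrow> \<alpha> * real N \<le> real (card A) \<Longrightarrow> (\<And>d. 1 \<le> d \<Longrightarrow> d < int N \<Longrightarrow> diff_rep A d \<le> M) \<Longrightarrow> B \<le> real M"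
  shows "B \<le> real (min_max_diff_rep N \<alpha>)"
proof -
  have "\<alpha> * real N \<le> real (card {1..int N})" using mult_right_mono[OF \<alpha>, of "real N"] by simp
  then have "{A. A \<subseteq> {1..int N} \<and> \<alpha> * real N \<le> real (card A)} \<noteq> {}" by blast
  then have "min_max_diff_rep N \<alpha> \<in> (\<lambda>A. Max (diff_rep A ` {1..<int N})) ` {A. A \<subseteq> {1..int N} \<and> \<alpha> * real N \<le> real (card A)}"
    unfolding min_max_diff_rep_eq_Min_image using finite_admissible by (intro Min_in) auto
  then obtain A where A: "A \<subseteq> {1..int N}" "\<alpha> * real N \<le> real (card A)" "min_max_diff_rep N \<alpha> = Max (diff_rep A ` {1..<int N})" by auto
  show ?thesis
  proof (rule B[OF A(1,2)])
    fix d assume "1 \<le> d" "d < int N"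
    then show "diff_rep A d \<le> min_max_diff_rep N \<alpha>" unfolding A(3) by (intro Max_ge) auto
  qed
qed

theorem theorem4p1:
  fixes \<alpha> :: "nat \<Rightarrow> real"
  assumes "\<And>N. N \<ge> 1 \<Longrightarrow> 0 < \<alpha> N \<and> \<alpha> N < 1"
    and "filterlim (\<lambda>N. (\<alpha> N)\<^sup>2 * real N) at_top sequentially"
  shows "(\<lambda>N. real (min_max_diff_rep N (\<alpha> N))) \<sim>[sequentially] (\<lambda>N. (\<alpha> N)\<^sup>2 * real N)"
proof (rule asymp_equivI', rule tendstoI)
  fix e :: real assume e: "e > 0"
  \<comment> \<open>Strictly below e, because the two bounds are not strict, and at most 1, as both
    of them require.\<close>
  define \<epsilon> where "\<epsilon> = min (e / 2) 1"
  have \<epsilon>: "0 < \<epsilon>" "\<epsilon> \<le> 1" "\<epsilon> < e" using e by (auto simp: \<epsilon>_def min_def)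
  obtain C N0 where C: "\<And>N \<alpha>. N \<ge> N0 \<and> 0 < \<alpha> \<and> \<alpha> < 1 \<and> C \<le> \<alpha>\<^sup>2 * real N \<Longrightarrow>
    \<exists>A\<subseteq>{1..int N}. \<alpha> * real N \<le> real (card A) \<and> (\<forall>d. 1 \<le> d \<and> d < int N \<longrightarrow> real (diff_rep A d) \<le> (1 + \<epsilon>) * (\<alpha>\<^sup>2 * real N))"
    using diff_rep_upper_bound[OF \<epsilon>(1,2)] by blast
  have "\<forall>\<^sub>F N in sequentially. max C (16 / \<epsilon>\<^sup>2) \<le> (\<alpha> N)\<^sup>2 * real N"
    using assms(2) unfolding filterlim_at_top by blast
  then show "\<forall>\<^sub>F N in sequentially. dist (real (min_max_diff_rep N (\<alpha> N)) / ((\<alpha> N)\<^sup>2 * real N)) 1 < e"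
    using eventually_ge_at_top[of "max 2 N0"]
  proof eventually_elim
    case (elim N)
    define g where "g = (\<alpha> N)\<^sup>2 * real N"
    have N: "N \<ge> 2" "N \<ge> N0" using elim by auto
    have a: "0 < \<alpha> N" "\<alpha> N < 1" using assms(1)[of N] N by auto
    have g: "g > 0" using a N by (simp add: g_def)
    obtain A where A: "A \<subseteq> {1..int N}" "\<alpha> N * real N \<le> real (card A)" "\<And>d. 1 \<le> d \<Longrightarrow> d < int N \<Longrightarrow> real (diff_rep A d) \<le> (1 + \<epsilon>) * g"
      using C[of N "\<alpha> N"] N a elim unfolding g_def by auto
    have up: "real (min_max_diff_rep N (\<alpha> N)) \<le> (1 + \<epsilon>) * g"
      by (rule min_max_diff_rep_le[OF N(1) A])
    have lo: "(1 - \<epsilon>) * g \<le> real (min_max_diff_rep N (\<alpha> N))" unfolding g_def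
    proof (rule min_max_diff_rep_ge[OF N(1)])
      fix A M assume "A \<subseteq> {1..int N}" "\<alpha> N * real N \<le> real (card A)" "\<And>d. 1 \<le> d \<Longrightarrow> d < int N \<Longrightarrow> diff_rep A d \<le> M"
      then show "(1 - \<epsilon>) * ((\<alpha> N)\<^sup>2 * real N) \<le> real M"
        using elim by (intro diff_rep_lower_bound[OF \<epsilon>(1,2) a]) auto
    qed (use a in simp)
    have "\<bar>real (min_max_diff_rep N (\<alpha> N)) - g\<bar> \<le> \<epsilon> * g" using up lo by (simp add: abs_le_iff algebra_simps)
    then have "\<bar>real (min_max_diff_rep N (\<alpha> N)) / g - 1\<bar> \<le> \<epsilon>"
      using g by (simp add: abs_le_iff field_simps)
    then show ?case using \<epsilon>(3) by (simp add: dist_real_def g_def)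
  qed
qed

end
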